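(* Let $\mathbf A$ be a regular diffusion matrix with parameters $\rho$ and $\kappa$, with the network graph drawn according to an Erdős–Rényi random graph model $\mathscr G(N,p_N)$, where the fraction of observable nodes $|\mathcal S|/N$ converges to $\xi\in(0,1)$. Assume the uniform concentration regime $$p_N=\omega_N\frac{\log N}{N}\to p,\qquad \omega_N\to\infty\quad(N\to\infty).$$ Then each of the following three estimators achieves universal local structural consistency, with scaling sequence $s_N=Np_N$ and with the following bias $\eta$ and identifiability gap $\Gamma$: 1. Granger estimator $[\mathbf R_1]_{\mathcal S}([\mathbf R_0]_{\mathcal S})^{-1}$: $$\eta=\kappa^2p\,\frac{(2\rho-\kappa)(1-\xi)}{1-(\rho^2-2\rho\kappa\xi+\kappa^2\xi)},\qquad \Gamma=\kappa.$$ 2. One-lag estimator $[\mathbf R_1]_{\mathcal S}$: $$\eta=\sigma^2\kappa^2p\,\frac{\rho+\rho(\rho-\kappa)^2+2(\rho-\kappa)}{(1-\rho^2)(1-(\rho-\kappa)^2)^2},\qquad \Gamma=\sigma^2\kappa\,\frac{1+(\rho-\kappa)^2}{(1-(\rho-\kappa)^2)^2}.$$ 3. Residual estimator $[\mathbf R_1]_{\mathcal S}-[\mathbf R_0]_{\mathcal S}$: $$\eta=-\frac{\sigma^2\kappa^2p}{(1+\rho)(1+\rho-\kappa)^2},\qquad \Gamma=\frac{\sigma^2\kappa}{(1+\rho-\kappa)^2}.$$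
   Context: **Graph.** For each $N$, the node set is $\mathcal N=\{1,\dots,N\}$ and $\mathbf G\sim\mathscr G(N,p_N)$ is the adjacency matrix of an undirected Erdős–Rényi graph: $\mathbf g_{ij}$, $i<j$, are independent Bernoulli variables with success probability $p_N$, and $\mathbf g_{ji}=\mathbf g_{ij}$. Degrees: $\mathbf d_i=1+\sum_{\ell\ne i}\mathbf g_{i\ell}$, $\mathbf d_{\min}=\min_i\mathbf d_i$, $\mathbf d_{\max}=\max_i\mathbf d_i$. **Regular diffusion matrix.** $\mathbf A=\pi(\mathbf G)$ is a deterministic function of $\mathbf G$. It is a regular diffusion matrix with parameters $\rho,\kappa$, $0<\kappa\le\rho<1$ (constants not depending on $N$), if it is symmetric with nonnegative entries, $\sum_{\ell=1}^N\mathbf a_{i\ell}=\rho$ for all $i$, and $\frac{\kappa}{\mathbf d_{\max}}\mathbf g_{ij}\le\mathbf a_{ij}\le\frac{\kappa}{\mathbf d_{\min}}\mathbf g_{ij}$ for all $i\ne j$. **Dynamics and correlations.** $\mathbf y_n=\mathbf A\mathbf y_{n-1}+\sigma\mathbf x_n$, $\sigma>0$, with input entries $\mathbf x_i(n)$ i.i.d. in $i$ and $n$, zero mean, unit variance, independent of $\mathbf G$. The steady-state correlation matrix (given $\mathbf A$) is $\mathbf R_0=\lim_n\mathbb E[\mathbf y_n\mathbf y_n^\top]=\sigma^2(I-\mathbf A^2)^{-1}$ and the one-lag correlation matrix is $\mathbf R_1=\lim_n\mathbb E[\mathbf y_n\mathbf y_{n-1}^\top]=\mathbf A\mathbf R_0$;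 both are random only through $\mathbf G$. **Observed nodes.** $\mathcal S=\mathcal S_N\subset\mathcal N$ is the set of observed nodes; $[M]_{\mathcal S}$ is the submatrix with rows and columns in $\mathcal S$ (entries keep their original indices). **Margins.** For an estimator $\widehat{\mathbf A}_{\mathcal S}$ with entries $\widehat{\mathbf a}_{ij}$, let $\underline{\boldsymbol\delta}_N$ and $\overline{\boldsymbol\delta}_N$ be the minimum and the maximum of $\widehat{\mathbf a}_{ij}$ over $i,j\in\mathcal S$, $i\ne j$, $\mathbf a_{ij}=0$; let $\underline{\boldsymbol\Delta}_N$ and $\overline{\boldsymbol\Delta}_N$ be the minimum and the maximum of $\widehat{\mathbf a}_{ij}$ over $i,j\in\mathcal S$, $i\neq j$, $\mathbf a_{ij}>0$. If all pairs in $\mathcal S$ are connected, or all are disconnected, the undefined margins are given arbitrary values; it is a standing assumption that the probability of these degenerate events tends to $0$ as $N\to\infty$. **Universal local structural consistency.** $\widehat{\mathbf A}_{\mathcal S}$ achieves universal local structural consistency, with bias $\eta\in\mathbb R$, identifiability gap $\Gamma>0$ and scaling sequence $s_N$, if for every $\epsilon>0$, as $N\to\infty$, each of the four events $|s_N\underline{\boldsymbol\delta}_N-\eta|<\epsilon$, $|s_N\overline{\boldsymbol\delta}_N-\eta|<\epsilon$, $|s_N\underline{\boldsymbol\Delta}_N-(\eta+\Gamma)|<\epsilon$, $|s_N\overline{\boldsymbol\Delta}_N-(\eta+\Gamma)|<\epsilon$ has probability tending to $1$. *)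

theory Defs
  imports "HOL-Probability.Probability"
begin

text \<open>
  The nodes are \<open>{1..N}\<close>. Since \<open>N\<close> varies, a matrix is a function
  \<^typ>\<open>nat \<Rightarrow> nat \<Rightarrow> real\<close>, of which only the entries with indices in the relevant
  finite index set are meaningful; in this way a submatrix keeps the original indices of
  its entries.
\<close>

type_synonym rmatrix = "nat \<Rightarrow> nat \<Rightarrow> real"

definition submat :: "nat set \<Rightarrow> rmatrix \<Rightarrow> rmatrix" where
  "submat I A = (\<lambda>i j. if i \<in> I \<and> j \<in> I then A i j else 0)"

definition mat_mult_on :: "nat set \<Rightarrow> rmatrix \<Rightarrow> rmatrix \<Rightarrow> rmatrix" where
  "mat_mult_on I A B = (\<lambda>i j. \<Sum>k\<in>I. A i k * B k j)"

definition inverse_on :: "nat set \<Rightarrow> rmatrix \<Rightarrow> rmatrix \<Rightarrow> bool" where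
  "inverse_on I A B \<longleftrightarrow>
     (\<forall>i\<in>I. \<forall>j\<in>I. mat_mult_on I A B i j = of_bool (i = j)) \<and>
     (\<forall>i\<in>I. \<forall>j\<in>I. mat_mult_on I B A i j = of_bool (i = j))"

text \<open>
  The condition \<open>submat I B = B\<close> fixes the irrelevant entries of the inverse to be zero, so
  that it is unique as a function whenever the \<open>I \<times> I\<close> matrix is invertible.
\<close>

definition mat_inv_on :: "nat set \<Rightarrow> rmatrix \<Rightarrow> rmatrix" where
  "mat_inv_on I A = (THE B. inverse_on I A B \<and> submat I B = B)"


type_synonym graph = "nat \<Rightarrow> nat \<Rightarrow> bool"

text \<open>
  The last two conjuncts make \<open>G \<omega>\<close> the adjacency matrix of a simple graph on \<open>{1..N}\<close>; they
  hold for every outcome, and the entries outside \<open>{1..N}\<close> carry no information.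
\<close>

definition erdos_renyi :: "'a measure \<Rightarrow> nat \<Rightarrow> real \<Rightarrow> ('a \<Rightarrow> graph) \<Rightarrow> bool" where
  "erdos_renyi M N p G \<longleftrightarrow>
     prob_space.indep_vars M (\<lambda>_. count_space UNIV) (\<lambda>(i, j) \<omega>. G \<omega> i j)
       {(i, j). 1 \<le> i \<and> i < j \<and> j \<le> N} \<and>
     (\<forall>i j. 1 \<le> i \<and> i < j \<and> j \<le> N \<longrightarrow>
        distr M (count_space UNIV) (\<lambda>\<omega>. G \<omega> i j) = measure_pmf (bernoulli_pmf p)) \<and>
     (\<forall>\<omega>\<in>space M. \<forall>i j. G \<omega> j i = G \<omega> i j) \<and>
     (\<forall>\<omega>\<in>space M. \<forall>i j. G \<omega> i j \<longrightarrow> i \<in> {1..N} \<and> j \<in> {1..N} \<and> i \<noteq> j)"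

definition degree :: "nat \<Rightarrow> graph \<Rightarrow> nat \<Rightarrow> real" where
  "degree N g i = 1 + (\<Sum>l\<in>{1..N} - {i}. of_bool (g i l))"

definition min_degree :: "nat \<Rightarrow> graph \<Rightarrow> real" where
  "min_degree N g = Min (degree N g ` {1..N})"

definition max_degree :: "nat \<Rightarrow> graph \<Rightarrow> real" where
  "max_degree N g = Max (degree N g ` {1..N})"

definition regular_diffusion :: "nat \<Rightarrow> real \<Rightarrow> real \<Rightarrow> graph \<Rightarrow> rmatrix \<Rightarrow> bool" where
  "regular_diffusion N \<rho> \<kappa> g a \<longleftrightarrow>
     (\<forall>i\<in>{1..N}. \<forall>j\<in>{1..N}. a j i = a i j \<and> a i j \<ge> 0) \<and>
     (\<forall>i\<in>{1..N}. (\<Sum>l\<in>{1..N}. a i l) = \<rho>) \<and>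
     (\<forall>i\<in>{1..N}. \<forall>j\<in>{1..N}. i \<noteq> j \<longrightarrow>
        \<kappa> / max_degree N g * of_bool (g i j) \<le> a i j \<and>
        a i j \<le> \<kappa> / min_degree N g * of_bool (g i j))"


definition iid_inputs :: "'a measure \<Rightarrow> nat \<Rightarrow> (nat \<Rightarrow> nat \<Rightarrow> 'a \<Rightarrow> real) \<Rightarrow> bool" where
  "iid_inputs M N x \<longleftrightarrow>
     prob_space.indep_vars M (\<lambda>_. borel) (\<lambda>(i, n). x i n) ({1..N} \<times> {1..}) \<and>
     (\<forall>i\<in>{1..N}. \<forall>j\<in>{1..N}. \<forall>n\<ge>1. \<forall>m\<ge>1. distr M borel (x i n) = distr M borel (x j m)) \<and>
     (\<forall>i\<in>{1..N}. \<forall>n\<ge>1. integrable M (x i n) \<and> integrable M (\<lambda>\<omega>. (x i n \<omega>)\<^sup>2) \<and>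
        prob_space.expectation M (x i n) = 0 \<and> prob_space.variance M (x i n) = 1)"

text \<open>
  The inputs at times \<open>n \<ge> 1\<close> are independent of the graph and of the initial state \<open>y 0\<close>
  (which may itself depend on the graph), stated for the generated sigma-algebras.
\<close>

definition inputs_indep ::
  "'a measure \<Rightarrow> nat \<Rightarrow> ('a \<Rightarrow> graph) \<Rightarrow> ('a \<Rightarrow> nat \<Rightarrow> real) \<Rightarrow> (nat \<Rightarrow> nat \<Rightarrow> 'a \<Rightarrow> real) \<Rightarrow> bool" where
  "inputs_indep M N G y0 x \<longleftrightarrow>
     prob_space.indep_set M
       (sets (vimage_algebra (space M) (\<lambda>\<omega>. (G \<omega>, \<lambda>i\<in>{1..N}. y0 \<omega> i))
          (count_space UNIV \<Otimes>\<^sub>M Pi\<^sub>M {1..N} (\<lambda>_. borel))))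
       (sets (vimage_algebra (space M) (\<lambda>\<omega>. \<lambda>k\<in>{1..N} \<times> {1..}. x (fst k) (snd k) \<omega>)
          (Pi\<^sub>M ({1..N} \<times> {1..}) (\<lambda>_. borel))))"

definition diffusion_dynamics ::
  "'a measure \<Rightarrow> nat \<Rightarrow> real \<Rightarrow> ('a \<Rightarrow> rmatrix) \<Rightarrow> (nat \<Rightarrow> nat \<Rightarrow> 'a \<Rightarrow> real) \<Rightarrow>
    (nat \<Rightarrow> 'a \<Rightarrow> nat \<Rightarrow> real) \<Rightarrow> bool" where
  "diffusion_dynamics M N \<sigma> A x y \<longleftrightarrow>
     (\<forall>i\<in>{1..N}. integrable M (\<lambda>\<omega>. (y 0 \<omega> i)\<^sup>2)) \<and>
     (\<forall>\<omega>\<in>space M. \<forall>n\<ge>1. \<forall>i\<in>{1..N}.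
        y n \<omega> i = (\<Sum>l\<in>{1..N}. A \<omega> i l * y (n - 1) \<omega> l) + \<sigma> * x i n \<omega>)"

text \<open>
  The correlation matrices are conditional on \<open>A\<close>. As \<open>A\<close> takes finitely many values, the
  conditional law given \<open>A = A \<omega>\<close> is elementary; it is only meaningful for \<open>\<omega>\<close> in an atom of
  positive probability, that is, almost surely.
\<close>

definition law_given :: "'a measure \<Rightarrow> nat \<Rightarrow> ('a \<Rightarrow> rmatrix) \<Rightarrow> 'a \<Rightarrow> 'a measure" where
  "law_given M N A \<omega> =
     uniform_measure M {\<omega>'\<in>space M. \<forall>i\<in>{1..N}. \<forall>j\<in>{1..N}. A \<omega>' i j = A \<omega> i j}"

definition corr0 ::
  "'a measure \<Rightarrow> nat \<Rightarrow> ('a \<Rightarrow> rmatrix) \<Rightarrow> (nat \<Rightarrow> 'a \<Rightarrow> nat \<Rightarrow> real) \<Rightarrow> 'a \<Rightarrow> rmatrix" where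
  "corr0 M N A y \<omega> = (\<lambda>i j. lim (\<lambda>n. \<integral>\<omega>'. y n \<omega>' i * y n \<omega>' j \<partial>law_given M N A \<omega>))"

definition corr1 ::
  "'a measure \<Rightarrow> nat \<Rightarrow> ('a \<Rightarrow> rmatrix) \<Rightarrow> (nat \<Rightarrow> 'a \<Rightarrow> nat \<Rightarrow> real) \<Rightarrow> 'a \<Rightarrow> rmatrix" where
  "corr1 M N A y \<omega> = (\<lambda>i j. lim (\<lambda>n. \<integral>\<omega>'. y n \<omega>' i * y (n - 1) \<omega>' j \<partial>law_given M N A \<omega>))"


definition granger_est :: "nat set \<Rightarrow> rmatrix \<Rightarrow> rmatrix \<Rightarrow> rmatrix" where
  "granger_est S R0 R1 = mat_mult_on S (submat S R1) (mat_inv_on S (submat S R0))"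

definition onelag_est :: "nat set \<Rightarrow> rmatrix \<Rightarrow> rmatrix \<Rightarrow> rmatrix" where
  "onelag_est S R0 R1 = submat S R1"

definition residual_est :: "nat set \<Rightarrow> rmatrix \<Rightarrow> rmatrix \<Rightarrow> rmatrix" where
  "residual_est S R0 R1 = (\<lambda>i j. submat S R1 i j - submat S R0 i j)"


definition disconnected_pairs :: "nat set \<Rightarrow> rmatrix \<Rightarrow> (nat \<times> nat) set" where
  "disconnected_pairs S a = {(i, j). i \<in> S \<and> j \<in> S \<and> i \<noteq> j \<and> a i j = 0}"

definition connected_pairs :: "nat set \<Rightarrow> rmatrix \<Rightarrow> (nat \<times> nat) set" where
  "connected_pairs S a = {(i, j). i \<in> S \<and> j \<in> S \<and> i \<noteq> j \<and> a i j > 0}"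

text \<open>
  For an empty set of pairs, \<open>Min {}\<close> and \<open>Max {}\<close> are unspecified reals, which serve as the
  arbitrary values of the undefined margins.
\<close>

definition lower_margin :: "(nat \<times> nat) set \<Rightarrow> rmatrix \<Rightarrow> real" where
  "lower_margin P e = Min ((\<lambda>(i, j). e i j) ` P)"

definition upper_margin :: "(nat \<times> nat) set \<Rightarrow> rmatrix \<Rightarrow> real" where
  "upper_margin P e = Max ((\<lambda>(i, j). e i j) ` P)"

definition nondegenerate ::
  "(nat \<Rightarrow> 'a measure) \<Rightarrow> (nat \<Rightarrow> 'a \<Rightarrow> rmatrix) \<Rightarrow> (nat \<Rightarrow> nat set) \<Rightarrow> bool" where
  "nondegenerate M A S \<longleftrightarrow>
     (\<lambda>N. measure (M N) {\<omega>\<in>space (M N). disconnected_pairs (S N) (A N \<omega>) = {}}) \<longlonglongrightarrow> 0 \<and>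
     (\<lambda>N. measure (M N) {\<omega>\<in>space (M N). connected_pairs (S N) (A N \<omega>) = {}}) \<longlonglongrightarrow> 0"

definition whp_near ::
  "(nat \<Rightarrow> 'a measure) \<Rightarrow> (nat \<Rightarrow> 'a \<Rightarrow> real) \<Rightarrow> real \<Rightarrow> bool" where
  "whp_near M X c \<longleftrightarrow>
     (\<forall>\<epsilon>>0. (\<lambda>N. measure (M N) {\<omega>\<in>space (M N). \<bar>X N \<omega> - c\<bar> < \<epsilon>}) \<longlonglongrightarrow> 1)"

definition universal_local_consistency ::
  "(nat \<Rightarrow> 'a measure) \<Rightarrow> (nat \<Rightarrow> 'a \<Rightarrow> rmatrix) \<Rightarrow> (nat \<Rightarrow> nat set) \<Rightarrow>
    (nat \<Rightarrow> 'a \<Rightarrow> rmatrix) \<Rightarrow> (nat \<Rightarrow> real) \<Rightarrow> real \<Rightarrow> real \<Rightarrow> bool" where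
  "universal_local_consistency M A S est s \<eta> \<Gamma> \<longleftrightarrow>
     \<Gamma> > 0 \<and>
     whp_near M (\<lambda>N \<omega>. s N * lower_margin (disconnected_pairs (S N) (A N \<omega>)) (est N \<omega>)) \<eta> \<and>
     whp_near M (\<lambda>N \<omega>. s N * upper_margin (disconnected_pairs (S N) (A N \<omega>)) (est N \<omega>)) \<eta> \<and>
     whp_near M (\<lambda>N \<omega>. s N * lower_margin (connected_pairs (S N) (A N \<omega>)) (est N \<omega>)) (\<eta> + \<Gamma>) \<and>
     whp_near M (\<lambda>N \<omega>. s N * upper_margin (connected_pairs (S N) (A N \<omega>)) (est N \<omega>)) (\<eta> + \<Gamma>)"

end

(*
  Idea. Write a = rho - kappa and q = N p_N. In the stated regime a Chernoff bound makes all
  degrees concentrate around q and all numbers of common neighbours around N p_N^2 with an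
  error o(q), uniformly over nodes and pairs of nodes and separately inside and outside S.
  Hence A has diagonal a + o(1) and off-diagonal entries (kappa g_ij + o(1)) / q.

  R0 = A R0 A + sigma^2 I forces R0 to commute with A, so that P = R0 - R1 and Q = R0 + R1
  satisfy P = sigma^2 I - A P and Q = sigma^2 I + A Q. For the Granger estimator, extend the
  j-th unit vector on S by v = A^2 v outside S; column j of the estimator is then A v on S.
  All these linear equations are solved up to o(1) by columns of the shape: d at node j and
  (b g_ij + c) / q at i, since A maps such columns to columns of the same shape. As A has row
  sums rho < 1, a maximum principle turns small residuals into small errors, first for the
  whole column and then, at scale 1/q, off the diagonal.
*)
theory Submission
  imports Defs
begin

section \<open>Linear equations with a contracting matrix\<close>

text \<open>An off-diagonal entry has size 1/q itself, so an error bound of order \<epsilon> for a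
  whole column says nothing about it; accuracy is needed at two scales at once. What makes this
  possible is that the paths from i to j through third nodes contribute, after scaling by q, a
  quantity that is nearly the same for all pairs. This common quantity is the source of the bias,
  which is proportional to p, while the direct edge yields the gap. The residual estimator is -P and
  the one-lag estimator is (Q - P) / 2, so both reduce to resolvents of A and -A. The inverse of a
  block of R0 has no such formula, whence the detour through an extended column for Granger. The
  number of pairs costs a factor N^2, while the tail for precision e is exp(- e^2 q / 4) with q =
  \<omega>_N log N; as \<omega>_N tends to infinity, every fixed e is affordable. Correlations are
  conditional on the value of A, so they are controlled only on atoms of positive probability; the
  graph has finitely many values, so the remaining atoms form a null set, and every event about the
  estimators is measurable.\<close>

lemma abs_weighted_sum_le:
  fixes c z :: "'i \<Rightarrow> real"
  assumes "(\<Sum>j\<in>I. \<bar>c j\<bar>) \<le> r" and "\<And>j. j \<in> I \<Longrightarrow> \<bar>z j\<bar> \<le> m" and "0 \<le> m"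
  shows "\<bar>\<Sum>j\<in>I. c j * z j\<bar> \<le> r * m"
proof -
  have "\<bar>\<Sum>j\<in>I. c j * z j\<bar> \<le> (\<Sum>j\<in>I. \<bar>c j\<bar> * m)"
    by (rule order_trans[OF sum_abs]) (auto intro!: sum_mono mult_left_mono assms simp: abs_mult)
  also have "\<dots> \<le> r * m"
    using assms(1,3) by (simp add: sum_distrib_right[symmetric] mult_right_mono)
  finally show ?thesis .
qed

text \<open>Consecutive increments shrink by the factor r in the maximum norm over \<open>I\<close>,
  so every coordinate is an absolutely convergent telescoping series. It serves for the limits that
  define the correlations and for the existence of the extended column behind the Granger
  estimator.\<close>

lemma affine_iteration_converges:
  fixes C :: "'i \<Rightarrow> 'i \<Rightarrow> real" and x :: "nat \<Rightarrow> 'i \<Rightarrow> real"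
  assumes "finite I" and row: "\<And>i. i \<in> I \<Longrightarrow> (\<Sum>j\<in>I. \<bar>C i j\<bar>) \<le> r" and "r < 1"
    and step: "\<And>n i. i \<in> I \<Longrightarrow> x (Suc n) i = f i + (\<Sum>j\<in>I. C i j * x n j)"
  obtains L where "\<And>i. i \<in> I \<Longrightarrow> (\<lambda>n. x n i) \<longlonglongrightarrow> L i"
    and "\<And>i. i \<in> I \<Longrightarrow> L i = f i + (\<Sum>j\<in>I. C i j * L j)"
proof (cases "I = {}")
  case True
  then show thesis using that[of "\<lambda>_. 0"] by simp
next
  case False
  then obtain i0 where "i0 \<in> I" by auto
  have "0 \<le> r"
    using order_trans[OF sum_nonneg row[OF \<open>i0 \<in> I\<close>]] by simp
  define m where "m = (\<Sum>j\<in>I. \<bar>x 1 j - x 0 j\<bar>)"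
  have "0 \<le> m" by (simp add: m_def sum_nonneg)
  have inc: "\<bar>x (Suc n) i - x n i\<bar> \<le> r ^ n * m" if "i \<in> I" for n i
    using that
  proof (induction n arbitrary: i)
    case 0
    then show ?case
      using member_le_sum[of i I "\<lambda>j. \<bar>x 1 j - x 0 j\<bar>"] \<open>finite I\<close> by (simp add: m_def)
  next
    case (Suc n)
    have "x (Suc (Suc n)) i - x (Suc n) i = (\<Sum>j\<in>I. C i j * (x (Suc n) j - x n j))"
      using step[OF Suc.prems] by (simp add: sum_subtractf right_diff_distrib)
    also have "\<bar>\<dots>\<bar> \<le> r * (r ^ n * m)"
      by (rule abs_weighted_sum_le) (use row Suc \<open>0 \<le> r\<close> \<open>0 \<le> m\<close> in auto)
    finally show ?case by simp
  qed
  have conv: "convergent (\<lambda>n. x n i)" if "i \<in> I" for i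
  proof -
    have "summable (\<lambda>n. x (Suc n) i - x n i)"
      by (rule summable_comparison_test'[where g = "\<lambda>n. r ^ n * m" and N = 0])
        (use inc[OF that] \<open>0 \<le> r\<close> \<open>r < 1\<close> in \<open>auto intro!: summable_mult2 summable_geometric\<close>)
    then have "convergent (\<lambda>n. \<Sum>k<n. x (Suc k) i - x k i)"
      by (simp add: summable_iff_convergent)
    then have "convergent (\<lambda>n. (x n i - x 0 i) + x 0 i)"
      by (intro convergent_add convergent_const) (simp add: sum_lessThan_telescope[of "\<lambda>n. x n i"])
    then show ?thesis by simp
  qed
  define L where "L i = lim (\<lambda>n. x n i)" for i
  have lim: "(\<lambda>n. x n i) \<longlonglongrightarrow> L i" if "i \<in> I" for i
    using conv[OF that] by (simp add: L_def convergent_LIMSEQ_iff)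
  moreover have "L i = f i + (\<Sum>j\<in>I. C i j * L j)" if "i \<in> I" for i
  proof (rule LIMSEQ_unique)
    show "(\<lambda>n. x (Suc n) i) \<longlonglongrightarrow> L i" using lim[OF that] by (rule LIMSEQ_Suc)
    show "(\<lambda>n. x (Suc n) i) \<longlonglongrightarrow> f i + (\<Sum>j\<in>I. C i j * L j)"
      unfolding step[OF that] by (intro tendsto_intros lim)
  qed
  ultimately show thesis by (rule that)
qed

text \<open>At an index where \<bar>z\<bar> attains its maximum m, the equation gives m \<le> r *
  m.\<close>

lemma contraction_fixed_point_zero:
  fixes C :: "'i \<Rightarrow> 'i \<Rightarrow> real"
  assumes "finite I" and row: "\<And>i. i \<in> I \<Longrightarrow> (\<Sum>j\<in>I. \<bar>C i j\<bar>) \<le> r" and "r < 1"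
    and fix_pt: "\<And>i. i \<in> I \<Longrightarrow> z i = (\<Sum>j\<in>I. C i j * z j)"
    and "i \<in> I"
  shows "z i = 0"
proof -
  have "I \<noteq> {}" using \<open>i \<in> I\<close> by auto
  define m where "m = Max ((\<lambda>i. \<bar>z i\<bar>) ` I)"
  have le: "\<bar>z j\<bar> \<le> m" if "j \<in> I" for j
    using that \<open>finite I\<close> by (simp add: m_def)
  have "0 \<le> m" using le[OF \<open>i \<in> I\<close>] by simp
  have "m \<in> (\<lambda>i. \<bar>z i\<bar>) ` I"
    unfolding m_def using \<open>finite I\<close> \<open>I \<noteq> {}\<close> by (intro Max_in) auto
  then obtain k where "k \<in> I" and m_k: "m = \<bar>z k\<bar>" by auto
  have "m \<le> r * m"
    
  proof -
    have "m = \<bar>\<Sum>j\<in>I. C k j * z j\<bar>" using m_k fix_pt[OF \<open>k \<in> I\<close>] by simp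
    also have "\<dots> \<le> r * m" by (rule abs_weighted_sum_le, use row \<open>k \<in> I\<close> le \<open>0 \<le> m\<close> in auto)
    finally show ?thesis .
  qed
  then have "(1 - r) * m \<le> 0" by (simp add: algebra_simps)
  then have "m \<le> 0" using \<open>r < 1\<close> by (simp add: mult_le_0_iff)
  then show ?thesis using le[OF \<open>i \<in> I\<close>] by simp
qed

section \<open>Matrix algebra and inverses on a finite index set\<close>

lemma mat_mult_on_assoc:
  "mat_mult_on I (mat_mult_on J A B) C = mat_mult_on J A (mat_mult_on I B C)"
  by (auto simp: mat_mult_on_def sum_distrib_left sum_distrib_right mult.assoc fun_eq_iff
      intro: sum.swap)

lemma mat_mult_on_cong:
  assumes "\<And>k. k \<in> I \<Longrightarrow> A i k = A' i k" and "\<And>k. k \<in> I \<Longrightarrow> B k j = B' k j"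
  shows "mat_mult_on I A B i j = mat_mult_on I A' B' i j"
  using assms by (simp add: mat_mult_on_def)

text \<open>The usual B' = B' (A B) = (B' A) B settles the entries inside \<open>I\<close>; the
  support condition settles all others, so that the definite description in
  \<open>mat_inv_on\<close> really denotes B.\<close>

lemma mat_inv_on_eqI:
  assumes "finite I" and inv: "inverse_on I A B" and supp: "submat I B = B"
  shows "mat_inv_on I A = B"
  unfolding mat_inv_on_def
proof (rule the_equality)
  fix B' assume B': "inverse_on I A B' \<and> submat I B' = B'"
  have "B' i j = B i j" if "i \<in> I" "j \<in> I" for i j
  proof -
    have "B' i j = mat_mult_on I B' (mat_mult_on I A B) i j"
      using inv that \<open>finite I\<close> by (simp add: inverse_on_def mat_mult_on_def)
    also have "\<dots> = mat_mult_on I (mat_mult_on I B' A) B i j"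
      by (simp add: mat_mult_on_assoc)
    also have "\<dots> = B i j"
      using B' that \<open>finite I\<close> unfolding inverse_on_def
      by (subst mat_mult_on_cong[where A' = "\<lambda>i k. of_bool (i = k)" and B' = B])
        (auto simp: mat_mult_on_def)
    finally show ?thesis .
  qed
  then show "B' = B"
    using B' supp by (metis (no_types, lifting) ext submat_def)
qed (use assms in auto)

text \<open>For symmetric A the transpose of a right inverse is a left inverse, and a left inverse
  equals a right inverse. Hence one product suffices when the block of R0 is inverted.\<close>

lemma inverse_on_symmetric:
  assumes "finite I" and sym: "\<And>i j. i \<in> I \<Longrightarrow> j \<in> I \<Longrightarrow> A j i = A i j"
    and right: "\<And>i j. i \<in> I \<Longrightarrow> j \<in> I \<Longrightarrow> mat_mult_on I A B i j = of_bool (i = j)"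
  shows "inverse_on I A B"
proof -
  define B' where "B' = (\<lambda>i j. B j i)"
  have left: "mat_mult_on I B' A i j = of_bool (i = j)" if "i \<in> I" "j \<in> I" for i j
    using right[OF that(2,1)] sym that
    by (auto simp: mat_mult_on_def B'_def mult.commute)
  have "B' i j = B i j" if "i \<in> I" "j \<in> I" for i j
  proof -
    have "B' i j = mat_mult_on I B' (mat_mult_on I A B) i j"
      using right that \<open>finite I\<close> by (simp add: mat_mult_on_def)
    also have "\<dots> = mat_mult_on I (mat_mult_on I B' A) B i j"
      by (simp add: mat_mult_on_assoc)
    also have "\<dots> = B i j"
      using left that \<open>finite I\<close> by (simp add: mat_mult_on_def)
    finally show ?thesis .
  qed
  then have "mat_mult_on I B A i j = of_bool (i = j)" if "i \<in> I" "j \<in> I" for i j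
    using left[OF that] that by (simp add: mat_mult_on_def)
  with right show ?thesis by (simp add: inverse_on_def)
qed

text \<open>The commutator D = A R - R A solves the homogeneous equation D = A D A, because s I
  commutes with A. On pairs of indices the map D \<mapsto> A D A is a matrix with absolute row sums
  at most \<rho>^2 < 1, so D vanishes.\<close>

lemma stationary_equation_commute:
  fixes A R :: rmatrix
  assumes "finite V" and sym: "\<And>i j. i \<in> V \<Longrightarrow> j \<in> V \<Longrightarrow> A j i = A i j"
    and row: "\<And>i. i \<in> V \<Longrightarrow> (\<Sum>l\<in>V. \<bar>A i l\<bar>) \<le> \<rho>" and "\<rho> < 1"
    and R: "\<And>i j. i \<in> V \<Longrightarrow> j \<in> V \<Longrightarrow>
      R i j = s * of_bool (i = j) + mat_mult_on V A (mat_mult_on V R A) i j"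
    and "i \<in> V" "j \<in> V"
  shows "mat_mult_on V A R i j = mat_mult_on V R A i j"
proof -
  define D where "D i j = mat_mult_on V A R i j - mat_mult_on V R A i j" for i j
  define C where "C u v = A (fst u) (fst v) * A (snd v) (snd u)" for u v :: "nat \<times> nat"
  have "(\<Sum>v\<in>V\<times>V. \<bar>C u v\<bar>) \<le> \<rho> * \<rho>" if "u \<in> V \<times> V" for u
  proof -
    obtain i j where u: "u = (i, j)" "i \<in> V" "j \<in> V" using \<open>u \<in> V \<times> V\<close> by (cases u) auto
    have "(\<Sum>v\<in>V\<times>V. \<bar>C u v\<bar>) = (\<Sum>l\<in>V. \<bar>A i l\<bar>) * (\<Sum>m\<in>V. \<bar>A j m\<bar>)"
      using sym[of _ j] u
      by (auto simp: C_def sum_product sum.cartesian_product abs_mult case_prod_beta intro!: sum.cong)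
    also have "\<dots> \<le> \<rho> * \<rho>"
      using row u order_trans[OF sum_nonneg row] by (intro mult_mono) (auto intro: sum_nonneg)
    finally show ?thesis .
  qed
  moreover have "\<rho> * \<rho> < 1"
    using \<open>i \<in> V\<close> row[of i] sum_nonneg[of V "\<lambda>l. \<bar>A i l\<bar>"] \<open>\<rho> < 1\<close> 
    by (smt (verit, best) abs_ge_zero mult_left_le)
  moreover have "D (fst u) (snd u) = (\<Sum>v\<in>V\<times>V. C u v * D (fst v) (snd v))" if "u \<in> V \<times> V" for u
  proof -
    obtain i j where u: "u = (i, j)" "i \<in> V" "j \<in> V" using \<open>u \<in> V \<times> V\<close> by (cases u) auto
    have diag: "(\<Sum>k\<in>V. A i k * (s * of_bool (k = j))) = s * A i j"
      using u \<open>finite V\<close> by (simp add: of_bool_def if_distrib[of "\<lambda>x. _ * x"] cong: if_cong)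
    \<comment> \<open>Inserting the equation for R into A R, and below into R A, produces the same
      term s * A, which cancels in D.\<close>
    have AR: "mat_mult_on V A R i j = s * A i j +
        mat_mult_on V A (mat_mult_on V A (mat_mult_on V R A)) i j"
      using R u \<open>finite V\<close>
      by (subst mat_mult_on_cong[where A' = A and B' = "\<lambda>i j. s * of_bool (i = j) + mat_mult_on V A (mat_mult_on V R A) i j"])
       (auto simp: mat_mult_on_def[of V A "\<lambda>i j. s * of_bool (i = j) + _ i j"] mat_mult_on_def[of V A "mat_mult_on V A (mat_mult_on V R A)"]
          sum.distrib distrib_left diag)
    have diag': "(\<Sum>k\<in>V. s * of_bool (i = k) * A k j) = s * A i j"
      using u \<open>finite V\<close> by (simp add: of_bool_def if_distrib[of "\<lambda>x. _ * x * _"] cong: if_cong)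
    have RA: "mat_mult_on V R A i j = s * A i j +
        mat_mult_on V (mat_mult_on V A (mat_mult_on V R A)) A i j"
      using R u \<open>finite V\<close>
      by (subst mat_mult_on_cong[where B' = A and A' = "\<lambda>i j. s * of_bool (i = j) + mat_mult_on V A (mat_mult_on V R A) i j"])
       (auto simp: mat_mult_on_def[of V "\<lambda>i j. s * of_bool (i = j) + _ i j" A] mat_mult_on_def[of V "mat_mult_on V A (mat_mult_on V R A)" A]
          sum.distrib distrib_right diag')
    have "D i j = mat_mult_on V A (mat_mult_on V D A) i j"
    proof -
      have "mat_mult_on V D A = (\<lambda>i j. mat_mult_on V (mat_mult_on V A R) A i j - mat_mult_on V (mat_mult_on V R A) A i j)"
        by (simp add: mat_mult_on_def[of V D] mat_mult_on_def[of V "mat_mult_on V A R"] mat_mult_on_def[of V "mat_mult_on V R A"] D_def sum_subtractf left_diff_distrib)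
      then have "mat_mult_on V A (mat_mult_on V D A) i j =
         mat_mult_on V A (mat_mult_on V (mat_mult_on V A R) A) i j - mat_mult_on V A (mat_mult_on V (mat_mult_on V R A) A) i j"
        by (simp add: mat_mult_on_def[of V A "\<lambda>i j. _ i j - _ i j"] 
            mat_mult_on_def[of V A "mat_mult_on V (mat_mult_on V A R) A"] 
            mat_mult_on_def[of V A "mat_mult_on V (mat_mult_on V R A) A"] sum_subtractf right_diff_distrib)
      then show ?thesis by (simp add: D_def AR RA mat_mult_on_assoc)
    qed
    then show ?thesis
      by (simp add: u C_def mat_mult_on_def sum_distrib_left sum.cartesian_product mult_ac case_prod_beta)
  qed
  ultimately have "D (fst (i, j)) (snd (i, j)) = 0"
    using contraction_fixed_point_zero[of "V \<times> V" C "\<rho> * \<rho>" "\<lambda>u. D (fst u) (snd u)" "(i, j)"]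
      \<open>finite V\<close> \<open>i \<in> V\<close> \<open>j \<in> V\<close> by blast
  then show ?thesis by (simp add: D_def)
qed

text \<open>Instead of inverting a block of R0, a system with the contracting matrix A^2 is solved
  outside S. The stationary equation is taken with both factors A to the right of R0 because it gets
  applied to a column v.\<close>

lemma granger_est_eq:
  fixes A R0 R1 :: rmatrix
  assumes "finite V" "S \<subseteq> V" "0 < s"
    and sym: "\<And>i j. i \<in> V \<Longrightarrow> j \<in> V \<Longrightarrow> A j i = A i j"
    and row: "\<And>i. i \<in> V \<Longrightarrow> (\<Sum>l\<in>V. \<bar>A i l\<bar>) \<le> \<rho>" and "\<rho> < 1"
    and R0_sym: "\<And>i j. i \<in> V \<Longrightarrow> j \<in> V \<Longrightarrow> R0 j i = R0 i j"
    and R0: "\<And>i j. i \<in> V \<Longrightarrow> j \<in> V \<Longrightarrow>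
      R0 i j = s * of_bool (i = j) + mat_mult_on V (mat_mult_on V R0 A) A i j"
    and R1: "\<And>i j. i \<in> V \<Longrightarrow> j \<in> V \<Longrightarrow> R1 i j = mat_mult_on V A R0 i j"
  obtains v where "\<And>i j. i \<in> S \<Longrightarrow> j \<in> S \<Longrightarrow> v i j = of_bool (i = j)"
    and "\<And>i j. i \<in> V - S \<Longrightarrow> j \<in> S \<Longrightarrow> v i j = mat_mult_on V A (mat_mult_on V A v) i j"
    and "\<And>i j. i \<in> S \<Longrightarrow> j \<in> S \<Longrightarrow> granger_est S R0 R1 i j = mat_mult_on V A v i j"
proof -
  define A2 where "A2 = mat_mult_on V A A"
  have A2_row: "(\<Sum>j\<in>V. \<bar>A2 i j\<bar>) \<le> \<rho> * \<rho>" if "i \<in> V" for i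
  proof -
    have "0 \<le> \<rho>" using order_trans[OF sum_nonneg row[OF that]] by simp
    have "(\<Sum>j\<in>V. \<bar>A2 i j\<bar>) \<le> (\<Sum>j\<in>V. \<Sum>k\<in>V. \<bar>A i k\<bar> * \<bar>A k j\<bar>)"
      by (auto simp: A2_def mat_mult_on_def abs_mult intro!: sum_mono order_trans[OF sum_abs])
    also have "\<dots> = (\<Sum>k\<in>V. \<bar>A i k\<bar> * (\<Sum>j\<in>V. \<bar>A k j\<bar>))"
      by (subst sum.swap) (simp add: sum_distrib_left)
    also have "\<dots> \<le> (\<Sum>k\<in>V. \<bar>A i k\<bar> * \<rho>)"
      by (intro sum_mono mult_left_mono row) auto
    also have "\<dots> \<le> \<rho> * \<rho>"
      using row[OF that] \<open>0 \<le> \<rho>\<close> by (simp add: mult_right_mono flip: sum_distrib_right)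
    finally show ?thesis .
  qed
  \<comment> \<open>The inhomogeneous term \<open>A2 i j\<close> is the contribution of the unit
    vector prescribed on S to A^2 v.\<close>
  have ex: "\<exists>L. \<forall>i\<in>V - S. L i = A2 i j + (\<Sum>k\<in>V - S. A2 i k * L k)" for j
  proof (cases "V - S = {}")
    case False
    then obtain i0 where "i0 \<in> V" by auto
    have "\<rho> * \<rho> < 1"
      using order_trans[OF sum_nonneg row[OF \<open>i0 \<in> V\<close>]] \<open>\<rho> < 1\<close>
      by (smt (verit, best) abs_ge_zero mult_left_le)
    define x where
      "x = rec_nat (\<lambda>_. 0) (\<lambda>n xn i. A2 i j + (\<Sum>k\<in>V - S. A2 i k * xn k))"
    have row': "(\<Sum>k\<in>V - S. \<bar>A2 i k\<bar>) \<le> \<rho> * \<rho>" if "i \<in> V - S" for i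
      using that by (intro order_trans[OF sum_mono2 A2_row]) (use \<open>finite V\<close> in auto)
    obtain L where "\<And>i. i \<in> V - S \<Longrightarrow> (\<lambda>n. x n i) \<longlonglongrightarrow> L i"
        "\<And>i. i \<in> V - S \<Longrightarrow> L i = A2 i j + (\<Sum>k\<in>V - S. A2 i k * L k)"
      by (rule affine_iteration_converges[of "V - S" A2 "\<rho> * \<rho>" x "\<lambda>i. A2 i j"])
       (use \<open>finite V\<close> row' \<open>\<rho> * \<rho> < 1\<close> in \<open>auto simp: x_def\<close>)
    then show ?thesis by blast
  qed auto
  then obtain K where K: "K j i = A2 i j + (\<Sum>k\<in>V - S. A2 i k * K j k)" if "i \<in> V - S" for i j
    by metis
  define v where "v = (\<lambda>i j. if i \<in> S then of_bool (i = j) else K j i)"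
  have split: "(\<Sum>k\<in>V. f k) = (\<Sum>k\<in>S. f k) + (\<Sum>k\<in>V - S. f k)" for f :: "nat \<Rightarrow> real"
    using sum.subset_diff[OF \<open>S \<subseteq> V\<close> \<open>finite V\<close>, of f] by simp
  have "finite S" using \<open>S \<subseteq> V\<close> \<open>finite V\<close> finite_subset by blast
  have v_out: "v i j = mat_mult_on V A2 v i j" if "i \<in> V - S" "j \<in> S" for i j
    using K[OF that(1), of j] that \<open>finite S\<close> by (simp add: mat_mult_on_def split v_def)
  \<comment> \<open>The column \<open>(I - A\<^sup>2) v\<close> vanishes outside \<open>S\<close> and \<open>R0 (I - A\<^sup>2) = s I\<close>, so \<open>B\<close> inverts the
    \<open>S\<close>-block of \<open>R0\<close>.\<close>
  define B where "B = submat S (\<lambda>i j. (v i j - mat_mult_on V A2 v i j) / s)"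
  \<comment> \<open>Since the omitted terms are zero, products with B over S become products over V,
    where the equations for R0 and R1 apply.\<close>
  have B_sum: "(\<Sum>k\<in>S. X k * B k j) = ((\<Sum>k\<in>V. X k * v k j) - (\<Sum>k\<in>V. X k * mat_mult_on V A2 v k j)) / s"
    if "j \<in> S" for X :: "nat \<Rightarrow> real" and j
  proof -
    have "(\<Sum>k\<in>S. X k * B k j) = (\<Sum>k\<in>S. X k * ((v k j - mat_mult_on V A2 v k j) / s))"
      using that by (simp add: B_def submat_def)
    also have "\<dots> = (\<Sum>k\<in>V. X k * ((v k j - mat_mult_on V A2 v k j) / s))"
      using v_out[OF _ that] by (simp add: split)
    also have "\<dots> = ((\<Sum>k\<in>V. X k * v k j) - (\<Sum>k\<in>V. X k * mat_mult_on V A2 v k j)) / s"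
      by (simp add: sum_subtractf right_diff_distrib sum_divide_distrib diff_divide_distrib)
    finally show ?thesis .
  qed
  have R0_v: "(\<Sum>k\<in>V. R0 i k * v k j) - (\<Sum>k\<in>V. R0 i k * mat_mult_on V A2 v k j) = s * v i j"
    if "i \<in> V" for i j
  proof -
    have "(\<Sum>k\<in>V. R0 i k * mat_mult_on V A2 v k j) = mat_mult_on V (mat_mult_on V (mat_mult_on V R0 A) A) v i j"
      by (simp add: mat_mult_on_assoc A2_def flip: mat_mult_on_def[of V R0 "mat_mult_on V (mat_mult_on V A A) v"])
       (simp add: mat_mult_on_def[of V R0 "mat_mult_on V A (mat_mult_on V A v)"])
    moreover have "(\<Sum>k\<in>V. R0 i k * v k j)
        = (\<Sum>k\<in>V. (s * of_bool (i = k) + mat_mult_on V (mat_mult_on V R0 A) A i k) * v k j)"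
      using R0 that by (intro sum.cong) auto
    ultimately show ?thesis
      using that \<open>finite V\<close>
      by (simp add: distrib_right sum.distrib mat_mult_on_def[of V "mat_mult_on V (mat_mult_on V R0 A) A"]
          mult.assoc flip: sum_distrib_left)
  qed
  have "inverse_on S (submat S R0) B"
  proof (rule inverse_on_symmetric[OF \<open>finite S\<close>])
    show "submat S R0 j i = submat S R0 i j" if "i \<in> S" "j \<in> S" for i j
      using R0_sym[of i j] that \<open>S \<subseteq> V\<close> by (auto simp: submat_def)
    show "mat_mult_on S (submat S R0) B i j = of_bool (i = j)" if "i \<in> S" "j \<in> S" for i j
    proof -
      have "mat_mult_on S (submat S R0) B i j = (\<Sum>k\<in>S. R0 i k * B k j)"
        using that by (simp add: mat_mult_on_def submat_def)
      also have "\<dots> = of_bool (i = j)"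
        using that \<open>S \<subseteq> V\<close> \<open>0 < s\<close> by (subst B_sum) (auto simp: R0_v subset_iff, auto simp: v_def)
      finally show ?thesis .
    qed
  qed
  moreover have "submat S B = B" by (simp add: B_def submat_def fun_eq_iff)
  ultimately have inv: "mat_inv_on S (submat S R0) = B"
    by (rule mat_inv_on_eqI[OF \<open>finite S\<close>])
  have "granger_est S R0 R1 i j = mat_mult_on V A v i j" if "i \<in> S" "j \<in> S" for i j
  proof -
    have "i \<in> V" using that \<open>S \<subseteq> V\<close> by auto
    have "granger_est S R0 R1 i j = (\<Sum>k\<in>S. R1 i k * B k j)"
      using that unfolding granger_est_def inv by (simp add: mat_mult_on_def submat_def)
    also have "\<dots> = ((\<Sum>k\<in>V. R1 i k * v k j) - (\<Sum>k\<in>V. R1 i k * mat_mult_on V A2 v k j)) / s"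
      by (rule B_sum[OF that(2)])
    also have "\<dots> = (\<Sum>l\<in>V. A i l * ((\<Sum>k\<in>V. R0 l k * v k j) - (\<Sum>k\<in>V. R0 l k * mat_mult_on V A2 v k j))) / s"
    proof -
      have "(\<Sum>k\<in>V. R1 i k * X k) = (\<Sum>l\<in>V. A i l * (\<Sum>k\<in>V. R0 l k * X k))" for X :: "nat \<Rightarrow> real"
        using R1[OF \<open>i \<in> V\<close>]
        by (simp add: mat_mult_on_def sum_distrib_left sum_distrib_right mult.assoc) (rule sum.swap)
      then show ?thesis by (simp add: sum_subtractf right_diff_distrib)
    qed
    also have "\<dots> = (\<Sum>l\<in>V. A i l * (s * v l j)) / s"
      by (simp add: R0_v)
    also have "\<dots> = mat_mult_on V A v i j"
      using \<open>0 < s\<close> by (simp add: mat_mult_on_def sum_distrib_left sum_divide_distrib)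
    finally show ?thesis .
  qed
  moreover have "v i j = of_bool (i = j)" if "i \<in> S" "j \<in> S" for i j
    using that by (simp add: v_def)
  moreover have "v i j = mat_mult_on V A (mat_mult_on V A v) i j" if "i \<in> V - S" "j \<in> S" for i j
    using v_out[OF that] by (simp add: A2_def mat_mult_on_assoc)
  ultimately show thesis by (rule that[rotated 2])
qed

section \<open>Approximate columns for a concentrated diffusion matrix\<close>

text \<open>At an index with the largest max \<bar>u\<bar> \<bar>v\<bar> = m, both inequalities give
  m \<le> r + \<rho> * m. Two vectors occur because the Granger column obeys alternating equations,
  u = A v everywhere and v = A u outside S; this keeps A^2 out of the error estimates.\<close>

lemma two_step_maximum_principle:
  fixes A :: "'i \<Rightarrow> 'i \<Rightarrow> real"
  assumes "finite I" and nonneg: "\<And>i l. i \<in> I \<Longrightarrow> l \<in> I \<Longrightarrow> 0 \<le> A i l"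
    and row: "\<And>i. i \<in> I \<Longrightarrow> (\<Sum>l\<in>I. A i l) \<le> \<rho>" and "\<rho> < 1"
    and u: "\<And>i. i \<in> I \<Longrightarrow> \<bar>u i\<bar> \<le> r + (\<Sum>l\<in>I. A i l * \<bar>v l\<bar>)"
    and v: "\<And>i. i \<in> I \<Longrightarrow> \<bar>v i\<bar> \<le> r + (\<Sum>l\<in>I. A i l * \<bar>u l\<bar>)"
    and "i \<in> I"
  shows "\<bar>u i\<bar> \<le> r / (1 - \<rho>) \<and> \<bar>v i\<bar> \<le> r / (1 - \<rho>)"
proof -
  have "I \<noteq> {}" using \<open>i \<in> I\<close> by auto
  define m where "m = Max ((\<lambda>i. max \<bar>u i\<bar> \<bar>v i\<bar>) ` I)"
  have le: "max \<bar>u l\<bar> \<bar>v l\<bar> \<le> m" if "l \<in> I" for l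
    unfolding m_def using that \<open>finite I\<close> by (intro Max_ge) auto
  have "0 \<le> m" using le[OF \<open>i \<in> I\<close>] abs_ge_zero[of "u i"] by (simp, linarith)
  have sum_le: "(\<Sum>l\<in>I. A k l * \<bar>w l\<bar>) \<le> \<rho> * m"
    if "k \<in> I" "\<And>l. l \<in> I \<Longrightarrow> \<bar>w l\<bar> \<le> m" for k and w :: "'i \<Rightarrow> real"
  proof -
    have "(\<Sum>l\<in>I. A k l * \<bar>w l\<bar>) \<le> (\<Sum>l\<in>I. A k l * m)"
      using that nonneg by (intro sum_mono mult_left_mono) auto
    also have "\<dots> \<le> \<rho> * m"
      using row[OF that(1)] \<open>0 \<le> m\<close> by (simp add: mult_right_mono flip: sum_distrib_right)
    finally show ?thesis .
  qed
  have "max \<bar>u k\<bar> \<bar>v k\<bar> \<le> r + \<rho> * m" if "k \<in> I" for k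
    using u[OF that] v[OF that] sum_le[OF that, of u] sum_le[OF that, of v] le by force
  then have "m \<le> r + \<rho> * m"
    unfolding m_def using \<open>finite I\<close> \<open>I \<noteq> {}\<close> by (subst Max_le_iff) auto
  then have "m \<le> r / (1 - \<rho>)"
    using \<open>\<rho> < 1\<close> by (simp add: field_simps)
  then show ?thesis using le[OF \<open>i \<in> I\<close>] by simp
qed

text \<open>Collects the six errors in \<open>diffusion_of_profile\<close>. The first is allowed
  twice the size because it multiplies a sum of two coefficients.\<close>

lemma abs_sum6_le:
  fixes m :: real
  assumes "\<bar>e1\<bar> \<le> 2 * m" "\<bar>e2\<bar> \<le> m" "\<bar>e3\<bar> \<le> m" "\<bar>e4\<bar> \<le> m" "\<bar>e5\<bar> \<le> m" "\<bar>e6\<bar> \<le> m"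
  shows "\<bar>e1 + e2 + e3 + e4 + e5 + e6\<bar> \<le> 7 * m"
  using assms unfolding abs_le_iff by auto

text \<open>
  Here \<open>p\<close> and \<open>\<xi>\<close> are the limits of the edge probability and of the observed fraction, so that
  \<open>\<epsilon>\<close> absorbs their convergence as well; \<open>q\<close> is the scaling \<open>N * p\<^sub>N\<close>.
\<close>

locale concentrated_diffusion =
  fixes V S :: "nat set" and A :: rmatrix and g :: graph and q \<kappa> \<rho> p \<xi> \<epsilon> :: real
  assumes finite_V: "finite V" and S_sub: "S \<subseteq> V"
    and A_nonneg: "\<And>i j. i \<in> V \<Longrightarrow> j \<in> V \<Longrightarrow> 0 \<le> A i j"
    and A_row: "\<And>i. i \<in> V \<Longrightarrow> (\<Sum>l\<in>V. A i l) = \<rho>"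
    and \<kappa>_pos: "0 < \<kappa>" and \<kappa>_le: "\<kappa> \<le> \<rho>" and \<rho>_less: "\<rho> < 1"
    and q_ge: "1 \<le> q" and q_eps: "1 / q \<le> \<epsilon>" and eps_le: "\<epsilon> \<le> 1"
    and A_diag: "\<And>i. i \<in> V \<Longrightarrow> \<bar>A i i - (\<rho> - \<kappa>)\<bar> \<le> \<epsilon>"
    and A_off: "\<And>i j. i \<in> V \<Longrightarrow> j \<in> V \<Longrightarrow> i \<noteq> j \<Longrightarrow> \<bar>q * A i j - \<kappa> * of_bool (g i j)\<bar> \<le> \<epsilon>"
    and sum_in: "\<And>i j. i \<in> V \<Longrightarrow> j \<in> V \<Longrightarrow> i \<noteq> j \<Longrightarrow>
      \<bar>(\<Sum>l\<in>S - {i, j}. A i l) - \<kappa> * \<xi>\<bar> \<le> \<epsilon>"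
    and sum_out: "\<And>i j. i \<in> V \<Longrightarrow> j \<in> V \<Longrightarrow> i \<noteq> j \<Longrightarrow>
      \<bar>(\<Sum>l\<in>V - S - {i, j}. A i l) - \<kappa> * (1 - \<xi>)\<bar> \<le> \<epsilon>"
    and path_in: "\<And>i j. i \<in> V \<Longrightarrow> j \<in> V \<Longrightarrow> i \<noteq> j \<Longrightarrow>
      \<bar>(\<Sum>l\<in>S - {i, j}. A i l * of_bool (g l j)) - \<kappa> * \<xi> * p\<bar> \<le> \<epsilon>"
    and path_out: "\<And>i j. i \<in> V \<Longrightarrow> j \<in> V \<Longrightarrow> i \<noteq> j \<Longrightarrow>
      \<bar>(\<Sum>l\<in>V - S - {i, j}. A i l * of_bool (g l j)) - \<kappa> * (1 - \<xi>) * p\<bar> \<le> \<epsilon>"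
begin

lemma eps_pos: "0 < \<epsilon>"
  using q_ge q_eps by (smt (verit, best) divide_pos_pos)

text \<open>
  The primed coefficients belong to the nodes outside \<open>S\<close>. Only the Granger estimator, whose
  defining equations distinguish the two classes of nodes, needs them to differ from the unprimed ones.
\<close>

definition profile :: "nat \<Rightarrow> real \<Rightarrow> real \<Rightarrow> real \<Rightarrow> real \<Rightarrow> real \<Rightarrow> nat \<Rightarrow> real" where
  "profile j d b b' c c' = (\<lambda>i. if i = j then d
     else if i \<in> S then (b * of_bool (g i j) + c) / q else (b' * of_bool (g i j) + c') / q)"

text \<open>The natural size of the entries of a profile at i; residuals are measured relative to
  it.\<close>

definition weight :: "nat \<Rightarrow> nat \<Rightarrow> real" where
  "weight j i = (if i = j then 1 else 1 / q)"

text \<open>For i \<noteq> j there are three sources. The loop at i multiplies the entry by about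
  \<rho> - \<kappa>. The edge to j adds about \<kappa> * d * g_ij / q. All other nodes together add
  t / q, where t splits according to S because the entries inside and outside S may use different
  coefficients; its parts with p come from the paths i, l, j. None of this depends on the pair
  except through g_ij, so the shape is preserved.\<close>

lemma diffusion_of_profile:
  assumes "i \<in> V" "j \<in> V" and B: "\<bar>d\<bar> \<le> B" "\<bar>b\<bar> \<le> B" "\<bar>b'\<bar> \<le> B" "\<bar>c\<bar> \<le> B" "\<bar>c'\<bar> \<le> B"
    and "t = \<kappa> * (\<xi> * (b * p + c) + (1 - \<xi>) * (b' * p + c'))"
  shows "\<bar>(\<Sum>l\<in>V. A i l * profile j d b b' c c' l)
      - profile j ((\<rho> - \<kappa>) * d) ((\<rho> - \<kappa>) * b + \<kappa> * d) ((\<rho> - \<kappa>) * b' + \<kappa> * d)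
          ((\<rho> - \<kappa>) * c + t) ((\<rho> - \<kappa>) * c' + t) i\<bar> \<le> 7 * B * \<epsilon> * weight j i"
proof -
  define f where "f = profile j d b b' c c'"
  define \<beta> where "\<beta> l = (if l \<in> S then b else b')" for l
  define \<gamma> where "\<gamma> l = (if l \<in> S then c else c')" for l
  have "0 \<le> B" using B(1) by simp
  have "0 < q" using q_ge by simp
  have f_off: "f l = (\<beta> l * of_bool (g l j) + \<gamma> l) / q" if "l \<noteq> j" for l
    using that by (simp add: f_def profile_def \<beta>_def \<gamma>_def)
  have mult_bound: "\<bar>x * y\<bar> \<le> B * \<epsilon>" if "\<bar>x\<bar> \<le> B" "\<bar>y\<bar> \<le> \<epsilon>" for x y
    unfolding abs_mult using that \<open>0 \<le> B\<close> by (intro mult_mono) auto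
  have f_diag: "f j = d" by (simp add: f_def profile_def)
  have bg_le: "\<bar>\<beta> l * of_bool (g l j) + \<gamma> l\<bar> \<le> 2 * B" for l
    using B by (auto simp: \<beta>_def \<gamma>_def)
  show ?thesis
  proof (cases "i = j")
    case True
    \<comment> \<open>At node j itself the entries from elsewhere are pure error: each is at most 2
      * B / q, and the row of A has mass at most 1.\<close>
    have f_le: "\<bar>f l\<bar> \<le> 2 * B * \<epsilon>" if "l \<noteq> j" for l
    proof -
      have "\<bar>f l\<bar> = \<bar>\<beta> l * of_bool (g l j) + \<gamma> l\<bar> * (1 / q)"
        using \<open>0 < q\<close> by (simp add: f_off[OF that])
      also have "\<dots> \<le> 2 * B * \<epsilon>"
        using bg_le q_eps \<open>0 \<le> B\<close> \<open>0 < q\<close> by (intro mult_mono) auto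
      finally show ?thesis .
    qed
    have "(\<Sum>l\<in>V - {j}. A j l) \<le> 1"
      using A_row[OF \<open>j \<in> V\<close>] A_nonneg[OF \<open>j \<in> V\<close> \<open>j \<in> V\<close>] \<rho>_less \<open>j \<in> V\<close> finite_V
      by (simp add: sum_diff1)
    then have "\<bar>\<Sum>l\<in>V - {j}. A j l * f l\<bar> \<le> 1 * (2 * B * \<epsilon>)"
      using A_nonneg \<open>j \<in> V\<close> f_le \<open>0 \<le> B\<close> eps_pos by (intro abs_weighted_sum_le) auto
    moreover have "\<bar>(A j j - (\<rho> - \<kappa>)) * d\<bar> \<le> \<epsilon> * B"
      unfolding abs_mult using A_diag[OF \<open>j \<in> V\<close>] B(1) eps_pos by (intro mult_mono) auto
    moreover have "(\<Sum>l\<in>V. A j l * f l) = A j j * d + (\<Sum>l\<in>V - {j}. A j l * f l)"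
      using sum.remove[OF finite_V \<open>j \<in> V\<close>, of "\<lambda>l. A j l * f l"] by (simp only: f_diag)
    moreover have "0 \<le> B * \<epsilon>" using \<open>0 \<le> B\<close> eps_pos by simp
    ultimately show ?thesis
      unfolding True f_def[symmetric] by (simp add: profile_def weight_def algebra_simps)
  next
    case False
    have fin: "finite (S - {i, j})" "finite (V - S - {i, j})"
      using finite_V S_sub finite_subset by auto
    have "(\<Sum>l\<in>V. A i l * f l) = A i i * f i + (A i j * d
        + ((\<Sum>l\<in>S - {i, j}. A i l * f l) + (\<Sum>l\<in>V - S - {i, j}. A i l * f l)))"
    proof -
      have "(\<Sum>l\<in>(S - {i, j}) \<union> (V - S - {i, j}). A i l * f l)
          = (\<Sum>l\<in>S - {i, j}. A i l * f l) + (\<Sum>l\<in>V - S - {i, j}. A i l * f l)"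
        using fin by (intro sum.union_disjoint) auto
      moreover have "(S - {i, j}) \<union> (V - S - {i, j}) = V - {i} - {j}"
        using S_sub by auto
      moreover have "(\<Sum>l\<in>V. A i l * f l) = A i i * f i + (\<Sum>l\<in>V - {i}. A i l * f l)"
        by (rule sum.remove[OF finite_V \<open>i \<in> V\<close>])
      moreover have "(\<Sum>l\<in>V - {i}. A i l * f l) = A i j * f j + (\<Sum>l\<in>V - {i} - {j}. A i l * f l)"
        using \<open>j \<in> V\<close> finite_V False by (intro sum.remove) auto
      ultimately show ?thesis by (simp only: f_diag)
    qed
    moreover have "q * (\<Sum>l\<in>S - {i, j}. A i l * f l)
        = b * (\<Sum>l\<in>S - {i, j}. A i l * of_bool (g l j)) + c * (\<Sum>l\<in>S - {i, j}. A i l)"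
      unfolding sum_distrib_left sum.distrib[symmetric]
      using \<open>0 < q\<close> by (intro sum.cong) (auto simp: f_off \<beta>_def \<gamma>_def field_simps)
    moreover have "q * (\<Sum>l\<in>V - S - {i, j}. A i l * f l)
        = b' * (\<Sum>l\<in>V - S - {i, j}. A i l * of_bool (g l j)) + c' * (\<Sum>l\<in>V - S - {i, j}. A i l)"
      unfolding sum_distrib_left sum.distrib[symmetric]
      using \<open>0 < q\<close> by (intro sum.cong) (auto simp: f_off \<beta>_def \<gamma>_def field_simps)
    moreover have "q * (A i i * f i) = A i i * (\<beta> i * of_bool (g i j) + \<gamma> i)"
      using \<open>0 < q\<close> by (simp add: f_off[OF False])
    \<comment> \<open>The main terms cancel by the choice of t. The six remainders are controlled,
      in this order, by \<open>A_diag\<close>, \<open>A_off\<close>, \<open>path_in\<close>,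
      \<open>sum_in\<close>, \<open>path_out\<close> and \<open>sum_out\<close>.\<close>
    ultimately have "q * (\<Sum>l\<in>V. A i l * f l)
      - (((\<rho> - \<kappa>) * \<beta> i + \<kappa> * d) * of_bool (g i j) + ((\<rho> - \<kappa>) * \<gamma> i + t))
      = (A i i - (\<rho> - \<kappa>)) * (\<beta> i * of_bool (g i j) + \<gamma> i)
        + (q * A i j - \<kappa> * of_bool (g i j)) * d
        + b * ((\<Sum>l\<in>S - {i, j}. A i l * of_bool (g l j)) - \<kappa> * \<xi> * p)
        + c * ((\<Sum>l\<in>S - {i, j}. A i l) - \<kappa> * \<xi>)
        + b' * ((\<Sum>l\<in>V - S - {i, j}. A i l * of_bool (g l j)) - \<kappa> * (1 - \<xi>) * p)
        + c' * ((\<Sum>l\<in>V - S - {i, j}. A i l) - \<kappa> * (1 - \<xi>))" (is "?lhs = ?e1 + ?e2 + ?e3 + ?e4 + ?e5 + ?e6")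
      unfolding assms by (simp add: algebra_simps)
    moreover have "\<bar>?e1\<bar> \<le> 2 * (B * \<epsilon>)"
    proof -
      have "\<bar>?e1\<bar> \<le> \<epsilon> * (2 * B)"
        unfolding abs_mult using A_diag[OF \<open>i \<in> V\<close>] bg_le eps_pos by (intro mult_mono) auto
      then show ?thesis by (simp add: mult_ac)
    qed
    moreover have "\<bar>?e2\<bar> \<le> B * \<epsilon>"
      by (subst mult.commute) (rule mult_bound[OF B(1) A_off[OF \<open>i \<in> V\<close> \<open>j \<in> V\<close> False]])
    moreover have "\<bar>?e3\<bar> \<le> B * \<epsilon>" "\<bar>?e4\<bar> \<le> B * \<epsilon>" "\<bar>?e5\<bar> \<le> B * \<epsilon>" "\<bar>?e6\<bar> \<le> B * \<epsilon>"
      by (rule mult_bound[OF B(2) path_in[OF \<open>i \<in> V\<close> \<open>j \<in> V\<close> False]],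
          rule mult_bound[OF B(4) sum_in[OF \<open>i \<in> V\<close> \<open>j \<in> V\<close> False]],
          rule mult_bound[OF B(3) path_out[OF \<open>i \<in> V\<close> \<open>j \<in> V\<close> False]],
          rule mult_bound[OF B(5) sum_out[OF \<open>i \<in> V\<close> \<open>j \<in> V\<close> False]])
    ultimately have "\<bar>?lhs\<bar> \<le> 7 * (B * \<epsilon>)"
      by (simp only: abs_sum6_le)
    then have "\<bar>?lhs\<bar> \<le> 7 * B * \<epsilon>" by simp
    then have "\<bar>?lhs / q\<bar> \<le> 7 * B * \<epsilon> / q"
      using \<open>0 < q\<close> by (simp add: divide_right_mono)
    moreover have "?lhs / q = (\<Sum>l\<in>V. A i l * f l)
      - profile j ((\<rho> - \<kappa>) * d) ((\<rho> - \<kappa>) * b + \<kappa> * d) ((\<rho> - \<kappa>) * b' + \<kappa> * d)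
          ((\<rho> - \<kappa>) * c + t) ((\<rho> - \<kappa>) * c' + t) i"
      using False \<open>0 < q\<close> by (simp add: profile_def \<beta>_def \<gamma>_def diff_divide_distrib)
    ultimately show ?thesis
      using False by (simp only: f_def weight_def if_False times_divide_eq_right mult_1_right)
  qed
qed

text \<open>The maximum principle on V bounds both vectors by r / (1 - \<rho>), node j included.
  Repeated on V without j, it sees the error at j only through A i j \<le> 2 / q, so its residual
  has the small size 1 / q.\<close>

lemma two_step_stability:
  assumes "i \<in> V" "j \<in> V" "i \<noteq> j" "0 \<le> r"
    and u: "\<And>i. i \<in> V \<Longrightarrow> \<bar>u i\<bar> \<le> r * weight j i + (\<Sum>l\<in>V. A i l * \<bar>v l\<bar>)"
    and v: "\<And>i. i \<in> V \<Longrightarrow> \<bar>v i\<bar> \<le> r * weight j i + (\<Sum>l\<in>V. A i l * \<bar>u l\<bar>)"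
  shows "\<bar>q * u i\<bar> \<le> 3 * r / (1 - \<rho>)\<^sup>2"
proof -
  have "0 < q" using q_ge by simp
  have "0 < \<rho>" using \<kappa>_pos \<kappa>_le by simp
  have "weight j l \<le> 1" for l using q_ge by (simp add: weight_def)
  then have w: "r * weight j l \<le> r" for l using \<open>0 \<le> r\<close> by (simp add: mult_left_le)
  have all: "\<bar>u l\<bar> \<le> r / (1 - \<rho>) \<and> \<bar>v l\<bar> \<le> r / (1 - \<rho>)" if "l \<in> V" for l
    by (rule two_step_maximum_principle[where A = A])
      (use finite_V A_nonneg A_row \<rho>_less that u v w in \<open>fastforce intro: order_trans[OF _ add_right_mono]\<close>)+
  \<comment> \<open>The 3 consists of 1 for the residual r / q, enlarged by the factor 1 / (1 -
    \<rho>), and 2 for A i j \<le> 2 / q times the error at j.\<close>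
  define r' where "r' = r / q * (3 / (1 - \<rho>))"
  have step: "r * weight j i + (\<Sum>l\<in>V. A i l * \<bar>z l\<bar>) \<le> r' + (\<Sum>l\<in>V - {j}. A i l * \<bar>z l\<bar>)"
    if "i \<in> V - {j}" "\<bar>z j\<bar> \<le> r / (1 - \<rho>)" for i and z :: "nat \<Rightarrow> real"
  proof -
    have "q * A i j \<le> 2"
      using A_off[of i j] that \<open>j \<in> V\<close> \<kappa>_le \<rho>_less eps_le by (auto simp: of_bool_def split: if_splits)
    then have "A i j \<le> 2 / q" using \<open>0 < q\<close> by (simp add: field_simps)
    then have "A i j * \<bar>z j\<bar> \<le> 2 / q * (r / (1 - \<rho>))"
      using that \<open>0 < q\<close> by (intro mult_mono) auto
    moreover have "r / q * 1 \<le> r / q * (1 / (1 - \<rho>))"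
      using \<open>0 \<le> r\<close> \<open>0 < q\<close> \<open>0 < \<rho>\<close> \<rho>_less by (intro mult_left_mono) auto
    moreover have "r' = r / q * (1 / (1 - \<rho>)) + 2 / q * (r / (1 - \<rho>))"
      by (simp add: r'_def flip: add_divide_distrib)
    ultimately have "r / q + A i j * \<bar>z j\<bar> \<le> r'"
      by linarith
    then show ?thesis
      using that sum.remove[OF finite_V \<open>j \<in> V\<close>, of "\<lambda>l. A i l * \<bar>z l\<bar>"]
      by (simp add: weight_def)
  qed
  have "\<bar>u i\<bar> \<le> r' / (1 - \<rho>) \<and> \<bar>v i\<bar> \<le> r' / (1 - \<rho>)"
  proof (rule two_step_maximum_principle[where A = A and I = "V - {j}"])
    show "(\<Sum>l\<in>V - {j}. A i l) \<le> \<rho>" if "i \<in> V - {j}" for i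
      using A_row[of i] that A_nonneg finite_V by (smt (verit) Diff_iff Diff_subset sum_mono2)
    show "\<bar>u i\<bar> \<le> r' + (\<Sum>l\<in>V - {j}. A i l * \<bar>v l\<bar>)" if "i \<in> V - {j}" for i
      using u[of i] step[of i v] all[OF \<open>j \<in> V\<close>] that by force
    show "\<bar>v i\<bar> \<le> r' + (\<Sum>l\<in>V - {j}. A i l * \<bar>u l\<bar>)" if "i \<in> V - {j}" for i
      using v[of i] step[of i u] all[OF \<open>j \<in> V\<close>] that by force
  qed (use finite_V A_nonneg \<rho>_less assms in auto)
  then have "\<bar>q * u i\<bar> \<le> q * (r' / (1 - \<rho>))"
    using \<open>0 < q\<close> unfolding abs_mult by (intro mult_mono) auto
  also have "\<dots> = 3 * r / (1 - \<rho>)\<^sup>2"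
    using \<open>0 < q\<close> by (simp add: r'_def power2_eq_square)
  finally show ?thesis .
qed

text \<open>X is a column of \<tau> (I - s A)^(-1). The coefficients d, b, c are the exact fixed
  point of the action of A on profiles, so the only residual is the error of
  \<open>diffusion_of_profile\<close>. The constant c feeds back into itself both through the loop,
  with factor \<rho> - \<kappa>, and through all other nodes, with factor \<kappa>; hence its
  denominator 1 - s * \<rho>. The constant 21 is 3 * 7.\<close>

lemma resolvent_entries:
  assumes "i \<in> V" "j \<in> V" "i \<noteq> j" and s: "s = 1 \<or> s = -1"
    and X: "\<And>i. i \<in> V \<Longrightarrow> X i = \<tau> * of_bool (i = j) + s * (\<Sum>l\<in>V. A i l * X l)"
    and d: "d = \<tau> / (1 - s * (\<rho> - \<kappa>))" and b: "b = s * \<kappa> * d / (1 - s * (\<rho> - \<kappa>))"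
    and c: "c = s * \<kappa> * b * p / (1 - s * \<rho>)"
  shows "\<bar>q * X i - (b * of_bool (g i j) + c)\<bar> \<le> 21 * (\<bar>d\<bar> + \<bar>b\<bar> + \<bar>c\<bar>) * \<epsilon> / (1 - \<rho>)\<^sup>2"
proof -
  define B where "B = \<bar>d\<bar> + \<bar>b\<bar> + \<bar>c\<bar>"
  define f where "f = profile j d b b c c"
  define t where "t = \<kappa> * (\<xi> * (b * p + c) + (1 - \<xi>) * (b * p + c))"
  define h where "h = profile j ((\<rho> - \<kappa>) * d) ((\<rho> - \<kappa>) * b + \<kappa> * d) ((\<rho> - \<kappa>) * b + \<kappa> * d)
          ((\<rho> - \<kappa>) * c + t) ((\<rho> - \<kappa>) * c + t)"
  have nz: "1 - s * (\<rho> - \<kappa>) \<noteq> 0" "1 - s * \<rho> \<noteq> 0"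
    using s \<kappa>_pos \<kappa>_le \<rho>_less by auto
  have eqs: "d = \<tau> + s * (\<rho> - \<kappa>) * d" "b = s * ((\<rho> - \<kappa>) * b + \<kappa> * d)"
    "c = s * ((\<rho> - \<kappa>) * c + t)"
  proof -
    have "d * (1 - s * (\<rho> - \<kappa>)) = \<tau>"
      using nz by (simp add: d)
    then show "d = \<tau> + s * (\<rho> - \<kappa>) * d" by (simp add: algebra_simps)
    have "b * (1 - s * (\<rho> - \<kappa>)) = s * \<kappa> * d"
      using nz by (simp add: b)
    then show "b = s * ((\<rho> - \<kappa>) * b + \<kappa> * d)" by (simp add: algebra_simps)
    have "c * (1 - s * \<rho>) = s * \<kappa> * b * p"
      using nz by (simp add: c)
    then show "c = s * ((\<rho> - \<kappa>) * c + t)" by (simp add: t_def algebra_simps)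
  qed
  have fixed: "f k = \<tau> * of_bool (k = j) + s * h k" for k
    using eqs by (simp add: f_def h_def profile_def flip: add_divide_distrib times_divide_eq_right)
      (simp add: algebra_simps)
  have err: "\<bar>(\<Sum>l\<in>V. A k l * f l) - h k\<bar> \<le> 7 * B * \<epsilon> * weight j k" if "k \<in> V" for k
    unfolding f_def h_def by (rule diffusion_of_profile[OF that \<open>j \<in> V\<close>]) (auto simp: B_def t_def)
  have s_abs: "\<bar>s\<bar> = 1" using s by auto
  have z: "\<bar>X k - f k\<bar> \<le> 7 * B * \<epsilon> * weight j k + (\<Sum>l\<in>V. A k l * \<bar>X l - f l\<bar>)"
    if "k \<in> V" for k
  proof -
    have "X k - f k = s * (\<Sum>l\<in>V. A k l * (X l - f l)) + s * ((\<Sum>l\<in>V. A k l * f l) - h k)"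
      unfolding X[OF that] fixed[of k] by (simp add: sum_subtractf right_diff_distrib algebra_simps)
    also have "\<bar>\<dots>\<bar> \<le> \<bar>\<Sum>l\<in>V. A k l * (X l - f l)\<bar> + \<bar>(\<Sum>l\<in>V. A k l * f l) - h k\<bar>"
      using abs_triangle_ineq by (simp add: abs_mult s_abs order_trans[OF abs_triangle_ineq])
    also have "\<bar>\<Sum>l\<in>V. A k l * (X l - f l)\<bar> \<le> (\<Sum>l\<in>V. A k l * \<bar>X l - f l\<bar>)"
      using A_nonneg[OF that] by (intro order_trans[OF sum_abs]) (simp add: abs_mult)
    finally show ?thesis using err[OF that] by simp
  qed
  \<comment> \<open>Both vectors of \<open>two_step_stability\<close> are taken to be X - f.\<close>
  have "\<bar>q * (X i - f i)\<bar> \<le> 3 * (7 * B * \<epsilon>) / (1 - \<rho>)\<^sup>2"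
    by (rule two_step_stability[OF assms(1-3) _ z z]) (use eps_pos in \<open>auto simp: B_def\<close>)
  moreover have "q * f i = b * of_bool (g i j) + c"
    using q_ge \<open>i \<noteq> j\<close> by (simp add: f_def profile_def)
  ultimately show ?thesis unfolding B_def[symmetric] by (simp add: right_diff_distrib mult.assoc)
qed

text \<open>Off j, the column v is zero on S and has entries about (b * g_kj + c) / q outside. Their
  average outside S, times q, is t = b * p + c, and since a row of A has mass about \<kappa> * (1 -
  \<xi>) there, A v acquires the constant \<eta>. Applying A once more and comparing outside S gives
  b = (\<rho> - \<kappa>)^2 * b + 2 * (\<rho> - \<kappa>) * \<kappa> and a linear equation for t,
  whose solution is the stated one. On S the edge coefficient of A v is \<kappa>, the gap.\<close>

lemma granger_entries:
  assumes "i \<in> S" "j \<in> S" "i \<noteq> j" "0 \<le> \<xi>" "\<xi> \<le> 1"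
    and v_in: "\<And>k. k \<in> S \<Longrightarrow> v k = of_bool (k = j)"
    and v_out: "\<And>k. k \<in> V - S \<Longrightarrow> v k = (\<Sum>l\<in>V. A k l * (\<Sum>m\<in>V. A l m * v m))"
    and t: "t = \<kappa> * p * (2 * \<rho> - \<kappa>) / (1 - (\<rho>\<^sup>2 - 2 * \<rho> * \<kappa> * \<xi> + \<kappa>\<^sup>2 * \<xi>))"
    and \<eta>: "\<eta> = \<kappa> * (1 - \<xi>) * t"
    and b: "b = 2 * (\<rho> - \<kappa>) * \<kappa> / (1 - (\<rho> - \<kappa>)\<^sup>2)" and c: "c = t - b * p"
    and B: "B = 1 + \<bar>b\<bar> + \<bar>c\<bar> + \<bar>\<eta>\<bar> + \<bar>(\<rho> - \<kappa>) * b + \<kappa>\<bar> + \<bar>(\<rho> - \<kappa>) * c + \<eta>\<bar>"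
  shows "\<bar>q * (\<Sum>l\<in>V. A i l * v l) - (\<kappa> * of_bool (g i j) + \<eta>)\<bar> \<le> 21 * B * \<epsilon> / (1 - \<rho>)\<^sup>2"
proof -
  define a where "a = \<rho> - \<kappa>"
  have a: "0 \<le> a" "a < 1" "\<rho> = a + \<kappa>" using \<kappa>_pos \<kappa>_le \<rho>_less by (auto simp: a_def)
  define b2 where "b2 = a * b + \<kappa>"
  define c2 where "c2 = a * c + \<eta>"
  define u where "u k = (\<Sum>l\<in>V. A k l * v l)" for k
  define vt where "vt = profile j 1 0 b 0 c"
  define ut where "ut = profile j a \<kappa> b2 \<eta> c2"
  have B_ge: "1 \<le> B" "\<bar>a\<bar> \<le> B" "\<bar>\<kappa>\<bar> \<le> B" "\<bar>b\<bar> \<le> B" "\<bar>c\<bar> \<le> B" "\<bar>\<eta>\<bar> \<le> B" "\<bar>b2\<bar> \<le> B" "\<bar>c2\<bar> \<le> B"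
    using a \<kappa>_pos \<kappa>_le \<rho>_less unfolding B b2_def c2_def a_def[symmetric] by linarith+
  have err_u: "\<bar>(\<Sum>l\<in>V. A k l * vt l) - ut k\<bar> \<le> 7 * B * \<epsilon> * weight j k" if "k \<in> V" for k
  proof -
    have "\<eta> = \<kappa> * (\<xi> * (0 * p + 0) + (1 - \<xi>) * (b * p + c))" by (simp add: \<eta> c)
    from diffusion_of_profile[OF that _ _ _ _ _ _ this, of j 1 B] show ?thesis
      using B_ge \<open>j \<in> S\<close> S_sub by (auto simp: ut_def vt_def b2_def c2_def a_def)
  qed
  have err_v: "\<bar>(\<Sum>l\<in>V. A k l * ut l) - vt k\<bar> \<le> 7 * B * \<epsilon> * weight j k" if "k \<in> V - S" for k
  proof -
    define t' where "t' = \<kappa> * (\<xi> * (\<kappa> * p + \<eta>) + (1 - \<xi>) * (b2 * p + c2))"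
    have "0 < 1 - a\<^sup>2" using a by (simp add: power_less_one_iff abs_square_less_1)
    then have b_eq: "b * (1 - a\<^sup>2) = 2 * a * \<kappa>" by (simp add: b a_def)
    \<comment> \<open>This is the denominator of t in a form that shows its sign.\<close>
    have "0 < 1 - \<rho>\<^sup>2 + \<kappa> * (2 * \<rho> - \<kappa>) * \<xi>"
    proof (rule add_pos_nonneg)
      show "0 < 1 - \<rho>\<^sup>2" using \<kappa>_pos \<kappa>_le \<rho>_less by (simp add: abs_square_less_1)
      show "0 \<le> \<kappa> * (2 * \<rho> - \<kappa>) * \<xi>" using \<kappa>_pos \<kappa>_le \<open>0 \<le> \<xi>\<close> by simp
    qed
    then have "1 - (\<rho>\<^sup>2 - 2 * \<rho> * \<kappa> * \<xi> + \<kappa>\<^sup>2 * \<xi>) \<noteq> 0"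
      by (simp add: algebra_simps power2_eq_square)
    then have t_eq: "t * (1 - (\<rho>\<^sup>2 - 2 * \<rho> * \<kappa> * \<xi> + \<kappa>\<^sup>2 * \<xi>)) = \<kappa> * p * (2 * \<rho> - \<kappa>)"
      by (simp add: t)
    have "a * b2 + \<kappa> * a = b" using b_eq by (simp add: b2_def algebra_simps power2_eq_square)
    have "a * c2 + t' = c"
    proof -
      have "b * p * (1 - a\<^sup>2) = 2 * a * \<kappa> * p" using b_eq by (simp add: mult_ac)
      then show ?thesis
        using t_eq unfolding t'_def c2_def b2_def \<eta> c \<open>\<rho> = a + \<kappa>\<close>
        by (simp only: algebra_simps power2_eq_square)
    qed
    have "k \<noteq> j" "k \<in> V" "j \<in> V" using that \<open>j \<in> S\<close> S_sub by auto
    have "\<bar>(\<Sum>l\<in>V. A k l * ut l) - profile j (a * a) (a * \<kappa> + \<kappa> * a) (a * b2 + \<kappa> * a)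
        (a * \<eta> + t') (a * c2 + t') k\<bar> \<le> 7 * B * \<epsilon> * weight j k"
      unfolding ut_def a_def
      by (rule diffusion_of_profile[OF \<open>k \<in> V\<close> \<open>j \<in> V\<close> _ _ _ _ _ t'_def])
        (use B_ge in \<open>auto simp: a_def\<close>)
    \<comment> \<open>Only the coefficients outside S have to match here, since v = A u is required
      only there; on S the column is prescribed and agrees with \<open>vt\<close> exactly.\<close>
    moreover have "profile j (a * a) (a * \<kappa> + \<kappa> * a) (a * b2 + \<kappa> * a) (a * \<eta> + t') (a * c2 + t') k = vt k"
      using \<open>k \<noteq> j\<close> \<open>k \<in> V - S\<close> \<open>a * b2 + \<kappa> * a = b\<close> \<open>a * c2 + t' = c\<close>
      by (simp add: vt_def profile_def)
    ultimately show ?thesis by simp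
  qed
  have abs_sum: "\<bar>\<Sum>l\<in>V. A k l * z l\<bar> \<le> (\<Sum>l\<in>V. A k l * \<bar>z l\<bar>)" if "k \<in> V" for k and z :: "nat \<Rightarrow> real"
    using A_nonneg[OF that] by (intro order_trans[OF sum_abs]) (simp add: abs_mult)
  have "\<bar>q * (u i - ut i)\<bar> \<le> 3 * (7 * B * \<epsilon>) / (1 - \<rho>)\<^sup>2"
  proof (rule two_step_stability)
    show "\<bar>u k - ut k\<bar> \<le> 7 * B * \<epsilon> * weight j k + (\<Sum>l\<in>V. A k l * \<bar>v l - vt l\<bar>)" if "k \<in> V" for k
    proof -
      have "u k - ut k = (\<Sum>l\<in>V. A k l * (v l - vt l)) + ((\<Sum>l\<in>V. A k l * vt l) - ut k)"
        by (simp add: u_def sum_subtractf right_diff_distrib)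
      then show ?thesis
        using abs_sum[OF that, of "\<lambda>l. v l - vt l"] err_u[OF that] by linarith
    qed
    show "\<bar>v k - vt k\<bar> \<le> 7 * B * \<epsilon> * weight j k + (\<Sum>l\<in>V. A k l * \<bar>u l - ut l\<bar>)" if "k \<in> V" for k
    proof (cases "k \<in> S")
      case True
      then have "v k - vt k = 0" using \<open>j \<in> S\<close> by (simp add: v_in vt_def profile_def)
      moreover have "0 \<le> (\<Sum>l\<in>V. A k l * \<bar>u l - ut l\<bar>)"
        using A_nonneg that by (intro sum_nonneg) auto
      moreover have "0 \<le> 7 * B * \<epsilon> * weight j k"
        using B_ge eps_pos q_ge by (simp add: weight_def)
      ultimately show ?thesis by simp
    next
      case False
      then have "k \<in> V - S" using that by simp
      have "v k - vt k = (\<Sum>l\<in>V. A k l * (u l - ut l)) + ((\<Sum>l\<in>V. A k l * ut l) - vt k)"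
        using v_out[OF \<open>k \<in> V - S\<close>] by (simp add: u_def sum_subtractf right_diff_distrib)
      then show ?thesis
        using abs_sum[OF that, of "\<lambda>l. u l - ut l"] err_v[OF \<open>k \<in> V - S\<close>] by linarith
    qed
  qed (use assms(1-3) S_sub B_ge eps_pos in auto)
  moreover have "q * ut i = \<kappa> * of_bool (g i j) + \<eta>"
    using q_ge \<open>i \<noteq> j\<close> \<open>i \<in> S\<close> by (simp add: ut_def profile_def)
  ultimately show ?thesis by (simp add: u_def right_diff_distrib)
qed

end

section \<open>Concentration in the random graph\<close>

text \<open>For t = - s < 0 it follows from (1 - s + s^2) * (1 + s) = 1 + s^3 \<ge> 1 together with
  1 + s \<le> exp s.\<close>

lemma exp_le_quadratic:
  fixes t :: real
  assumes "\<bar>t\<bar> \<le> 1"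
  shows "exp t \<le> 1 + t + t\<^sup>2"
proof (cases "0 \<le> t")
  case True
  then show ?thesis using exp_bound[of t] assms by simp
next
  case False
  define s where "s = - t"
  have s: "0 < s" "s \<le> 1" using False assms by (auto simp: s_def)
  have "1 \<le> (1 - s + s\<^sup>2) * (1 + s)"
    using s by (simp add: algebra_simps power2_eq_square)
  also have "\<dots> \<le> (1 - s + s\<^sup>2) * exp s"
    using s exp_ge_add_one_self[of s] by (intro mult_left_mono) (auto simp: add.commute)
  finally have "exp (- s) \<le> 1 - s + s\<^sup>2"
    by (simp add: exp_minus field_simps)
  then show ?thesis by (simp add: s_def)
qed

section \<open>Chernoff bounds for degrees and numbers of common neighbours\<close>

context prob_space begin

text \<open>A Chernoff bound in which q only dominates the mean. Deviations are measured in units of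
  q, so the same tail holds for common neighbours, whose mean of order N p^2 may be far below q = N
  p. The sign s treats both tails, and e \<le> 2 keeps the exponential parameter within the range of
  the quadratic bound.\<close>

lemma indicator_sum_upper_tail:
  fixes Y :: "'i \<Rightarrow> 'a \<Rightarrow> bool" and s e q m :: real
  assumes "finite T"
    and indep: "indep_vars (\<lambda>_. count_space UNIV) Y T"
    and mean: "\<And>l. l \<in> T \<Longrightarrow> prob {\<omega> \<in> space M. Y l \<omega>} = m"
    and size: "real (card T) * m \<le> q" and s: "s = 1 \<or> s = -1" and e: "0 < e" "e \<le> 2"
  shows "prob {\<omega> \<in> space M. e * q \<le> s * ((\<Sum>l\<in>T. of_bool (Y l \<omega>)) - real (card T) * m)}
    \<le> exp (- (e\<^sup>2 * q / 4))"
proof -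
  \<comment> \<open>\<open>t\<close> minimises the exponent \<open>q * t\<^sup>2 - s * t * e * q\<close>.\<close>
  define t where "t = s * e / 2"
  have t: "\<bar>t\<bar> \<le> 1" "t\<^sup>2 = e\<^sup>2 / 4" using s e by (auto simp: t_def power_mult_distrib power_divide)
  define X :: "'i \<Rightarrow> 'a \<Rightarrow> real" where "X l \<omega> = exp (t * of_bool (Y l \<omega>))" for l \<omega>
  have Y_rv: "Y l \<in> measurable M (count_space UNIV)" if "l \<in> T" for l
    using indep that by (auto simp: indep_vars_def)
  have X_eq: "X l \<omega> = 1 + (exp t - 1) * indicator {\<omega> \<in> space M. Y l \<omega>} \<omega>" if "\<omega> \<in> space M" for l \<omega>
    using that by (auto simp: X_def indicator_def)
  have Y_ev[measurable]: "{\<omega> \<in> space M. Y l \<omega>} \<in> events" if "l \<in> T" for l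
    using measurable_sets[OF Y_rv[OF that], of "{True}"] by (simp add: vimage_def Int_def conj_commute)
  have X_int: "integrable M (X l)" and X_mean: "expectation (X l) = 1 + (exp t - 1) * m" if "l \<in> T" for l
  proof -
    have ind: "integrable M (indicator {\<omega> \<in> space M. Y l \<omega>} :: 'a \<Rightarrow> real)"
      using Y_ev[OF that] by (intro integrable_real_indicator) (auto simp: emeasure_eq_measure)
    then have i: "integrable M (\<lambda>\<omega>. 1 + (exp t - 1) * indicator {\<omega> \<in> space M. Y l \<omega>} \<omega> :: real)"
      by (intro Bochner_Integration.integrable_add integrable_mult_right) auto
    then show "integrable M (X l)"
      by (rule Bochner_Integration.integrable_cong[THEN iffD2, rotated 2]) (auto simp: X_eq)
    have "expectation (X l) = expectation (\<lambda>\<omega>. 1 + (exp t - 1) * indicator {\<omega> \<in> space M. Y l \<omega>} \<omega>)"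
      by (rule Bochner_Integration.integral_cong) (auto simp: X_eq)
    then show "expectation (X l) = 1 + (exp t - 1) * m"
      using Y_ev[OF that] mean[OF that] ind by (simp add: Bochner_Integration.integral_add prob_space)
  qed
  have X_indep: "indep_vars (\<lambda>_. borel) X T"
    unfolding X_def by (rule indep_vars_compose2[OF indep]) auto
  define Z where "Z \<omega> = (\<Prod>l\<in>T. X l \<omega>)" for \<omega>
  define n where "n = real (card T)"
  have "n * m * t\<^sup>2 \<le> q * t\<^sup>2" using size by (simp add: n_def mult_right_mono)
  have Z_int: "integrable M Z"
    unfolding Z_def by (rule indep_vars_integrable[OF \<open>finite T\<close> X_indep X_int])
  have m: "0 \<le> m" if "T \<noteq> {}"
    using that mean by (metis all_not_in_conv measure_nonneg)
  have "expectation Z = (\<Prod>l\<in>T. 1 + (exp t - 1) * m)"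
    unfolding Z_def using indep_vars_lebesgue_integral[OF \<open>finite T\<close> X_indep X_int] X_mean by simp
  also have "\<dots> \<le> (\<Prod>l\<in>T. exp ((t + t\<^sup>2) * m))"
  proof (rule prod_mono)
    fix l assume "l \<in> T"
    have "0 \<le> expectation (X l)" by (rule Bochner_Integration.integral_nonneg) (simp add: X_def)
    moreover have "(exp t - 1) * m \<le> (t + t\<^sup>2) * m"
      using exp_le_quadratic[OF t(1)] m \<open>l \<in> T\<close> by (intro mult_right_mono) auto
    moreover have "1 + (t + t\<^sup>2) * m \<le> exp ((t + t\<^sup>2) * m)" by (rule exp_ge_add_one_self)
    ultimately show "0 \<le> 1 + (exp t - 1) * m \<and> 1 + (exp t - 1) * m \<le> exp ((t + t\<^sup>2) * m)"
      using X_mean[OF \<open>l \<in> T\<close>] by (metis add_left_mono order_trans)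
  qed
  also have "\<dots> = exp (t * n * m + n * m * t\<^sup>2)"
    by (simp add: n_def exp_of_nat_mult[symmetric] algebra_simps)
  also have "\<dots> \<le> exp (t * n * m + q * t\<^sup>2)"
    using \<open>n * m * t\<^sup>2 \<le> q * t\<^sup>2\<close> by simp
  finally have Z_mean: "expectation Z \<le> exp (t * n * m + q * t\<^sup>2)" .
  have Z_eq: "Z \<omega> = exp (t * (\<Sum>l\<in>T. of_bool (Y l \<omega>)))" for \<omega>
    by (simp add: Z_def X_def exp_sum[OF \<open>finite T\<close>] sum_distrib_left)
  have "e * q \<le> s * ((\<Sum>l\<in>T. of_bool (Y l \<omega>)) - n * m)
      \<longleftrightarrow> exp (t * n * m + e\<^sup>2 * q / 2) \<le> Z \<omega>" for \<omega>
  proof -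
    define D where "D = (\<Sum>l\<in>T. of_bool (Y l \<omega>)) - n * m"
    have "e * q \<le> s * D \<longleftrightarrow> e * q * (e / 2) \<le> s * D * (e / 2)"
      using e by (subst mult_le_cancel_right_pos) auto
    also have "\<dots> \<longleftrightarrow> e\<^sup>2 * q / 2 \<le> t * D"
      by (simp add: t_def power2_eq_square mult_ac)
    also have "\<dots> \<longleftrightarrow> t * n * m + e\<^sup>2 * q / 2 \<le> t * (\<Sum>l\<in>T. of_bool (Y l \<omega>))"
      by (simp add: D_def algebra_simps)
    finally show ?thesis by (simp add: Z_eq D_def)
  qed
  then have "prob {\<omega> \<in> space M. e * q \<le> s * ((\<Sum>l\<in>T. of_bool (Y l \<omega>)) - n * m)}
      = prob {\<omega> \<in> space M. exp (t * n * m + e\<^sup>2 * q / 2) \<le> Z \<omega>}"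
    by simp
  also have "\<dots> \<le> expectation Z / exp (t * n * m + e\<^sup>2 * q / 2)"
    by (rule integral_Markov_inequality_measure[where A = "{}"]) (use Z_int in \<open>auto simp: Z_eq[abs_def]\<close>)
  also have "\<dots> \<le> exp (t * n * m + q * t\<^sup>2) / exp (t * n * m + e\<^sup>2 * q / 2)"
    using Z_mean by (simp add: divide_right_mono)
  also have "\<dots> = exp (- (e\<^sup>2 * q / 4))"
    unfolding exp_diff[symmetric] by (simp add: t(2))
  finally show ?thesis by (simp add: n_def)
qed

lemma indicator_sum_concentration:
  fixes Y :: "'i \<Rightarrow> 'a \<Rightarrow> bool" and e q m :: real
  assumes "finite T"
    and indep: "indep_vars (\<lambda>_. count_space UNIV) Y T"
    and mean: "\<And>l. l \<in> T \<Longrightarrow> prob {\<omega> \<in> space M. Y l \<omega>} = m"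
    and size: "real (card T) * m \<le> q" and e: "0 < e" "e \<le> 2"
  shows "prob {\<omega> \<in> space M. e * q \<le> \<bar>(\<Sum>l\<in>T. of_bool (Y l \<omega>)) - real (card T) * m\<bar>}
    \<le> 2 * exp (- (e\<^sup>2 * q / 4))"
proof -
  define D where "D \<omega> = (\<Sum>l\<in>T. of_bool (Y l \<omega>)) - real (card T) * m" for \<omega>
  have [measurable]: "Y l \<in> measurable M (count_space UNIV)" if "l \<in> T" for l
    using indep that by (auto simp: indep_vars_def)
  have D_rv[measurable]: "D \<in> borel_measurable M"
    unfolding D_def by (intro borel_measurable_diff borel_measurable_sum borel_measurable_const) measurable
  have "{\<omega> \<in> space M. e * q \<le> \<bar>D \<omega>\<bar>}
      = {\<omega> \<in> space M. e * q \<le> 1 * D \<omega>} \<union> {\<omega> \<in> space M. e * q \<le> -1 * D \<omega>}"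
    by auto
  then have "prob {\<omega> \<in> space M. e * q \<le> \<bar>D \<omega>\<bar>}
      \<le> prob {\<omega> \<in> space M. e * q \<le> 1 * D \<omega>} + prob {\<omega> \<in> space M. e * q \<le> -1 * D \<omega>}"
    by (simp only:) (intro measure_Un_le; measurable)
  also have "\<dots> \<le> exp (- (e\<^sup>2 * q / 4)) + exp (- (e\<^sup>2 * q / 4))"
    unfolding D_def by (intro add_mono indicator_sum_upper_tail assms) auto
  finally show ?thesis by (simp add: D_def)
qed

text \<open>For distinct l outside {i, j} the edge sets {il, jl} are disjoint, so functions of them
  are independent. With i = j the event is a single edge, so degrees are covered by the same
  statement.\<close>

lemma erdos_renyi_common_neighbours_indep:
  assumes er: "erdos_renyi M N p G" and p: "0 \<le> p" "p \<le> 1"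
    and "i \<in> {1..N}" "j \<in> {1..N}" and T: "T \<subseteq> {1..N} - {i, j}"
  shows "indep_vars (\<lambda>_. count_space UNIV) (\<lambda>l \<omega>. G \<omega> i l \<and> G \<omega> l j) T"
    and "l \<in> T \<Longrightarrow> prob {\<omega> \<in> space M. G \<omega> i l \<and> G \<omega> l j} = (if i = j then p else p\<^sup>2)"
proof -
  define P where "P = {(i, j). 1 \<le> i \<and> i < j \<and> j \<le> N}"
  \<comment> \<open>Independence is assumed only for edges written with increasing endpoints, so
    every edge is brought into that form.\<close>
  define pr where "pr k l = (min k l, max k l)" for k l :: nat
  have indep: "indep_vars (\<lambda>_. count_space UNIV) (\<lambda>e \<omega>. G \<omega> (fst e) (snd e)) P"
    and dist: "\<And>i j. (i, j) \<in> P \<Longrightarrow> distr M (count_space UNIV) (\<lambda>\<omega>. G \<omega> i j) = measure_pmf (bernoulli_pmf p)"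
    and sym: "\<And>\<omega> i j. \<omega> \<in> space M \<Longrightarrow> G \<omega> j i = G \<omega> i j"
    using er by (simp_all add: erdos_renyi_def P_def case_prod_beta')
  have pr_in: "pr k l \<in> P" if "k \<in> {1..N}" "l \<in> {1..N}" "k \<noteq> l" for k l
    using that by (auto simp: pr_def P_def min_def max_def)
  have G_pr: "G \<omega> (fst (pr k l)) (snd (pr k l)) = G \<omega> k l" if "\<omega> \<in> space M" for \<omega> k l
    using sym[OF that] by (auto simp: pr_def min_def max_def)
  have pr_eq: "pr k l = pr k' l' \<longleftrightarrow> (k = k' \<and> l = l') \<or> (k = l' \<and> l = k')" for k l k' l'
    by (auto simp: pr_def min_def max_def split: if_splits)
  define K where "K l = {pr i l, pr j l}" for l
  have "indep_vars (\<lambda>l. PiM (K l) (\<lambda>_. count_space UNIV)) (\<lambda>l \<omega>. restrict (\<lambda>e. G \<omega> (fst e) (snd e)) (K l)) T"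
    using T assms(4,5) by (intro indep_vars_restrict[OF indep])
      (auto simp: K_def disjoint_family_on_def pr_eq intro!: pr_in)
  then have *: "indep_vars (\<lambda>_. count_space UNIV)
      (\<lambda>l \<omega>. restrict (\<lambda>e. G \<omega> (fst e) (snd e)) (K l) (pr i l) \<and> restrict (\<lambda>e. G \<omega> (fst e) (snd e)) (K l) (pr j l)) T"
    by (rule indep_vars_compose2[where Y = "\<lambda>l f. f (pr i l) \<and> f (pr j l)"])
      (auto simp: K_def intro!: measurable_compose[OF measurable_component_singleton] pred_intros_logic)
  have cong: "restrict (\<lambda>e. G \<omega> (fst e) (snd e)) (K l) (pr i l) \<and> restrict (\<lambda>e. G \<omega> (fst e) (snd e)) (K l) (pr j l)
      \<longleftrightarrow> G \<omega> i l \<and> G \<omega> l j" if "\<omega> \<in> space M" for \<omega> l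
    using that G_pr sym by (auto simp: K_def)
  \<comment> \<open>The ordered and the original edges agree only on the space of M, where G is
    symmetric, so the two families cannot simply be rewritten into each other.\<close>
  have ext: "indep_vars (\<lambda>_. count_space UNIV) X J \<Longrightarrow> indep_vars (\<lambda>_. count_space UNIV) Y J"
    if "\<And>\<omega> l. \<omega> \<in> space M \<Longrightarrow> X l \<omega> = Y l \<omega>" for X Y :: "nat \<Rightarrow> 'a \<Rightarrow> bool" and J
  proof -
    have "X l -` A \<inter> space M = Y l -` A \<inter> space M" for l A using that by auto
    then show "indep_vars (\<lambda>_. count_space UNIV) X J \<Longrightarrow> indep_vars (\<lambda>_. count_space UNIV) Y J"
      unfolding indep_vars_def2 by (simp add: that cong: measurable_cong)
  qed
  show "indep_vars (\<lambda>_. count_space UNIV) (\<lambda>l \<omega>. G \<omega> i l \<and> G \<omega> l j) T"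
    by (rule ext[OF cong *])
  assume "l \<in> T"
  then have l: "l \<in> {1..N}" "l \<noteq> i" "l \<noteq> j" using T by auto
  have edge: "prob {\<omega> \<in> space M. G \<omega> k l} = p" if "k \<in> {1..N}" "k \<noteq> l" for k
  proof -
    have "pr k l \<in> P" using pr_in that l by auto
    then have rv: "(\<lambda>\<omega>. G \<omega> (fst (pr k l)) (snd (pr k l))) \<in> measurable M (count_space UNIV)"
      using indep unfolding indep_vars_def by blast
    have "{\<omega> \<in> space M. G \<omega> k l} = (\<lambda>\<omega>. G \<omega> (fst (pr k l)) (snd (pr k l))) -` {True} \<inter> space M"
      using G_pr by auto
    then have "prob {\<omega> \<in> space M. G \<omega> k l}
        = measure (distr M (count_space UNIV) (\<lambda>\<omega>. G \<omega> (fst (pr k l)) (snd (pr k l)))) {True}"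
      by (simp add: measure_distr[OF rv])
    also have "\<dots> = p"
      using dist[of "fst (pr k l)" "snd (pr k l)"] \<open>pr k l \<in> P\<close> p by (simp add: measure_pmf_single)
    finally show ?thesis .
  qed
  show "prob {\<omega> \<in> space M. G \<omega> i l \<and> G \<omega> l j} = (if i = j then p else p\<^sup>2)"
  proof (cases "i = j")
    case True
    then have "{\<omega> \<in> space M. G \<omega> i l \<and> G \<omega> l j} = {\<omega> \<in> space M. G \<omega> i l}"
      using sym by auto
    then show ?thesis using edge[of i] l assms True by simp
  next
    case False
    then have "pr i l \<noteq> pr j l" by (simp add: pr_eq)
    have "indep_events (\<lambda>e. {\<omega> \<in> space M. G \<omega> (fst e) (snd e)}) P"
      by (rule indep_eventsI_indep_vars[OF indep, of "\<lambda>_ b. b", simplified])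
    then have edges: "prob (\<Inter>e\<in>J. {\<omega> \<in> space M. G \<omega> (fst e) (snd e)})
        = (\<Prod>e\<in>J. prob {\<omega> \<in> space M. G \<omega> (fst e) (snd e)})"
      if "J \<subseteq> P" "J \<noteq> {}" "finite J" for J
      using that unfolding indep_events_def by blast
    have "prob (\<Inter>e\<in>{pr i l, pr j l}. {\<omega> \<in> space M. G \<omega> (fst e) (snd e)})
        = (\<Prod>e\<in>{pr i l, pr j l}. prob {\<omega> \<in> space M. G \<omega> (fst e) (snd e)})"
      by (rule edges) (use l assms in \<open>auto intro: pr_in\<close>)
    moreover have "{\<omega> \<in> space M. G \<omega> (fst (pr k l)) (snd (pr k l))} = {\<omega> \<in> space M. G \<omega> k l}" for k
      using G_pr by auto
    moreover have "{\<omega> \<in> space M. G \<omega> i l} \<inter> {\<omega> \<in> space M. G \<omega> j l} = {\<omega> \<in> space M. G \<omega> i l \<and> G \<omega> l j}"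
      using sym by auto
    ultimately show ?thesis
      using False \<open>pr i l \<noteq> pr j l\<close> edge[of i] edge[of j] l assms by (simp add: power2_eq_square)
  qed
qed

lemma erdos_renyi_common_neighbours_concentration:
  assumes er: "erdos_renyi M N p G" and p: "0 \<le> p" "p \<le> 1"
    and "i \<in> {1..N}" "j \<in> {1..N}" and T: "T \<subseteq> {1..N} - {i, j}" and e: "0 < e" "e \<le> 2"
  shows "prob {\<omega> \<in> space M. e * (real N * p) \<le>
      \<bar>(\<Sum>l\<in>T. of_bool (G \<omega> i l \<and> G \<omega> l j)) - real (card T) * (if i = j then p else p\<^sup>2)\<bar>}
    \<le> 2 * exp (- (e\<^sup>2 * (real N * p) / 4))"
proof (rule indicator_sum_concentration)
  show "finite T" using T finite_subset by blast
  have "card T \<le> N" using card_mono[of "{1..N}" T] T by auto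
  moreover have "p\<^sup>2 \<le> p" using p by (simp add: power2_eq_square mult_left_le)
  ultimately show "real (card T) * (if i = j then p else p\<^sup>2) \<le> real N * p"
    using p by (auto intro!: mult_mono)
qed (use erdos_renyi_common_neighbours_indep[OF assms(1-6)] e in auto)

end

section \<open>Correlation matrices of the diffusion\<close>

lemma integrable_mult_square_integrable:
  fixes f h :: "'a \<Rightarrow> real"
  assumes [measurable]: "f \<in> borel_measurable M" "h \<in> borel_measurable M"
    and "integrable M (\<lambda>\<omega>. (f \<omega>)\<^sup>2)" "integrable M (\<lambda>\<omega>. (h \<omega>)\<^sup>2)"
  shows "integrable M (\<lambda>\<omega>. f \<omega> * h \<omega>)"
proof (rule Bochner_Integration.integrable_bound[OF Bochner_Integration.integrable_add[OF assms(3,4)]])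
  have "2 * \<bar>a * b\<bar> \<le> a\<^sup>2 + b\<^sup>2" for a b :: real
    using sum_squares_bound[of "\<bar>a\<bar>" "\<bar>b\<bar>"] by (simp add: abs_mult)
  then have "\<bar>a * b\<bar> \<le> a\<^sup>2 + b\<^sup>2" for a b :: real
    by (smt (verit) abs_ge_zero)
  then show "AE \<omega> in M. norm (f \<omega> * h \<omega>) \<le> norm ((f \<omega>)\<^sup>2 + (h \<omega>)\<^sup>2)"
    by (intro AE_I2) (simp add: abs_of_nonneg)
qed measurable

lemma integral_uniform_measure:
  fixes f :: "'a \<Rightarrow> real"
  assumes [measurable]: "f \<in> borel_measurable M" "B \<in> sets M"
    and "emeasure M B \<noteq> \<infinity>" "measure M B > 0"
  shows "(\<integral>\<omega>. f \<omega> \<partial>uniform_measure M B) = (\<integral>\<omega>. indicator B \<omega> * f \<omega> \<partial>M) / measure M B"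
proof -
  have "uniform_measure M B = density M (\<lambda>\<omega>. ennreal (indicator B \<omega> / measure M B))"
    unfolding uniform_measure_def
    using assms(3,4) by (intro arg_cong[where f = "density M"] ext)
      (auto simp: emeasure_eq_ennreal_measure divide_ennreal[symmetric] split: split_indicator
        simp flip: ennreal_1)
  then have "(\<integral>\<omega>. f \<omega> \<partial>uniform_measure M B) = (\<integral>\<omega>. (indicator B \<omega> / measure M B) *\<^sub>R f \<omega> \<partial>M)"
    using assms(4) by (simp only:) (rule integral_density; simp)
  then show ?thesis by simp
qed

section \<open>Recursion for the conditional second moments\<close>

context prob_space begin

lemma indep_var_of_indep_algebras:
  fixes X Y :: "'a \<Rightarrow> real"
  assumes indep: "indep_set (sets F1) (sets F2)"
    and "space F1 = space M" "space F2 = space M"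
    and X: "X \<in> borel_measurable F1" and Y: "Y \<in> borel_measurable F2"
  shows "indep_var borel X borel Y"
proof -
  have ev: "sets F1 \<subseteq> events" "sets F2 \<subseteq> events"
    using indep by (auto simp: indep_sets2_eq)
  have sub: "sigma_sets (space M) {X -` A \<inter> space M |A. A \<in> sets borel} \<subseteq> sets F1"
    unfolding assms(2)[symmetric]
    by (rule sets.sigma_sets_subset) (use X in \<open>auto dest: measurable_sets\<close>)
  have sub': "sigma_sets (space M) {Y -` A \<inter> space M |A. A \<in> sets borel} \<subseteq> sets F2"
    unfolding assms(3)[symmetric]
    by (rule sets.sigma_sets_subset) (use Y in \<open>auto dest: measurable_sets\<close>)
  have "X \<in> borel_measurable M"
    using measurable_sets[OF X] ev(1) assms(2) by (intro measurableI) auto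
  moreover have "Y \<in> borel_measurable M"
    using measurable_sets[OF Y] ev(2) assms(3) by (intro measurableI) auto
  ultimately show ?thesis
    using indep sub sub' ev unfolding indep_var_eq indep_sets2_eq by blast
qed

text \<open>On the atom where A has the given value A0, the second moments satisfy C_(n+1) =
  \<sigma>^2 I + A0 C_n A0. This contracts with factor \<rho>^2 on pairs of nodes, so C_n converges
  and its limit satisfies the stationary equation. No moment of the initial state survives in that
  equation.\<close>

lemma stationary_correlations:
  fixes \<pi> :: "graph \<Rightarrow> rmatrix" and A :: "'a \<Rightarrow> rmatrix"
  assumes iid: "iid_inputs M N x" and ind: "inputs_indep M N G (y 0) x"
    and dyn: "diffusion_dynamics M N \<sigma> A x y" and A_fun: "\<And>\<omega>. A \<omega> = \<pi> (G \<omega>)"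
    and pos: "0 < prob {\<omega>'\<in>space M. \<forall>i\<in>{1..N}. \<forall>j\<in>{1..N}. A \<omega>' i j = A \<omega> i j}"
    and sym: "\<And>i j. i \<in> {1..N} \<Longrightarrow> j \<in> {1..N} \<Longrightarrow> A \<omega> j i = A \<omega> i j"
    and row: "\<And>i. i \<in> {1..N} \<Longrightarrow> (\<Sum>l\<in>{1..N}. \<bar>A \<omega> i l\<bar>) \<le> \<rho>" and "\<rho> < 1"
    and i: "i \<in> {1..N}" and j: "j \<in> {1..N}"
  shows "corr0 M N A y \<omega> i j = \<sigma>\<^sup>2 * of_bool (i = j)
      + mat_mult_on {1..N} (A \<omega>) (mat_mult_on {1..N} (corr0 M N A y \<omega>) (A \<omega>)) i j" (is ?stat)
    and "corr0 M N A y \<omega> j i = corr0 M N A y \<omega> i j" (is ?symm)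
    and "corr1 M N A y \<omega> i j = mat_mult_on {1..N} (A \<omega>) (corr0 M N A y \<omega>) i j" (is ?lag)
proof -
  define V where "V = {1..N}"
  have "finite V" by (simp add: V_def)
  define A0 where "A0 = A \<omega>"
  define B where "B = {\<omega>'\<in>space M. \<forall>i\<in>V. \<forall>j\<in>V. A \<omega>' i j = A0 i j}"
  define F1 where "F1 = vimage_algebra (space M) (\<lambda>\<omega>. (G \<omega>, \<lambda>i\<in>V. y 0 \<omega> i))
          (count_space UNIV \<Otimes>\<^sub>M Pi\<^sub>M V (\<lambda>_. borel))"
  define F2 where "F2 = vimage_algebra (space M) (\<lambda>\<omega>. \<lambda>k\<in>V \<times> {1..}. x (fst k) (snd k) \<omega>)
          (Pi\<^sub>M (V \<times> {1..}) (\<lambda>_. borel))"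
  have F: "indep_set (sets F1) (sets F2)"
    using ind by (simp add: inputs_indep_def F1_def F2_def V_def)
  have sp: "space F1 = space M" "space F2 = space M" by (simp_all add: F1_def F2_def)
  have "(\<lambda>\<omega>. (G \<omega>, \<lambda>i\<in>V. y 0 \<omega> i)) \<in> measurable F1 (count_space UNIV \<Otimes>\<^sub>M Pi\<^sub>M V (\<lambda>_. borel))"
    unfolding F1_def by (rule measurable_vimage_algebra1) (auto simp: space_pair_measure space_PiM)
  note m1 = measurable_compose[OF this]
  have G_meas: "(\<lambda>\<omega>. h (G \<omega>)) \<in> borel_measurable F1" for h :: "graph \<Rightarrow> real"
    using m1[of "\<lambda>u. h (fst u)" borel] by (simp add: measurable_compose[OF measurable_fst])
  have y0_meas: "(\<lambda>\<omega>. y 0 \<omega> i) \<in> borel_measurable F1" if "i \<in> V" for i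
    using m1[OF measurable_compose[OF measurable_snd measurable_component_singleton[OF that]]] that by simp
  have "(\<lambda>\<omega>. \<lambda>k\<in>V \<times> {1..}. x (fst k) (snd k) \<omega>) \<in> measurable F2 (Pi\<^sub>M (V \<times> {1..}) (\<lambda>_. borel))"
    unfolding F2_def by (rule measurable_vimage_algebra1) (auto simp: space_PiM)
  note m2 = measurable_compose[OF this]
  have x_meas: "x i n \<in> borel_measurable F2" if "i \<in> V" "1 \<le> n" for i n
    using m2[OF measurable_component_singleton, of "(i, n)"] that by simp
  have to_M1: "X \<in> borel_measurable M" if "X \<in> borel_measurable F1" for X :: "'a \<Rightarrow> real"
    using F that sp unfolding indep_sets2_eq measurable_def by auto
  have to_M2: "X \<in> borel_measurable M" if "X \<in> borel_measurable F2" for X :: "'a \<Rightarrow> real"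
    using F that sp unfolding indep_sets2_eq measurable_def by auto
  define b :: "'a \<Rightarrow> real" where "b = (\<lambda>\<omega>'. of_bool (\<forall>i\<in>V. \<forall>j\<in>V. A \<omega>' i j = A0 i j))"
  have b_F1: "b \<in> borel_measurable F1"
    using G_meas[of "\<lambda>g. of_bool (\<forall>i\<in>V. \<forall>j\<in>V. \<pi> g i j = A0 i j)"] by (simp add: b_def A_fun)
  note b_M[measurable] = to_M1[OF b_F1]
  have B_eq: "B = b -` {1} \<inter> space M" by (auto simp: B_def b_def)
  have B_ev[measurable]: "B \<in> events"
    unfolding B_eq by (rule measurable_sets[OF b_M]) simp
  have ind_b: "indicator B \<omega>' = b \<omega>'" if "\<omega>' \<in> space M" for \<omega>'
    using that by (auto simp: B_def b_def)
  have "0 < prob B" using pos by (simp add: B_def V_def A0_def)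
  define EB where "EB f = expectation (\<lambda>\<omega>'. b \<omega>' * f \<omega>')" for f :: "'a \<Rightarrow> real"
  have b_int: "integrable M b"
    by (rule integrable_const_bound[where B = 1]) (use b_M in \<open>auto simp: b_def\<close>)
  have b_exp: "expectation b = prob B"
  proof -
    have "expectation b = expectation (indicator B)"
      by (rule Bochner_Integration.integral_cong) (auto simp: ind_b)
    then show ?thesis by simp
  qed
  have b_mult_int: "integrable M (\<lambda>\<omega>'. b \<omega>' * f \<omega>')" if "integrable M f" for f
    by (rule Bochner_Integration.integrable_bound[OF that])
      (use that b_M in \<open>auto simp: b_def intro!: AE_I2 borel_measurable_times\<close>)
  define L2 where "L2 f \<longleftrightarrow> f \<in> borel_measurable M \<and> integrable M (\<lambda>\<omega>'. (f \<omega>')\<^sup>2)" for f :: "'a \<Rightarrow> real"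
  have L2_mult: "integrable M (\<lambda>\<omega>'. f \<omega>' * h \<omega>')" if "L2 f" "L2 h" for f h
    using that unfolding L2_def by (intro integrable_mult_square_integrable) auto
  have L2_add: "L2 (\<lambda>\<omega>'. f \<omega>' + h \<omega>')" if "L2 f" "L2 h" for f h
  proof -
    have "(\<lambda>\<omega>'. (f \<omega>' + h \<omega>')\<^sup>2) = (\<lambda>\<omega>'. (f \<omega>')\<^sup>2 + 2 * (f \<omega>' * h \<omega>') + (h \<omega>')\<^sup>2)"
      by (simp add: power2_sum algebra_simps)
    then show ?thesis
      using that L2_mult[OF that] by (auto simp: L2_def intro!: borel_measurable_add)
  qed
  have L2_scale: "L2 (\<lambda>\<omega>'. c * f \<omega>')" if "L2 f" for f c
    using that by (auto simp: L2_def power_mult_distrib intro!: borel_measurable_times)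
  have L2_sum: "L2 (\<lambda>\<omega>'. \<Sum>l\<in>T. f l \<omega>')" if "finite T" "\<And>l. l \<in> T \<Longrightarrow> L2 (f l)" for f and T :: "nat set"
    using that by (induction T rule: finite_induct) (auto simp: L2_add, auto simp: L2_def)
  have x_L2: "L2 (x i n)" if "i \<in> V" "1 \<le> n" for i n
    using iid that to_M2[OF x_meas[OF that]] by (auto simp: L2_def iid_inputs_def V_def)
  \<comment> \<open>On \<open>B\<close> the state \<open>y\<close> agrees with \<open>z\<close>, which is linear in \<open>y 0\<close> and the inputs with constant
    coefficients. Hence only second moments of these, restricted to \<open>B\<close>, enter.\<close>
  define z where "z = rec_nat (\<lambda>i \<omega>'. y 0 \<omega>' i)
    (\<lambda>n zn i \<omega>'. (\<Sum>l\<in>V. A0 i l * zn l \<omega>') + \<sigma> * x i (Suc n) \<omega>')"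
  have z_0: "z 0 i = (\<lambda>\<omega>'. y 0 \<omega>' i)" for i by (simp add: z_def)
  have z_Suc: "z (Suc n) i = (\<lambda>\<omega>'. (\<Sum>l\<in>V. A0 i l * z n l \<omega>') + \<sigma> * x i (Suc n) \<omega>')" for n i
    by (simp add: z_def)
  have z_L2: "L2 (z n i)" if "i \<in> V" for n i
    using that
  proof (induction n arbitrary: i)
    case 0
    then show ?case
      using dyn to_M1[OF y0_meas[OF 0]] by (simp add: z_0 L2_def diffusion_dynamics_def V_def)
  next
    case (Suc n)
    then show ?case
      unfolding z_Suc by (intro L2_add L2_sum L2_scale x_L2 \<open>finite V\<close>) auto
  qed
  have y_Suc: "y (Suc n) \<omega>' i = (\<Sum>l\<in>V. A \<omega>' i l * y n \<omega>' l) + \<sigma> * x i (Suc n) \<omega>'"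
    if "\<omega>' \<in> space M" "i \<in> V" for n \<omega>' i
    using dyn that by (simp add: diffusion_dynamics_def V_def)
  have y_meas: "(\<lambda>\<omega>'. y n \<omega>' i) \<in> borel_measurable M" if "i \<in> V" for n i
    using that
  proof (induction n arbitrary: i)
    case 0
    then show ?case using to_M1[OF y0_meas] by simp
  next
    case (Suc n)
    have "(\<lambda>\<omega>'. A \<omega>' i l) \<in> borel_measurable M" for l
      using to_M1[OF G_meas[of "\<lambda>g. \<pi> g i l"]] by (simp add: A_fun)
    moreover have "x i (Suc n) \<in> borel_measurable M"
      using to_M2[OF x_meas] Suc.prems by simp
    ultimately have "(\<lambda>\<omega>'. (\<Sum>l\<in>V. A \<omega>' i l * y n \<omega>' l) + \<sigma> * x i (Suc n) \<omega>') \<in> borel_measurable M"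
      using Suc.IH by (intro borel_measurable_add borel_measurable_sum borel_measurable_times) auto
    then show ?case
      using y_Suc Suc.prems by (simp cong: measurable_cong)
  qed
  have y_z: "y n \<omega>' i = z n i \<omega>'" if "\<omega>' \<in> B" "i \<in> V" for n \<omega>' i
    using that(2)
  proof (induction n arbitrary: i)
    case (Suc n)
    have "\<omega>' \<in> space M" and "A \<omega>' i l = A0 i l" if "l \<in> V" for l
      using \<open>\<omega>' \<in> B\<close> that Suc.prems by (auto simp: B_def)
    then show ?case
      using Suc by (simp add: y_Suc z_Suc B_def[symmetric])
  qed (simp add: z_0)
  have cond: "(\<integral>\<omega>'. y n \<omega>' i * y m \<omega>' j \<partial>law_given M N A \<omega>) = EB (\<lambda>\<omega>'. z n i \<omega>' * z m j \<omega>') / prob B"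
    if "i \<in> V" "j \<in> V" for n m i j
  proof -
    have "(\<integral>\<omega>'. y n \<omega>' i * y m \<omega>' j \<partial>law_given M N A \<omega>)
        = (\<integral>\<omega>'. indicator B \<omega>' * (y n \<omega>' i * y m \<omega>' j) \<partial>M) / prob B"
      unfolding law_given_def B_def[unfolded V_def A0_def, symmetric]
      using y_meas that \<open>0 < prob B\<close>
      by (intro integral_uniform_measure) (auto simp: emeasure_eq_measure)
    also have "(\<integral>\<omega>'. indicator B \<omega>' * (y n \<omega>' i * y m \<omega>' j) \<partial>M) = EB (\<lambda>\<omega>'. z n i \<omega>' * z m j \<omega>')"
      unfolding EB_def using that
      by (intro Bochner_Integration.integral_cong)
        (auto simp: ind_b[symmetric] y_z split: split_indicator)
    finally show ?thesis .
  qed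
  have x_exp: "expectation (x i n) = 0" and x_int: "integrable M (x i n)" if "i \<in> V" "1 \<le> n" for i n
    using iid that by (auto simp: iid_inputs_def V_def)
  \<comment> \<open>The indicator b is a function of the graph, hence independent of the inputs:
    restricting to the atom merely multiplies their moments by \<open>prob B\<close>.\<close>
  have EB_xx: "EB (\<lambda>\<omega>'. x i n \<omega>' * x j m \<omega>') = prob B * of_bool (i = j \<and> n = m)"
    if "i \<in> V" "j \<in> V" "1 \<le> n" "1 \<le> m" for i j n m
  proof -
    have "indep_var borel b borel (\<lambda>\<omega>'. x i n \<omega>' * x j m \<omega>')"
      by (rule indep_var_of_indep_algebras[OF F sp b_F1]) (use x_meas that in simp)
    then have "EB (\<lambda>\<omega>'. x i n \<omega>' * x j m \<omega>') = prob B * expectation (\<lambda>\<omega>'. x i n \<omega>' * x j m \<omega>')"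
      unfolding EB_def b_exp[symmetric] by (rule indep_var_lebesgue_integral)
        (use b_int L2_mult x_L2 that in auto)
    also have "expectation (\<lambda>\<omega>'. x i n \<omega>' * x j m \<omega>') = of_bool (i = j \<and> n = m)"
    proof (cases "i = j \<and> n = m")
      case True
      have "variance (x i n) = 1"
        using iid that unfolding iid_inputs_def V_def by blast
      then show ?thesis
        using True x_exp[OF that(1,3)] by (simp add: power2_eq_square)
    next
      case False
      have "indep_vars (\<lambda>_. borel) (\<lambda>k. x (fst k) (snd k)) ({1..N} \<times> {1..})"
        using iid by (simp add: iid_inputs_def case_prod_beta')
      then have iv: "indep_vars (\<lambda>_. borel) (\<lambda>k. x (fst k) (snd k)) {(i, n), (j, m)}"
        by (rule indep_vars_subset) (use that in \<open>auto simp: V_def\<close>)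
      have "expectation (\<lambda>\<omega>'. \<Prod>k\<in>{(i, n), (j, m)}. x (fst k) (snd k) \<omega>')
          = (\<Prod>k\<in>{(i, n), (j, m)}. expectation (x (fst k) (snd k)))"
        by (rule indep_vars_lebesgue_integral[OF _ iv]) (use x_int that in auto)
      then show ?thesis
        using False x_exp that by auto
    qed
    finally show ?thesis .
  qed
  have EB_lin: "EB (\<lambda>\<omega>'. ((\<Sum>l\<in>V. a l * U l \<omega>') + c * X \<omega>') * W \<omega>')
      = (\<Sum>l\<in>V. a l * EB (\<lambda>\<omega>'. U l \<omega>' * W \<omega>')) + c * EB (\<lambda>\<omega>'. X \<omega>' * W \<omega>')"
    if "\<And>l. l \<in> V \<Longrightarrow> L2 (U l)" "L2 X" "L2 W" for a c U X W
  proof -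
    have "(\<lambda>\<omega>'. b \<omega>' * (((\<Sum>l\<in>V. a l * U l \<omega>') + c * X \<omega>') * W \<omega>'))
        = (\<lambda>\<omega>'. (\<Sum>l\<in>V. a l * (b \<omega>' * (U l \<omega>' * W \<omega>'))) + c * (b \<omega>' * (X \<omega>' * W \<omega>')))"
      by (simp add: distrib_left distrib_right sum_distrib_left sum_distrib_right mult_ac)
    then show ?thesis
      unfolding EB_def using b_mult_int[OF L2_mult[OF _ that(3)]] that
      by (simp add: Bochner_Integration.integral_add Bochner_Integration.integral_sum)
  qed
  \<comment> \<open>Future inputs are orthogonal to the present state on the atom. The base case
    uses independence of the inputs from the graph and the initial state jointly, as b times
    \<open>y 0\<close> involves both.\<close>
  have EB_zx: "EB (\<lambda>\<omega>'. z n i \<omega>' * x j m \<omega>') = 0" if "i \<in> V" "j \<in> V" "n < m" for n m i j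
    using that
  proof (induction n arbitrary: i)
    case 0
    have 1: "indep_var borel (\<lambda>\<omega>'. b \<omega>' * y 0 \<omega>' i) borel (x j m)"
      by (rule indep_var_of_indep_algebras[OF F sp]) (use b_F1 y0_meas x_meas 0 in auto)
    have "L2 (\<lambda>_. 1)" by (simp add: L2_def)
    then have "integrable M (\<lambda>\<omega>'. y 0 \<omega>' i)"
      using L2_mult[OF z_L2[OF \<open>i \<in> V\<close>, of 0], of "\<lambda>_. 1"] by (simp add: z_0)
    then have "expectation (\<lambda>\<omega>'. (b \<omega>' * y 0 \<omega>' i) * x j m \<omega>')
        = expectation (\<lambda>\<omega>'. b \<omega>' * y 0 \<omega>' i) * expectation (x j m)"
      using b_mult_int x_int 0 by (intro indep_var_lebesgue_integral[OF 1]) auto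
    then show ?case
      using x_exp 0 by (simp add: EB_def z_0 mult.assoc)
  next
    case (Suc n)
    have "EB (\<lambda>\<omega>'. z (Suc n) i \<omega>' * x j m \<omega>')
        = (\<Sum>l\<in>V. A0 i l * EB (\<lambda>\<omega>'. z n l \<omega>' * x j m \<omega>')) + \<sigma> * EB (\<lambda>\<omega>'. x i (Suc n) \<omega>' * x j m \<omega>')"
      unfolding z_Suc using Suc.prems by (intro EB_lin z_L2 x_L2) auto
    then show ?case
      using Suc by (simp add: EB_xx)
  qed
  define C where "C n u = EB (\<lambda>\<omega>'. z n (fst u) \<omega>' * z n (snd u) \<omega>') / prob B" for n and u :: "nat \<times> nat"
  have C_sym: "C n (j, i) = C n (i, j)" for n i j
    by (simp add: C_def mult.commute)
  have EB_comm: "EB (\<lambda>\<omega>'. f \<omega>' * h \<omega>') = EB (\<lambda>\<omega>'. h \<omega>' * f \<omega>')" for f h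
    by (simp add: mult.commute)
  have lag: "EB (\<lambda>\<omega>'. z (Suc n) i \<omega>' * z n j \<omega>') / prob B = (\<Sum>l\<in>V. A0 i l * C n (l, j))"
    if "i \<in> V" "j \<in> V" for n i j
  proof -
    have "EB (\<lambda>\<omega>'. z (Suc n) i \<omega>' * z n j \<omega>')
        = (\<Sum>l\<in>V. A0 i l * EB (\<lambda>\<omega>'. z n l \<omega>' * z n j \<omega>')) + \<sigma> * EB (\<lambda>\<omega>'. x i (Suc n) \<omega>' * z n j \<omega>')"
      unfolding z_Suc using that by (intro EB_lin z_L2 x_L2) auto
    also have "EB (\<lambda>\<omega>'. x i (Suc n) \<omega>' * z n j \<omega>') = 0"
      by (subst EB_comm) (use EB_zx that in simp)
    finally show ?thesis by (simp add: C_def sum_divide_distrib)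
  qed
  have C_Suc: "C (Suc n) u = \<sigma>\<^sup>2 * of_bool (fst u = snd u) + (\<Sum>v\<in>V \<times> V. (A0 (fst u) (fst v) * A0 (snd u) (snd v)) * C n v)"
    if "u \<in> V \<times> V" for n u
  proof -
    obtain i j where u: "u = (i, j)" "i \<in> V" "j \<in> V" using \<open>u \<in> V \<times> V\<close> by (cases u) auto
    have "EB (\<lambda>\<omega>'. z (Suc n) i \<omega>' * z (Suc n) j \<omega>')
        = (\<Sum>l\<in>V. A0 i l * EB (\<lambda>\<omega>'. z n l \<omega>' * z (Suc n) j \<omega>')) + \<sigma> * EB (\<lambda>\<omega>'. x i (Suc n) \<omega>' * z (Suc n) j \<omega>')"
      unfolding z_Suc[of n i] using u by (intro EB_lin z_L2 x_L2) auto
    also have "EB (\<lambda>\<omega>'. x i (Suc n) \<omega>' * z (Suc n) j \<omega>')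
        = (\<Sum>l\<in>V. A0 j l * EB (\<lambda>\<omega>'. z n l \<omega>' * x i (Suc n) \<omega>')) + \<sigma> * EB (\<lambda>\<omega>'. x j (Suc n) \<omega>' * x i (Suc n) \<omega>')"
      unfolding z_Suc[of n j] using u by (subst EB_comm, intro EB_lin z_L2 x_L2) auto
    also have "\<dots> = \<sigma> * (prob B * of_bool (i = j))"
      using u EB_zx EB_xx by (auto simp: of_bool_def)
    finally have "C (Suc n) u = (\<Sum>l\<in>V. A0 i l * (EB (\<lambda>\<omega>'. z n l \<omega>' * z (Suc n) j \<omega>') / prob B)) + \<sigma>\<^sup>2 * of_bool (i = j)"
      using \<open>0 < prob B\<close> by (simp add: C_def u add_divide_distrib sum_divide_distrib power2_eq_square)
    also have "(\<Sum>l\<in>V. A0 i l * (EB (\<lambda>\<omega>'. z n l \<omega>' * z (Suc n) j \<omega>') / prob B))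
        = (\<Sum>l\<in>V. A0 i l * (\<Sum>m\<in>V. A0 j m * C n (l, m)))"
      using lag u by (intro sum.cong refl, subst EB_comm) (simp add: C_sym)
    finally show ?thesis
      by (simp add: u sum_distrib_left sum.cartesian_product mult.assoc case_prod_beta)
  qed
  have row2: "(\<Sum>v\<in>V \<times> V. \<bar>A0 (fst u) (fst v) * A0 (snd u) (snd v)\<bar>) \<le> \<rho> * \<rho>" if "u \<in> V \<times> V" for u
  proof -
    obtain i j where u: "u = (i, j)" "i \<in> V" "j \<in> V" using \<open>u \<in> V \<times> V\<close> by (cases u) auto
    have "(\<Sum>v\<in>V \<times> V. \<bar>A0 (fst u) (fst v) * A0 (snd u) (snd v)\<bar>) = (\<Sum>l\<in>V. \<bar>A0 i l\<bar>) * (\<Sum>m\<in>V. \<bar>A0 j m\<bar>)"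
      by (simp add: u sum_product sum.cartesian_product abs_mult case_prod_beta)
    also have "\<dots> \<le> \<rho> * \<rho>"
      using row u order_trans[OF sum_nonneg row]
      by (intro mult_mono) (auto intro: sum_nonneg simp: V_def A0_def)
    finally show ?thesis .
  qed
  have "0 \<le> \<rho>" using order_trans[OF sum_nonneg row[OF i]] by simp
  then have contr: "\<rho> * \<rho> < 1" using \<open>\<rho> < 1\<close> by (smt (verit, best) mult_left_le)
  obtain L where L: "\<And>u. u \<in> V \<times> V \<Longrightarrow> (\<lambda>n. C n u) \<longlonglongrightarrow> L u"
      "\<And>u. u \<in> V \<times> V \<Longrightarrow> L u = \<sigma>\<^sup>2 * of_bool (fst u = snd u)
        + (\<Sum>v\<in>V \<times> V. (A0 (fst u) (fst v) * A0 (snd u) (snd v)) * L v)"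
    by (rule affine_iteration_converges[of "V \<times> V" "\<lambda>u v. A0 (fst u) (fst v) * A0 (snd u) (snd v)" "\<rho> * \<rho>" C
        "\<lambda>u. \<sigma>\<^sup>2 * of_bool (fst u = snd u)", OF _ row2 contr C_Suc]) (use \<open>finite V\<close> in auto)
  have c0: "corr0 M N A y \<omega> i j = L (i, j)" if "i \<in> V" "j \<in> V" for i j
    unfolding corr0_def cond[OF that] using L(1)[of "(i, j)"] that by (auto simp: C_def intro: limI)
  have c1: "corr1 M N A y \<omega> i j = (\<Sum>l\<in>V. A0 i l * L (l, j))" if "i \<in> V" "j \<in> V" for i j
    unfolding corr1_def cond[OF that]
  \<comment> \<open>Shifting the index avoids n = 0, where the truncated n - 1 would pair
    \<open>y 0\<close> with itself.\<close>
  proof (rule limI, rule LIMSEQ_imp_Suc)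
    show "(\<lambda>n. EB (\<lambda>\<omega>'. z (Suc n) i \<omega>' * z (Suc n - 1) j \<omega>') / prob B) \<longlonglongrightarrow> (\<Sum>l\<in>V. A0 i l * L (l, j))"
      using that by (simp add: lag) (intro tendsto_intros L(1), simp)
  qed
  have ij: "i \<in> V" "j \<in> V" using i j by (auto simp: V_def)
  show ?symm
    using LIMSEQ_unique[OF L(1)[of "(i, j)"], of "L (j, i)"] L(1)[of "(j, i)"] ij
    by (simp add: c0 C_sym)
  show ?lag
    using ij unfolding V_def[symmetric] A0_def[symmetric] by (simp add: mat_mult_on_def c0 c1)
  \<comment> \<open>The recursion produces the transpose of A0 on the right; symmetry turns it into
    A0.\<close>
  have "L (i, j) = \<sigma>\<^sup>2 * of_bool (i = j) + (\<Sum>l\<in>V. A0 i l * (\<Sum>m\<in>V. L (l, m) * A0 m j))"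
    using L(2)[of "(i, j)"] ij sym
    by (auto simp: sum_distrib_left sum.cartesian_product case_prod_beta V_def A0_def mult_ac intro!: sum.cong)
  then show ?stat
    using ij unfolding V_def[symmetric] A0_def[symmetric] by (simp add: mat_mult_on_def c0)
qed

end

section \<open>Concentrated graphs have concentrated diffusion matrices\<close>

lemma max_degree_pos:
  assumes "1 \<le> N"
  shows "0 < max_degree N g"
proof -
  have "0 < degree N g 1" by (simp add: degree_def add_pos_nonneg sum_nonneg)
  also have "\<dots> \<le> max_degree N g"
    unfolding max_degree_def using assms by (intro Max_ge) auto
  finally show ?thesis .
qed

text \<open>The margins are defined through the support of A, the entry bounds through the edges of
  the graph; positivity of \<kappa> / d_max makes the two coincide off the diagonal.\<close>

lemma regular_diffusion_pos_iff:
  assumes reg: "regular_diffusion N \<rho> \<kappa> g a" and "0 < \<kappa>" "i \<in> {1..N}" "j \<in> {1..N}" "i \<noteq> j"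
  shows "0 < a i j \<longleftrightarrow> g i j" and "a i j = 0 \<longleftrightarrow> \<not> g i j"
proof -
  have b: "\<kappa> / max_degree N g * of_bool (g i j) \<le> a i j"
    "a i j \<le> \<kappa> / min_degree N g * of_bool (g i j)" "0 \<le> a i j"
    using assms unfolding regular_diffusion_def by blast+
  moreover have "0 < \<kappa> / max_degree N g"
    using max_degree_pos[of N g] assms by simp
  ultimately show "0 < a i j \<longleftrightarrow> g i j" and "a i j = 0 \<longleftrightarrow> \<not> g i j"
    by (cases "g i j"; simp)+
qed

text \<open>\<open>conc\<close> with i = j controls the number of neighbours inside and outside S,
  hence the degrees and the entries of A; with i \<noteq> j it controls the common neighbours, hence
  the path sums. The condition 1 \<le> e * q absorbs the effect of removing i and j from a set. The
  factor 50 is chosen to cover the largest accumulated error, 46 * e on the diagonal.\<close>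

lemma concentrated_diffusionI:
  fixes P p q e \<xi> \<rho> \<kappa> :: real and g :: graph and a :: rmatrix
  assumes "1 \<le> N" and S: "S \<subseteq> {1..N}" and g_sym: "\<And>i j. g j i = g i j"
    and reg: "regular_diffusion N \<rho> \<kappa> g a" and \<kappa>: "0 < \<kappa>" "\<kappa> \<le> \<rho>" and "\<rho> < 1"
    and P: "0 \<le> P" "P \<le> 1" and q: "q = real N * P" and e: "0 < e" "e \<le> 1 / 50" "1 \<le> e * q"
    and p: "\<bar>P - p\<bar> \<le> e" "0 \<le> p" "p \<le> 1"
    and \<xi>: "\<bar>real (card S) / real N - \<xi>\<bar> \<le> e" "0 \<le> \<xi>" "\<xi> \<le> 1"
    and conc: "\<And>i j T. i \<in> {1..N} \<Longrightarrow> j \<in> {1..N} \<Longrightarrow> T \<in> {S, {1..N} - S} \<Longrightarrow>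
      \<bar>(\<Sum>l\<in>T - {i, j}. of_bool (g i l \<and> g l j)) - real (card (T - {i, j})) * (if i = j then P else P\<^sup>2)\<bar> < e * q"
  shows "concentrated_diffusion {1..N} S a g q \<kappa> \<rho> p \<xi> (50 * e)"
proof -
  define V where "V = {1..N}"
  have fin: "finite V" "S \<subseteq> V" using S by (auto simp: V_def)
  have "0 < q" using e by (smt (verit) mult_nonneg_nonpos)
  have "0 < P" using \<open>0 < q\<close> P q by (auto simp: zero_less_mult_iff)
  have "e * q \<le> 1 * q" using e \<open>0 < q\<close> by (intro mult_right_mono) auto
  then have "1 \<le> q" using e(3) by simp
  have \<kappa>1: "\<kappa> \<le> 1" using \<kappa> \<open>\<rho> < 1\<close> by simp
  define n where "n T i = (\<Sum>l\<in>T - {i}. of_bool (g i l) :: real)" for T i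
  have card_diff: "\<bar>real (card (T - F)) - real (card T)\<bar> \<le> 2" if "T \<subseteq> V" "finite F" "card F \<le> 2" for T F
  proof -
    have "finite T" using that fin finite_subset by auto
    then have "card (T - F) \<le> card T" "card T - card F \<le> card (T - F)"
      using that by (auto intro: card_mono diff_card_le_card_Diff)
    then show ?thesis using that by linarith
  qed
  have card_diff1: "\<bar>real (card (T - {i})) - real (card T)\<bar> \<le> 1" if "T \<subseteq> V" for T i
  proof -
    have "finite T" using that fin finite_subset by auto
    then show ?thesis by (cases "i \<in> T") (auto simp: card_Diff_singleton of_nat_diff card_gt_0_iff Suc_le_eq)
  qed
  have n_near: "\<bar>n T i - real (card T) * P\<bar> \<le> 2 * (e * q)" if "i \<in> V" "T \<in> {S, V - S}" for T i
  proof -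
    have "\<bar>n T i - real (card (T - {i})) * P\<bar> < e * q"
      using conc[of i i T] that g_sym[of _ i] by (simp add: n_def V_def)
    moreover have "\<bar>(real (card (T - {i})) - real (card T)) * P\<bar> \<le> 1 * 1"
      unfolding abs_mult using card_diff1[of T i] that P fin by (intro mult_mono) auto
    ultimately show ?thesis using e(3) unfolding left_diff_distrib by linarith
  qed
  have card_V: "real (card S) + real (card (V - S)) = real N"
    using card_Diff_subset[OF finite_subset[OF fin(2,1)] fin(2)] card_mono[OF fin]
    by (simp add: V_def of_nat_diff)
  have split_sum: "(\<Sum>l\<in>V - {i}. f l) = (\<Sum>l\<in>S - {i}. f l) + (\<Sum>l\<in>V - S - {i}. f l)"
    for i and f :: "nat \<Rightarrow> real"
  proof -
    have "(\<Sum>l\<in>(S - {i}) \<union> (V - S - {i}). f l) = (\<Sum>l\<in>S - {i}. f l) + (\<Sum>l\<in>V - S - {i}. f l)"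
      using fin finite_subset[OF fin(2,1)] by (intro sum.union_disjoint) auto
    moreover have "(S - {i}) \<union> (V - S - {i}) = V - {i}" using fin by auto
    ultimately show ?thesis by (simp only:)
  qed
  have deg: "degree N g i = 1 + (n S i + n (V - S) i)" for i
    unfolding degree_def n_def V_def[symmetric] split_sum ..
  \<comment> \<open>Twice 2 * (e * q) for the two parts of the neighbourhood, and e * q for the
    summand 1 in the degree.\<close>
  have deg_near: "\<bar>degree N g i - q\<bar> \<le> 5 * (e * q)" if "i \<in> V" for i
  proof -
    have "real (card S) * P + real (card (V - S)) * P = q"
      by (simp add: q card_V flip: distrib_right)
    then show ?thesis
      using n_near[OF that, of S] n_near[OF that, of "V - S"] e(3) deg[of i] by simp
  qed
  have n_le: "n T i \<le> 2 * q" if "i \<in> V" "T \<in> {S, V - S}" for i T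
  proof -
    have "0 \<le> n T i" for T by (simp add: n_def sum_nonneg)
    then have "n T i \<le> degree N g i" using that deg[of i] by auto
    also have "\<dots> \<le> q + 5 * (e * q)" using deg_near[OF that(1)] by simp
    also have "5 * (e * q) \<le> q" using e \<open>0 < q\<close> by simp
    finally show ?thesis by simp
  qed
  have "V \<noteq> {}" using \<open>1 \<le> N\<close> by (simp add: V_def)
  have dmin: "(1 - 5 * e) * q \<le> min_degree N g"
    unfolding min_degree_def V_def[symmetric] using fin \<open>V \<noteq> {}\<close> deg_near
    by (subst Min_ge_iff) (auto simp: abs_le_iff algebra_simps)
  have dmax: "max_degree N g \<le> (1 + 5 * e) * q"
    unfolding max_degree_def V_def[symmetric] using fin \<open>V \<noteq> {}\<close> deg_near
    by (subst Max_le_iff) (auto simp: abs_le_iff algebra_simps)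
  note dmax_pos = max_degree_pos[OF \<open>1 \<le> N\<close>, of g]
  have up: "\<kappa> / min_degree N g \<le> (\<kappa> + 10 * e) / q"
  proof -
    have "0 < (1 - 5 * e) * q" using e \<open>0 < q\<close> by simp
    then have "\<kappa> / min_degree N g \<le> \<kappa> / ((1 - 5 * e) * q)"
      using dmin \<kappa> by (intro divide_left_mono) auto
    also have "\<kappa> / ((1 - 5 * e) * q) \<le> (\<kappa> + 10 * e) / q"
    proof -
      \<comment> \<open>Expanding (\<kappa> + 10 * e) * (1 - 5 * e) shows that this is exactly what
        makes the product at least \<kappa>.\<close>
      have "e * (50 * e + 5 * \<kappa>) \<le> e * 10" using e \<kappa>1 by (intro mult_left_mono) auto
      then have "\<kappa> \<le> (\<kappa> + 10 * e) * (1 - 5 * e)" by (simp add: algebra_simps)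
      then have "\<kappa> / (1 - 5 * e) \<le> \<kappa> + 10 * e"
        using e by (simp add: pos_divide_le_eq)
      then show ?thesis
        using \<open>0 < q\<close> by (simp add: divide_right_mono flip: divide_divide_eq_left)
    qed
    finally show ?thesis .
  qed
  have low: "(\<kappa> - 10 * e) / q \<le> \<kappa> / max_degree N g"
  proof -
    have "(\<kappa> - 10 * e) * (1 + 5 * e) \<le> \<kappa>"
    proof -
      have "e * (5 * \<kappa>) \<le> e * (10 + 50 * e)" using e \<kappa>1 by (intro mult_left_mono) auto
      then show ?thesis by (simp add: algebra_simps)
    qed
    then have "\<kappa> - 10 * e \<le> \<kappa> / (1 + 5 * e)"
      using e by (simp add: pos_le_divide_eq)
    then have "(\<kappa> - 10 * e) / q \<le> \<kappa> / ((1 + 5 * e) * q)"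
      using \<open>0 < q\<close> by (simp add: divide_right_mono flip: divide_divide_eq_left)
    also have "\<dots> \<le> \<kappa> / max_degree N g"
      using dmax dmax_pos \<kappa> by (intro divide_left_mono) (auto intro!: mult_pos_pos less_le_trans[OF dmax_pos])
    finally show ?thesis .
  qed
  have a_sym: "a j i = a i j" and a_nonneg: "0 \<le> a i j" if "i \<in> V" "j \<in> V" for i j
    using reg that unfolding regular_diffusion_def V_def by blast+
  have a_row: "(\<Sum>l\<in>V. a i l) = \<rho>" if "i \<in> V" for i
    using reg that unfolding regular_diffusion_def V_def by blast
  \<comment> \<open>The factor \<open>of_bool (g i j)\<close> on the right is essential: summed over
    a row the errors count neighbours, at most 2 * q of them, instead of all N nodes.\<close>
  have a_near: "\<bar>q * a i j - \<kappa> * of_bool (g i j)\<bar> \<le> 10 * e * of_bool (g i j)"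
    if "i \<in> V" "j \<in> V" "i \<noteq> j" for i j
  proof -
    have b: "\<kappa> / max_degree N g * of_bool (g i j) \<le> a i j" "a i j \<le> \<kappa> / min_degree N g * of_bool (g i j)"
      using reg that unfolding regular_diffusion_def V_def by blast+
    show ?thesis
    proof (cases "g i j")
      case True
      then have "(\<kappa> - 10 * e) / q \<le> a i j" "a i j \<le> (\<kappa> + 10 * e) / q"
        using b up low by auto
      then show ?thesis
        using True \<open>0 < q\<close> by (simp add: abs_le_iff field_simps)
    next
      case False
      then show ?thesis using b a_nonneg[OF that(1,2)] by simp
    qed
  qed
  have a_small: "a i j \<le> 2 * e" if "i \<in> V" "j \<in> V" "i \<noteq> j" for i j
  proof -
    have "q * a i j \<le> \<kappa> * of_bool (g i j) + 10 * e * of_bool (g i j)"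
      using a_near[OF that] by simp
    also have "\<dots> \<le> 2" using \<kappa>1 e by (cases "g i j") auto
    also have "\<dots> \<le> q * (2 * e)" using e by (simp add: mult.commute)
    finally show ?thesis using \<open>0 < q\<close> by simp
  qed
  \<comment> \<open>Here 20 comes from replacing entries by edges, 2 from the number of neighbours,
    1 from the fraction of nodes in T.\<close>
  have sum1: "\<bar>(\<Sum>l\<in>T - {i}. a i l) - \<kappa> * x\<bar> \<le> 23 * e"
    if "i \<in> V" "T \<in> {S, V - S}" "\<bar>real (card T) / real N - x\<bar> \<le> e" for T i x
  proof -
    have T: "T \<subseteq> V" using that fin by auto
    have "\<bar>q * (\<Sum>l\<in>T - {i}. a i l) - \<kappa> * n T i\<bar> = \<bar>\<Sum>l\<in>T - {i}. q * a i l - \<kappa> * of_bool (g i l)\<bar>"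
      by (simp add: n_def sum_distrib_left sum_subtractf)
    also have "\<dots> \<le> (\<Sum>l\<in>T - {i}. 10 * e * of_bool (g i l))"
    proof (intro order_trans[OF sum_abs] sum_mono)
      fix l assume "l \<in> T - {i}"
      then have "l \<in> V" "i \<noteq> l" using T by auto
      then show "\<bar>q * a i l - \<kappa> * of_bool (g i l)\<bar> \<le> 10 * e * of_bool (g i l)"
        by (rule a_near[OF that(1)])
    qed
    also have "\<dots> = 10 * e * n T i" by (simp add: n_def sum_distrib_left)
    also have "\<dots> \<le> 10 * e * (2 * q)" using n_le[OF that(1,2)] e by (intro mult_left_mono) auto
    finally have 1: "\<bar>q * (\<Sum>l\<in>T - {i}. a i l) - \<kappa> * n T i\<bar> \<le> 20 * (e * q)" by simp
    have 2: "\<bar>\<kappa> * (n T i - real (card T) * P)\<bar> \<le> 1 * (2 * (e * q))"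
      unfolding abs_mult using n_near[OF that(1,2)] \<kappa> \<kappa>1 by (intro mult_mono) auto
    have 3: "\<bar>\<kappa> * (q * (real (card T) / real N - x))\<bar> \<le> 1 * (q * e)"
      unfolding abs_mult using that(3) \<kappa> \<kappa>1 \<open>0 < q\<close> by (intro mult_mono) auto
    have "real (card T) * P = q * (real (card T) / real N)"
      using \<open>1 \<le> N\<close> by (simp add: q)
    then have "q * ((\<Sum>l\<in>T - {i}. a i l) - \<kappa> * x) = (q * (\<Sum>l\<in>T - {i}. a i l) - \<kappa> * n T i)
      + \<kappa> * (n T i - real (card T) * P) + \<kappa> * (q * (real (card T) / real N - x))"
      by (simp add: algebra_simps)
    then have "\<bar>q * ((\<Sum>l\<in>T - {i}. a i l) - \<kappa> * x)\<bar> \<le> 20 * (e * q) + 2 * (e * q) + e * q"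
      using 1 2 3 abs_triangle_ineq by (smt (verit) mult.commute)
    then have "q * \<bar>(\<Sum>l\<in>T - {i}. a i l) - \<kappa> * x\<bar> \<le> q * (23 * e)"
      using \<open>0 < q\<close> by (simp add: abs_mult mult_ac)
    then show ?thesis using \<open>0 < q\<close> by simp
  qed
  have sum2: "\<bar>(\<Sum>l\<in>T - {i, j}. a i l) - \<kappa> * x\<bar> \<le> 50 * e"
    if "i \<in> V" "j \<in> V" "i \<noteq> j" "T \<in> {S, V - S}" "\<bar>real (card T) / real N - x\<bar> \<le> e" for T i j x
  proof -
    have "finite T" using that fin finite_subset[OF fin(2,1)] by auto
    have "T - {i, j} = T - {i} - {j}" by auto
    then have "(\<Sum>l\<in>T - {i, j}. a i l) = (\<Sum>l\<in>T - {i}. a i l) - (if j \<in> T then a i j else 0)"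
      using \<open>finite T\<close> that by (auto simp: sum_diff1)
    then show ?thesis
      using sum1[OF that(1,4,5)] a_small[OF that(1-3)] a_nonneg[OF that(1,2)] e(1) by (simp split: if_splits)
  qed
  \<comment> \<open>The errors add up to 25 * e: 20 for the entries, 3 for the number of common
    neighbours, and 1 each for the convergence of the node fraction and of the edge
    probability.\<close>
  have path: "\<bar>(\<Sum>l\<in>T - {i, j}. a i l * of_bool (g l j)) - \<kappa> * x * p\<bar> \<le> 50 * e"
    if "i \<in> V" "j \<in> V" "i \<noteq> j" "T \<in> {S, V - S}" "\<bar>real (card T) / real N - x\<bar> \<le> e" "0 \<le> x" "x \<le> 1" for T i j x
  proof -
    have T: "T \<subseteq> V" "finite T" using that fin finite_subset[OF fin(2,1)] by auto
    define m where "m = (\<Sum>l\<in>T - {i, j}. of_bool (g i l \<and> g l j) :: real)"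
    define Q where "Q = (\<Sum>l\<in>T - {i, j}. a i l * of_bool (g l j))"
    define r where "r = real (card T) / real N"
    have "m \<le> n T i"
    proof -
      have "m \<le> (\<Sum>l\<in>T - {i, j}. of_bool (g i l))"
        unfolding m_def by (intro sum_mono) auto
      also have "\<dots> \<le> n T i"
        unfolding n_def using T by (intro sum_mono2) auto
      finally show ?thesis .
    qed
    then have "m \<le> 2 * q" using n_le[OF that(1,4)] by simp
    have "\<bar>q * Q - \<kappa> * m\<bar> = \<bar>\<Sum>l\<in>T - {i, j}. (q * a i l - \<kappa> * of_bool (g i l)) * of_bool (g l j)\<bar>"
      by (simp add: m_def Q_def sum_distrib_left sum_subtractf of_bool_conj left_diff_distrib mult.assoc)
    also have "\<dots> \<le> (\<Sum>l\<in>T - {i, j}. 10 * e * of_bool (g i l \<and> g l j))"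
    proof (intro order_trans[OF sum_abs] sum_mono)
      fix l assume "l \<in> T - {i, j}"
      then have "l \<in> V" "i \<noteq> l" using T by auto
      from a_near[OF that(1) this]
      show "\<bar>(q * a i l - \<kappa> * of_bool (g i l)) * of_bool (g l j)\<bar> \<le> 10 * e * of_bool (g i l \<and> g l j)"
        by (cases "g l j") simp_all
    qed
    also have "\<dots> = 10 * e * m" by (simp add: m_def sum_distrib_left)
    also have "\<dots> \<le> 10 * e * (2 * q)" using \<open>m \<le> 2 * q\<close> e by (intro mult_left_mono) auto
    finally have 1: "\<bar>q * Q - \<kappa> * m\<bar> \<le> 20 * (e * q)" by simp
    have "\<bar>m - real (card (T - {i, j})) * P\<^sup>2\<bar> < e * q"
      using conc[of i j T] that by (simp add: m_def V_def)
    moreover have "\<bar>(real (card (T - {i, j})) - real (card T)) * P\<^sup>2\<bar> \<le> 2 * 1"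
      unfolding abs_mult using card_diff[of T "{i, j}"] T P
      by (intro mult_mono) (auto simp: power_le_one card_insert_if)
    ultimately have "\<bar>m - real (card T) * P\<^sup>2\<bar> \<le> 3 * (e * q)"
      using e(3) unfolding left_diff_distrib by linarith
    then have 2: "\<bar>\<kappa> * (m - real (card T) * P\<^sup>2)\<bar> \<le> 1 * (3 * (e * q))"
      unfolding abs_mult using \<kappa> \<kappa>1 by (intro mult_mono) auto
    have 3: "\<bar>(\<kappa> * q) * (P * (r - x))\<bar> \<le> (1 * q) * (1 * e)"
      unfolding abs_mult r_def using that \<kappa> \<kappa>1 \<open>0 < q\<close> P by (intro mult_mono) auto
    have 4: "\<bar>(\<kappa> * q) * (x * (P - p))\<bar> \<le> (1 * q) * (1 * e)"
      unfolding abs_mult using that \<kappa> \<kappa>1 \<open>0 < q\<close> p by (intro mult_mono) auto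
    have "real (card T) * P\<^sup>2 = q * (r * P)"
      using \<open>1 \<le> N\<close> by (simp add: q r_def power2_eq_square)
    then have "q * (Q - \<kappa> * x * p) = (q * Q - \<kappa> * m) + \<kappa> * (m - real (card T) * P\<^sup>2)
      + (\<kappa> * q) * (P * (r - x)) + (\<kappa> * q) * (x * (P - p))"
      by (simp add: algebra_simps)
    moreover have "\<bar>u1 + u2 + u3 + u4\<bar> \<le> 50 * y"
      if "\<bar>u1\<bar> \<le> 20 * y" "\<bar>u2\<bar> \<le> 3 * y" "\<bar>u3\<bar> \<le> y" "\<bar>u4\<bar> \<le> y" for u1 u2 u3 u4 y :: real
      using that by linarith
    ultimately have "\<bar>q * (Q - \<kappa> * x * p)\<bar> \<le> 50 * (e * q)"
      using 1 2 3 4 by (simp only: mult_1 mult.commute[of q e])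
    then have "q * \<bar>Q - \<kappa> * x * p\<bar> \<le> q * (50 * e)"
      using \<open>0 < q\<close> by (simp add: abs_mult mult_ac)
    then show ?thesis using \<open>0 < q\<close> by (simp add: Q_def)
  qed
  have \<xi>': "\<bar>real (card (V - S)) / real N - (1 - \<xi>)\<bar> \<le> e"
  proof -
    have "real (card (V - S)) / real N = 1 - real (card S) / real N"
      using card_V \<open>1 \<le> N\<close> by (simp add: field_simps)
    then show ?thesis using \<xi>(1) by simp
  qed
  \<comment> \<open>The diagonal is not bounded by the definition of A directly; it is what the row
    sum \<rho> leaves after both off-diagonal sums, each known up to 23 * e.\<close>
  have diag: "\<bar>a i i - (\<rho> - \<kappa>)\<bar> \<le> 50 * e" if "i \<in> V" for i
  proof -
    have "a i i = \<rho> - (\<Sum>l\<in>S - {i}. a i l) - (\<Sum>l\<in>V - S - {i}. a i l)"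
      using a_row[OF that] sum.remove[OF fin(1) that, of "a i"] split_sum[of "a i" i] by simp
    moreover have "\<kappa> = \<kappa> * \<xi> + \<kappa> * (1 - \<xi>)" by (simp add: algebra_simps)
    ultimately show ?thesis
      using sum1[OF that _ \<xi>(1)] sum1[OF that _ \<xi>'] e(1) by (simp add: abs_le_iff)
  qed
  show ?thesis
    unfolding V_def[symmetric]
  proof
    show "1 / q \<le> 50 * e" using e \<open>0 < q\<close> by (simp add: field_simps)
    show "50 * e \<le> 1" using e by simp
    show "\<bar>q * a i j - \<kappa> * of_bool (g i j)\<bar> \<le> 50 * e" if "i \<in> V" "j \<in> V" "i \<noteq> j" for i j
      using a_near[OF that] e(1) by (cases "g i j") auto
    show "\<bar>(\<Sum>l\<in>S - {i, j}. a i l) - \<kappa> * \<xi>\<bar> \<le> 50 * e" if "i \<in> V" "j \<in> V" "i \<noteq> j" for i j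
      by (rule sum2[OF that _ \<xi>(1)]) simp
    show "\<bar>(\<Sum>l\<in>V - S - {i, j}. a i l) - \<kappa> * (1 - \<xi>)\<bar> \<le> 50 * e" if "i \<in> V" "j \<in> V" "i \<noteq> j" for i j
      by (rule sum2[OF that _ \<xi>']) simp
    show "\<bar>(\<Sum>l\<in>S - {i, j}. a i l * of_bool (g l j)) - \<kappa> * \<xi> * p\<bar> \<le> 50 * e"
      if "i \<in> V" "j \<in> V" "i \<noteq> j" for i j
      by (rule path[OF that _ \<xi>]) simp
    show "\<bar>(\<Sum>l\<in>V - S - {i, j}. a i l * of_bool (g l j)) - \<kappa> * (1 - \<xi>) * p\<bar> \<le> 50 * e"
      if "i \<in> V" "j \<in> V" "i \<noteq> j" for i j
      by (rule path[OF that _ \<xi>']) (use \<xi> in auto)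
  qed (fact fin a_nonneg a_row \<kappa> \<open>\<rho> < 1\<close> \<open>1 \<le> q\<close> diag)+
qed

section \<open>Estimators and margins\<close>

text \<open>C is obtained before the node set, the graph and \<epsilon>, so one constant serves for
  all N. The columns R0 + s * R1 with s = 1 and s = -1 are Q and P, to which
  \<open>resolvent_entries\<close> applies; \<tau> stands for \<sigma>^2.\<close>

lemma estimator_entries:
  fixes \<kappa> \<rho> p \<xi> \<tau> :: real
  assumes \<kappa>: "0 < \<kappa>" "\<kappa> \<le> \<rho>" and "\<rho> < 1" and \<xi>: "0 \<le> \<xi>" "\<xi> \<le> 1" and "0 < \<tau>"
  obtains C where "0 \<le> C"
    and "\<And>V S A g q \<epsilon> R0 R1 i j. concentrated_diffusion V S A g q \<kappa> \<rho> p \<xi> \<epsilon> \<Longrightarrow>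
      (\<And>i j. i \<in> V \<Longrightarrow> j \<in> V \<Longrightarrow> A j i = A i j) \<Longrightarrow>
      (\<And>i j. i \<in> V \<Longrightarrow> j \<in> V \<Longrightarrow>
        R0 i j = \<tau> * of_bool (i = j) + mat_mult_on V A (mat_mult_on V R0 A) i j) \<Longrightarrow>
      (\<And>i j. i \<in> V \<Longrightarrow> j \<in> V \<Longrightarrow> R0 j i = R0 i j) \<Longrightarrow>
      (\<And>i j. i \<in> V \<Longrightarrow> j \<in> V \<Longrightarrow> R1 i j = mat_mult_on V A R0 i j) \<Longrightarrow>
      i \<in> S \<Longrightarrow> j \<in> S \<Longrightarrow> i \<noteq> j \<Longrightarrow>
      \<bar>q * granger_est S R0 R1 i j - (\<kappa> * of_bool (g i j)
        + \<kappa>\<^sup>2 * p * ((2 * \<rho> - \<kappa>) * (1 - \<xi>) / (1 - (\<rho>\<^sup>2 - 2 * \<rho> * \<kappa> * \<xi> + \<kappa>\<^sup>2 * \<xi>))))\<bar> \<le> C * \<epsilon> \<and>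
      \<bar>q * onelag_est S R0 R1 i j - (\<tau> * \<kappa> * ((1 + (\<rho> - \<kappa>)\<^sup>2) / (1 - (\<rho> - \<kappa>)\<^sup>2)\<^sup>2) * of_bool (g i j)
        + \<tau> * \<kappa>\<^sup>2 * p * ((\<rho> + \<rho> * (\<rho> - \<kappa>)\<^sup>2 + 2 * (\<rho> - \<kappa>)) / ((1 - \<rho>\<^sup>2) * (1 - (\<rho> - \<kappa>)\<^sup>2)\<^sup>2)))\<bar> \<le> C * \<epsilon> \<and>
      \<bar>q * residual_est S R0 R1 i j - (\<tau> * \<kappa> / (1 + \<rho> - \<kappa>)\<^sup>2 * of_bool (g i j)
        + - (\<tau> * \<kappa>\<^sup>2 * p / ((1 + \<rho>) * (1 + \<rho> - \<kappa>)\<^sup>2)))\<bar> \<le> C * \<epsilon>"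
proof -
  define a where "a = \<rho> - \<kappa>"
  have a: "0 \<le> a" "a < 1" "\<rho> - \<kappa> = a" "1 + \<rho> - \<kappa> = 1 + a" using \<kappa> \<open>\<rho> < 1\<close> by (auto simp: a_def)
  define d where "d s = \<tau> / (1 - s * (\<rho> - \<kappa>))" for s
  define b where "b s = s * \<kappa> * d s / (1 - s * (\<rho> - \<kappa>))" for s
  define c where "c s = s * \<kappa> * b s * p / (1 - s * \<rho>)" for s
  define D where "D s = 21 * (\<bar>d s\<bar> + \<bar>b s\<bar> + \<bar>c s\<bar>) / (1 - \<rho>)\<^sup>2" for s
  define t where "t = \<kappa> * p * (2 * \<rho> - \<kappa>) / (1 - (\<rho>\<^sup>2 - 2 * \<rho> * \<kappa> * \<xi> + \<kappa>\<^sup>2 * \<xi>))"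
  define \<eta> where "\<eta> = \<kappa> * (1 - \<xi>) * t"
  define b' where "b' = 2 * (\<rho> - \<kappa>) * \<kappa> / (1 - (\<rho> - \<kappa>)\<^sup>2)"
  define c' where "c' = t - b' * p"
  define B where "B = 1 + \<bar>b'\<bar> + \<bar>c'\<bar> + \<bar>\<eta>\<bar> + \<bar>(\<rho> - \<kappa>) * b' + \<kappa>\<bar> + \<bar>(\<rho> - \<kappa>) * c' + \<eta>\<bar>"
  define C where "C = 21 * B / (1 - \<rho>)\<^sup>2 + D 1 + D (- 1)"
  have D_nonneg: "0 \<le> D s" for s by (simp add: D_def)
  have B_nonneg: "0 \<le> 21 * B / (1 - \<rho>)\<^sup>2" by (simp add: B_def)
  have \<eta>_eq: "\<kappa>\<^sup>2 * p * ((2 * \<rho> - \<kappa>) * (1 - \<xi>) / (1 - (\<rho>\<^sup>2 - 2 * \<rho> * \<kappa> * \<xi> + \<kappa>\<^sup>2 * \<xi>))) = \<eta>"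
    by (simp add: \<eta>_def t_def power2_eq_square)
  have res: "\<tau> * \<kappa> / (1 + \<rho> - \<kappa>)\<^sup>2 = - b (-1)" "\<tau> * \<kappa>\<^sup>2 * p / ((1 + \<rho>) * (1 + \<rho> - \<kappa>)\<^sup>2) = c (-1)"
    unfolding c_def b_def d_def a by (simp_all add: power2_eq_square mult_ac)
  have nz: "1 - a \<noteq> 0" "1 + a \<noteq> 0" "1 - \<rho> \<noteq> 0" "1 + \<rho> \<noteq> 0" using a \<kappa> \<open>\<rho> < 1\<close> by auto
  have sq: "1 - a\<^sup>2 = (1 - a) * (1 + a)" "1 - \<rho>\<^sup>2 = (1 - \<rho>) * (1 + \<rho>)"
    by (simp_all add: power2_eq_square algebra_simps)
  have canc: "x * (2 * y) / (2 * z) = x * (y / z)" for x y z :: real by simp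
  \<comment> \<open>Gap and bias of the one-lag estimator are half the differences of the two
    resolvent coefficients. Over a common denominator the numerators are 2 * (1 + a^2) here and 2 *
    (\<rho> + \<rho> * a^2 + 2 * a) in \<open>lag_c\<close>.\<close>
  have lag_b: "\<tau> * \<kappa> * ((1 + (\<rho> - \<kappa>)\<^sup>2) / (1 - (\<rho> - \<kappa>)\<^sup>2)\<^sup>2) = (b 1 - b (-1)) / 2"
  proof -
    have "(b 1 - b (-1)) / 2 = (\<tau> * \<kappa> / (1 - a)\<^sup>2 + \<tau> * \<kappa> / (1 + a)\<^sup>2) / 2"
      unfolding b_def d_def a by (simp add: power2_eq_square mult.commute)
    also have "\<dots> = \<tau> * \<kappa> * ((1 + a)\<^sup>2 + (1 - a)\<^sup>2) / (2 * ((1 - a)\<^sup>2 * (1 + a)\<^sup>2))"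
      using nz by (simp add: add_frac_eq distrib_left)
    also have "(1 + a)\<^sup>2 + (1 - a)\<^sup>2 = 2 * (1 + a\<^sup>2)" by (simp add: power2_eq_square algebra_simps)
    finally show ?thesis by (simp only: a sq power_mult_distrib canc)
  qed
  have lag_c: "\<tau> * \<kappa>\<^sup>2 * p * ((\<rho> + \<rho> * (\<rho> - \<kappa>)\<^sup>2 + 2 * (\<rho> - \<kappa>)) / ((1 - \<rho>\<^sup>2) * (1 - (\<rho> - \<kappa>)\<^sup>2)\<^sup>2)) = (c 1 - c (-1)) / 2"
  proof -
    have "(c 1 - c (-1)) / 2 = (\<tau> * \<kappa>\<^sup>2 * p / ((1 - \<rho>) * (1 - a)\<^sup>2) - \<tau> * \<kappa>\<^sup>2 * p / ((1 + \<rho>) * (1 + a)\<^sup>2)) / 2"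
      unfolding c_def b_def d_def a by (simp add: power2_eq_square mult_ac)
    also have "\<dots> = \<tau> * \<kappa>\<^sup>2 * p * ((1 + \<rho>) * (1 + a)\<^sup>2 - (1 - \<rho>) * (1 - a)\<^sup>2)
        / (2 * (((1 - \<rho>) * (1 - a)\<^sup>2) * ((1 + \<rho>) * (1 + a)\<^sup>2)))"
      using nz by (subst diff_frac_eq) (simp_all add: right_diff_distrib mult_ac)
    also have "(1 + \<rho>) * (1 + a)\<^sup>2 - (1 - \<rho>) * (1 - a)\<^sup>2 = 2 * (\<rho> + \<rho> * a\<^sup>2 + 2 * a)"
      by (simp add: power2_eq_square algebra_simps)
    also have "((1 - \<rho>) * (1 - a)\<^sup>2) * ((1 + \<rho>) * (1 + a)\<^sup>2) = ((1 - \<rho>) * (1 + \<rho>)) * ((1 - a)\<^sup>2 * (1 + a)\<^sup>2)"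
      by (simp only: mult_ac)
    finally show ?thesis by (simp only: a sq power_mult_distrib canc)
  qed
  show thesis
  proof (rule that[of C])
    show "0 \<le> C" using D_nonneg[of 1] D_nonneg[of "-1"] B_nonneg by (simp add: C_def)
    fix V S A g q \<epsilon> i j and R0 R1 :: rmatrix
    assume cd: "concentrated_diffusion V S A g q \<kappa> \<rho> p \<xi> \<epsilon>"
      and sym: "\<And>i j. i \<in> V \<Longrightarrow> j \<in> V \<Longrightarrow> A j i = A i j"
      and stat: "\<And>i j. i \<in> V \<Longrightarrow> j \<in> V \<Longrightarrow>
        R0 i j = \<tau> * of_bool (i = j) + mat_mult_on V A (mat_mult_on V R0 A) i j"
      and R0_sym: "\<And>i j. i \<in> V \<Longrightarrow> j \<in> V \<Longrightarrow> R0 j i = R0 i j"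
      and R1: "\<And>i j. i \<in> V \<Longrightarrow> j \<in> V \<Longrightarrow> R1 i j = mat_mult_on V A R0 i j"
      and ij: "i \<in> S" "j \<in> S" "i \<noteq> j"
    interpret concentrated_diffusion V S A g q \<kappa> \<rho> p \<xi> \<epsilon> by fact
    have ijV: "i \<in> V" "j \<in> V" using ij S_sub by auto
    have row: "(\<Sum>l\<in>V. \<bar>A i l\<bar>) \<le> \<rho>" if "i \<in> V" for i
      using A_row[OF that] A_nonneg[OF that] by simp
    have comm: "mat_mult_on V A R0 i j = mat_mult_on V R0 A i j" if "i \<in> V" "j \<in> V" for i j
      by (rule stationary_equation_commute[OF finite_V sym row \<rho>_less stat that])
    have left: "R0 i j = \<tau> * of_bool (i = j) + mat_mult_on V A R1 i j" if "i \<in> V" "j \<in> V" for i j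
    proof -
      have "mat_mult_on V A R1 i j = mat_mult_on V A (mat_mult_on V R0 A) i j"
        by (rule mat_mult_on_cong) (use R1 comm that in auto)
      then show ?thesis using stat[OF that] by simp
    qed
    have right: "R0 i j = \<tau> * of_bool (i = j) + mat_mult_on V (mat_mult_on V R0 A) A i j"
      if "i \<in> V" "j \<in> V" for i j
    proof -
      have "mat_mult_on V (mat_mult_on V R0 A) A i j = mat_mult_on V (mat_mult_on V A R0) A i j"
        by (rule mat_mult_on_cong) (use comm that in auto)
      then show ?thesis using stat[OF that] by (simp add: mat_mult_on_assoc)
    qed
    define X where "X s k = R0 k j + s * R1 k j" for s :: real and k
    have X: "X s k = \<tau> * of_bool (k = j) + s * (\<Sum>l\<in>V. A k l * X s l)"
      if "k \<in> V" "s = 1 \<or> s = -1" for s k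
    proof -
      have "(\<Sum>l\<in>V. A k l * X s l) = R1 k j + s * mat_mult_on V A R1 k j"
        using R1[OF that(1) ijV(2)]
        by (simp add: X_def mat_mult_on_def distrib_left sum.distrib sum_distrib_left mult_ac)
      then show ?thesis
        using left[OF that(1) ijV(2)] that(2) unfolding X_def by (auto simp: algebra_simps)
    qed
    have XD: "\<bar>q * X s i - (b s * of_bool (g i j) + c s)\<bar> \<le> D s * \<epsilon>" if "s = 1 \<or> s = -1" for s
      using resolvent_entries[OF ijV ij(3) that X[OF _ that] d_def b_def c_def] by (simp add: D_def)
    have XC: "\<bar>q * X s i - (b s * of_bool (g i j) + c s)\<bar> \<le> C * \<epsilon>" if "s = 1 \<or> s = -1" for s
    proof -
      have "D s * \<epsilon> \<le> C * \<epsilon>"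
        using that eps_pos D_nonneg[of 1] D_nonneg[of "-1"] B_nonneg by (auto simp: C_def mult_right_mono)
      then show ?thesis using XD[OF that] by simp
    qed
    have R01: "R1 i j = (X 1 i - X (-1) i) / 2" "R1 i j - R0 i j = - X (-1) i"
      by (simp_all add: X_def)
    have res_bound: "\<bar>q * residual_est S R0 R1 i j - (- b (-1) * of_bool (g i j) + - c (-1))\<bar> \<le> C * \<epsilon>"
    proof -
      have "residual_est S R0 R1 i j = - X (-1) i"
        using ij R01 by (simp add: residual_est_def submat_def)
      then have "q * residual_est S R0 R1 i j - (- b (-1) * of_bool (g i j) + - c (-1))
          = - (q * X (-1) i - (b (-1) * of_bool (g i j) + c (-1)))" by simp
      then show ?thesis
        using XC[OF disjI2[OF refl]] by (simp only: abs_minus_cancel)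
    qed
    have lag_bound: "\<bar>q * onelag_est S R0 R1 i j - ((b 1 - b (-1)) / 2 * of_bool (g i j) + (c 1 - c (-1)) / 2)\<bar> \<le> C * \<epsilon>"
    proof -
      have "onelag_est S R0 R1 i j = (X 1 i - X (-1) i) / 2"
        using ij R01(1) by (simp add: onelag_est_def submat_def)
      then have "q * onelag_est S R0 R1 i j = (q * X 1 i - q * X (-1) i) / 2"
        by (simp only: times_divide_eq_right right_diff_distrib)
      then have "q * onelag_est S R0 R1 i j - ((b 1 - b (-1)) / 2 * of_bool (g i j) + (c 1 - c (-1)) / 2)
        = ((q * X 1 i - (b 1 * of_bool (g i j) + c 1)) - (q * X (-1) i - (b (-1) * of_bool (g i j) + c (-1)))) / 2"
        by (simp only:) (simp add: algebra_simps add_divide_distrib diff_divide_distrib)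
      moreover have "\<bar>(u - w) / 2\<bar> \<le> m" if "\<bar>u\<bar> \<le> m" "\<bar>w\<bar> \<le> m" for u w m :: real
        using that by (auto simp: abs_le_iff field_simps)
      ultimately show ?thesis
        using XC[OF disjI1[OF refl]] XC[OF disjI2[OF refl]] by (simp only:)
    qed
    have granger_bound: "\<bar>q * granger_est S R0 R1 i j - (\<kappa> * of_bool (g i j) + \<eta>)\<bar> \<le> C * \<epsilon>"
    proof -
      obtain v where v: "\<And>i j. i \<in> S \<Longrightarrow> j \<in> S \<Longrightarrow> v i j = of_bool (i = j)"
        "\<And>i j. i \<in> V - S \<Longrightarrow> j \<in> S \<Longrightarrow> v i j = mat_mult_on V A (mat_mult_on V A v) i j"
        "\<And>i j. i \<in> S \<Longrightarrow> j \<in> S \<Longrightarrow> granger_est S R0 R1 i j = mat_mult_on V A v i j"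
      proof (rule granger_est_eq[OF finite_V S_sub \<open>0 < \<tau>\<close> sym row \<rho>_less R0_sym right R1])
        fix v
        assume "\<And>i j. i \<in> S \<Longrightarrow> j \<in> S \<Longrightarrow> v i j = of_bool (i = j)"
          and "\<And>i j. i \<in> V - S \<Longrightarrow> j \<in> S \<Longrightarrow> v i j = mat_mult_on V A (mat_mult_on V A v) i j"
          and "\<And>i j. i \<in> S \<Longrightarrow> j \<in> S \<Longrightarrow> granger_est S R0 R1 i j = mat_mult_on V A v i j"
        then show thesis by (rule that[of v])
      qed
      have "\<bar>q * (\<Sum>l\<in>V. A i l * v l j) - (\<kappa> * of_bool (g i j) + \<eta>)\<bar> \<le> 21 * B * \<epsilon> / (1 - \<rho>)\<^sup>2"
        by (rule granger_entries[where v = "\<lambda>k. v k j", OF ij \<xi> _ _ t_def \<eta>_def b'_def c'_def B_def])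
          (use v ij in \<open>simp_all add: mat_mult_on_def\<close>)
      also have "\<dots> \<le> C * \<epsilon>"
        using eps_pos D_nonneg[of 1] D_nonneg[of "-1"] by (simp add: C_def distrib_right)
      finally show ?thesis
        using v(3)[OF ij(1,2)] by (simp add: mat_mult_on_def)
    qed
    show "\<bar>q * granger_est S R0 R1 i j - (\<kappa> * of_bool (g i j)
        + \<kappa>\<^sup>2 * p * ((2 * \<rho> - \<kappa>) * (1 - \<xi>) / (1 - (\<rho>\<^sup>2 - 2 * \<rho> * \<kappa> * \<xi> + \<kappa>\<^sup>2 * \<xi>))))\<bar> \<le> C * \<epsilon> \<and>
      \<bar>q * onelag_est S R0 R1 i j - (\<tau> * \<kappa> * ((1 + (\<rho> - \<kappa>)\<^sup>2) / (1 - (\<rho> - \<kappa>)\<^sup>2)\<^sup>2) * of_bool (g i j)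
        + \<tau> * \<kappa>\<^sup>2 * p * ((\<rho> + \<rho> * (\<rho> - \<kappa>)\<^sup>2 + 2 * (\<rho> - \<kappa>)) / ((1 - \<rho>\<^sup>2) * (1 - (\<rho> - \<kappa>)\<^sup>2)\<^sup>2)))\<bar> \<le> C * \<epsilon> \<and>
      \<bar>q * residual_est S R0 R1 i j - (\<tau> * \<kappa> / (1 + \<rho> - \<kappa>)\<^sup>2 * of_bool (g i j)
        + - (\<tau> * \<kappa>\<^sup>2 * p / ((1 + \<rho>) * (1 + \<rho> - \<kappa>)\<^sup>2)))\<bar> \<le> C * \<epsilon>"
      unfolding \<eta>_eq lag_b lag_c res using granger_bound lag_bound res_bound by blast
  qed
qed

section \<open>From uniform entry bounds to margins in probability\<close>

lemma margin_near:
  fixes s c \<delta> :: real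
  assumes "finite P" "P \<noteq> {}" and "\<And>i j. (i, j) \<in> P \<Longrightarrow> \<bar>s * e i j - c\<bar> \<le> \<delta>"
  shows "\<bar>s * lower_margin P e - c\<bar> \<le> \<delta>" and "\<bar>s * upper_margin P e - c\<bar> \<le> \<delta>"
proof -
  have "lower_margin P e \<in> (\<lambda>(i, j). e i j) ` P"
    unfolding lower_margin_def using assms by (intro Min_in) auto
  then show "\<bar>s * lower_margin P e - c\<bar> \<le> \<delta>" using assms(3) by auto
  have "upper_margin P e \<in> (\<lambda>(i, j). e i j) ` P"
    unfolding upper_margin_def using assms by (intro Max_in) auto
  then show "\<bar>s * upper_margin P e - c\<bar> \<le> \<delta>" using assms(3) by auto
qed

text \<open>Outside the degenerate event a margin is attained at some pair and inherits the entry
  bound. Hence the probability in question is at least P(H) minus the probability of degeneracy, and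
  the arbitrary value of an empty margin is harmless.\<close>

lemma whp_near_marginI:
  fixes s :: "nat \<Rightarrow> real" and c :: real
  assumes ps: "\<And>N. prob_space (M N)"
    and meas_P: "\<And>N. {\<omega> \<in> space (M N). P N \<omega> = {}} \<in> sets (M N)"
    and meas_low: "\<And>N \<epsilon>. {\<omega> \<in> space (M N). \<bar>s N * lower_margin (P N \<omega>) (e N \<omega>) - c\<bar> < \<epsilon>} \<in> sets (M N)"
    and meas_up: "\<And>N \<epsilon>. {\<omega> \<in> space (M N). \<bar>s N * upper_margin (P N \<omega>) (e N \<omega>) - c\<bar> < \<epsilon>} \<in> sets (M N)"
    and fin: "\<And>N \<omega>. finite (P N \<omega>)"
    and empty: "(\<lambda>N. measure (M N) {\<omega> \<in> space (M N). P N \<omega> = {}}) \<longlonglongrightarrow> 0"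
    and approx: "\<And>\<delta>. 0 < \<delta> \<Longrightarrow> \<exists>H. (\<forall>N. H N \<in> sets (M N)) \<and> (\<lambda>N. measure (M N) (H N)) \<longlonglongrightarrow> 1 \<and>
      (\<forall>\<^sub>F N in sequentially. \<forall>\<omega>\<in>H N. \<forall>(i, j)\<in>P N \<omega>. \<bar>s N * e N \<omega> i j - c\<bar> \<le> \<delta>)"
  shows "whp_near M (\<lambda>N \<omega>. s N * lower_margin (P N \<omega>) (e N \<omega>)) c"
    and "whp_near M (\<lambda>N \<omega>. s N * upper_margin (P N \<omega>) (e N \<omega>)) c"
proof -
  \<comment> \<open>Here m stands for either margin. The entry bounds are used with \<epsilon> / 2
    because they are not strict.\<close>
  have main: "(\<lambda>N. measure (M N) {\<omega> \<in> space (M N). \<bar>s N * m (P N \<omega>) (e N \<omega>) - c\<bar> < \<epsilon>}) \<longlonglongrightarrow> 1"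
    if "0 < \<epsilon>" and meas: "\<And>N. {\<omega> \<in> space (M N). \<bar>s N * m (P N \<omega>) (e N \<omega>) - c\<bar> < \<epsilon>} \<in> sets (M N)"
      and near: "\<And>P s e. finite P \<Longrightarrow> P \<noteq> {} \<Longrightarrow> (\<And>i j. (i, j) \<in> P \<Longrightarrow> \<bar>s * e i j - c\<bar> \<le> \<epsilon> / 2) \<Longrightarrow>
        \<bar>s * m P e - c\<bar> \<le> \<epsilon> / 2"
    for \<epsilon> and m :: "(nat \<times> nat) set \<Rightarrow> rmatrix \<Rightarrow> real"
  proof -
    obtain H where H: "\<And>N. H N \<in> sets (M N)" "(\<lambda>N. measure (M N) (H N)) \<longlonglongrightarrow> 1"
      and H_near: "\<forall>\<^sub>F N in sequentially. \<forall>\<omega>\<in>H N. \<forall>(i, j)\<in>P N \<omega>. \<bar>s N * e N \<omega> i j - c\<bar> \<le> \<epsilon> / 2"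
      using approx[of "\<epsilon> / 2"] \<open>0 < \<epsilon>\<close> by auto
    define Z where "Z N = {\<omega> \<in> space (M N). P N \<omega> = {}}" for N
    show ?thesis
    proof (rule tendsto_sandwich)
      show "(\<lambda>N. measure (M N) (H N) - measure (M N) (Z N)) \<longlonglongrightarrow> 1"
        using tendsto_diff[OF H(2) empty] by (simp add: Z_def)
      show "\<forall>\<^sub>F N in sequentially. measure (M N) {\<omega> \<in> space (M N). \<bar>s N * m (P N \<omega>) (e N \<omega>) - c\<bar> < \<epsilon>} \<le> 1"
        using prob_space.prob_le_1[OF ps] by simp
      show "\<forall>\<^sub>F N in sequentially. measure (M N) (H N) - measure (M N) (Z N)
          \<le> measure (M N) {\<omega> \<in> space (M N). \<bar>s N * m (P N \<omega>) (e N \<omega>) - c\<bar> < \<epsilon>}"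
        using H_near
      proof eventually_elim
        case (elim N)
        interpret prob_space "M N" by (rule ps)
        have "H N \<subseteq> Z N \<union> {\<omega> \<in> space (M N). \<bar>s N * m (P N \<omega>) (e N \<omega>) - c\<bar> < \<epsilon>}"
        proof
          fix \<omega> assume "\<omega> \<in> H N"
          then have "\<omega> \<in> space (M N)" using H(1) sets.sets_into_space by blast
          moreover have "\<bar>s N * m (P N \<omega>) (e N \<omega>) - c\<bar> \<le> \<epsilon> / 2" if "P N \<omega> \<noteq> {}"
            using fin that elim \<open>\<omega> \<in> H N\<close> by (intro near) auto
          ultimately show "\<omega> \<in> Z N \<union> {\<omega> \<in> space (M N). \<bar>s N * m (P N \<omega>) (e N \<omega>) - c\<bar> < \<epsilon>}"
            using \<open>0 < \<epsilon>\<close> by (force simp: Z_def)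
        qed
        then have "prob (H N) \<le> prob (Z N \<union> {\<omega> \<in> space (M N). \<bar>s N * m (P N \<omega>) (e N \<omega>) - c\<bar> < \<epsilon>})"
          using meas meas_P by (intro finite_measure_mono) (auto simp: Z_def)
        also have "\<dots> \<le> prob (Z N) + prob {\<omega> \<in> space (M N). \<bar>s N * m (P N \<omega>) (e N \<omega>) - c\<bar> < \<epsilon>}"
          using meas meas_P by (intro measure_Un_le) (auto simp: Z_def)
        finally show ?case by simp
      qed
    qed simp
  qed
  show "whp_near M (\<lambda>N \<omega>. s N * lower_margin (P N \<omega>) (e N \<omega>)) c"
    unfolding whp_near_def using main[OF _ meas_low margin_near(1)] by blast
  show "whp_near M (\<lambda>N \<omega>. s N * upper_margin (P N \<omega>) (e N \<omega>)) c"
    unfolding whp_near_def using main[OF _ meas_up margin_near(2)] by blast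
qed

text \<open>Both A and the estimator are required to be functions of the graph, so that
  \<open>meas\<close>, which speaks of arbitrary predicates of the graph, makes every event about
  the margins measurable.\<close>

lemma universal_local_consistencyI:
  fixes s :: "nat \<Rightarrow> real" and \<eta> \<Gamma> :: real
  assumes ps: "\<And>N. prob_space (M N)"
    and meas: "\<And>N Q. {\<omega> \<in> space (M N). Q (G N \<omega>)} \<in> sets (M N)"
    and A: "\<And>N \<omega>. A N \<omega> = \<pi> N (G N \<omega>)" and est: "\<And>N \<omega>. est N \<omega> = E N (G N \<omega>)"
    and S: "\<And>N. finite (S N)" "nondegenerate M A S" and "0 < \<Gamma>"
    and edge: "\<And>N \<omega> i j. \<omega> \<in> space (M N) \<Longrightarrow> i \<in> S N \<Longrightarrow> j \<in> S N \<Longrightarrow> i \<noteq> j \<Longrightarrow>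
      (0 < A N \<omega> i j \<longleftrightarrow> G N \<omega> i j) \<and> (A N \<omega> i j = 0 \<longleftrightarrow> \<not> G N \<omega> i j)"
    and approx: "\<And>\<delta>. 0 < \<delta> \<Longrightarrow> \<exists>H. (\<forall>N. H N \<in> sets (M N)) \<and> (\<lambda>N. measure (M N) (H N)) \<longlonglongrightarrow> 1 \<and>
      (\<forall>\<^sub>F N in sequentially. \<forall>\<omega>\<in>H N. \<forall>i\<in>S N. \<forall>j\<in>S N. i \<noteq> j \<longrightarrow>
        \<bar>s N * est N \<omega> i j - (\<Gamma> * of_bool (G N \<omega> i j) + \<eta>)\<bar> \<le> \<delta>)"
  shows "universal_local_consistency M A S est s \<eta> \<Gamma>"
proof -
  have fin: "finite (disconnected_pairs (S N) a)" "finite (connected_pairs (S N) a)" for N a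
    by (rule finite_subset[of _ "S N \<times> S N"]; use S in \<open>auto simp: disconnected_pairs_def connected_pairs_def\<close>)+
  have ap: "\<exists>H. (\<forall>N. H N \<in> sets (M N)) \<and> (\<lambda>N. measure (M N) (H N)) \<longlonglongrightarrow> 1 \<and>
      (\<forall>\<^sub>F N in sequentially. \<forall>\<omega>\<in>H N.
        (\<forall>(i, j)\<in>disconnected_pairs (S N) (A N \<omega>). \<bar>s N * est N \<omega> i j - \<eta>\<bar> \<le> \<delta>) \<and>
        (\<forall>(i, j)\<in>connected_pairs (S N) (A N \<omega>). \<bar>s N * est N \<omega> i j - (\<eta> + \<Gamma>)\<bar> \<le> \<delta>))" if "0 < \<delta>" for \<delta>
  proof -
    obtain H where H: "\<And>N. H N \<in> sets (M N)" "(\<lambda>N. measure (M N) (H N)) \<longlonglongrightarrow> 1"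
      and near: "\<forall>\<^sub>F N in sequentially. \<forall>\<omega>\<in>H N. \<forall>i\<in>S N. \<forall>j\<in>S N. i \<noteq> j \<longrightarrow>
        \<bar>s N * est N \<omega> i j - (\<Gamma> * of_bool (G N \<omega> i j) + \<eta>)\<bar> \<le> \<delta>"
      using approx[OF \<open>0 < \<delta>\<close>] by blast
    from near have "\<forall>\<^sub>F N in sequentially. \<forall>\<omega>\<in>H N.
        (\<forall>(i, j)\<in>disconnected_pairs (S N) (A N \<omega>). \<bar>s N * est N \<omega> i j - \<eta>\<bar> \<le> \<delta>) \<and>
        (\<forall>(i, j)\<in>connected_pairs (S N) (A N \<omega>). \<bar>s N * est N \<omega> i j - (\<eta> + \<Gamma>)\<bar> \<le> \<delta>)"
    proof eventually_elim
      case (elim N)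
      have sp: "\<omega> \<in> space (M N)" if "\<omega> \<in> H N" for \<omega>
        using that H(1) sets.sets_into_space by blast
      have "\<bar>s N * est N \<omega> i j - \<eta>\<bar> \<le> \<delta>" if "\<omega> \<in> H N" "(i, j) \<in> disconnected_pairs (S N) (A N \<omega>)" for \<omega> i j
        using elim that edge[OF sp[OF that(1)], of i j] by (force simp: disconnected_pairs_def)
      moreover have "\<bar>s N * est N \<omega> i j - (\<eta> + \<Gamma>)\<bar> \<le> \<delta>" if "\<omega> \<in> H N" "(i, j) \<in> connected_pairs (S N) (A N \<omega>)" for \<omega> i j
        using elim that edge[OF sp[OF that(1)], of i j] by (force simp: connected_pairs_def add.commute)
      ultimately show ?case by blast
    qed
    with H show ?thesis by blast
  qed
  have ap1: "\<exists>H. (\<forall>N. H N \<in> sets (M N)) \<and> (\<lambda>N. measure (M N) (H N)) \<longlonglongrightarrow> 1 \<and>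
      (\<forall>\<^sub>F N in sequentially. \<forall>\<omega>\<in>H N.
        \<forall>(i, j)\<in>disconnected_pairs (S N) (A N \<omega>). \<bar>s N * est N \<omega> i j - \<eta>\<bar> \<le> \<delta>)" if "0 < \<delta>" for \<delta>
    using ap[OF that]
    by (elim exE conjE, intro exI conjI) (assumption, assumption, erule eventually_mono, blast)
  have ap2: "\<exists>H. (\<forall>N. H N \<in> sets (M N)) \<and> (\<lambda>N. measure (M N) (H N)) \<longlonglongrightarrow> 1 \<and>
      (\<forall>\<^sub>F N in sequentially. \<forall>\<omega>\<in>H N.
        \<forall>(i, j)\<in>connected_pairs (S N) (A N \<omega>). \<bar>s N * est N \<omega> i j - (\<eta> + \<Gamma>)\<bar> \<le> \<delta>)" if "0 < \<delta>" for \<delta>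
    using ap[OF that]
    by (elim exE conjE, intro exI conjI) (assumption, assumption, erule eventually_mono, blast)
  have m: "{\<omega> \<in> space (M N). Q (A N \<omega>) (est N \<omega>)} \<in> sets (M N)" for N Q
    unfolding A est by (rule meas)
  show ?thesis
    unfolding universal_local_consistency_def
    using \<open>0 < \<Gamma>\<close> S(2)[unfolded nondegenerate_def] fin m ap1 ap2
    by (intro conjI whp_near_marginI[OF ps]) auto
qed

section \<open>Concentration with high probability\<close>

text \<open>Every outcome yields a simple graph on {1..N}, so G has finitely many values, each fixed
  by its edges with increasing endpoints. An event about G is thus a finite union of finite
  intersections of edge events.\<close>

lemma (in prob_space) erdos_renyi_graph_event:
  assumes er: "erdos_renyi M N p G"
  shows "finite (G ` space M)" and "{\<omega> \<in> space M. Q (G \<omega>)} \<in> events"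
proof -
  define P where "P = {(i, j). 1 \<le> i \<and> i < j \<and> j \<le> N}"
  have sym: "G \<omega> j i = G \<omega> i j" and simple: "G \<omega> i j \<Longrightarrow> i \<in> {1..N} \<and> j \<in> {1..N} \<and> i \<noteq> j"
    if "\<omega> \<in> space M" for \<omega> i j
    using er that unfolding erdos_renyi_def by blast+
  have "finite ((\<lambda>g. {(i, j). g i j}) ` (G ` space M))"
    by (rule finite_subset[of _ "Pow ({1..N} \<times> {1..N})"]) (use simple in auto)
  moreover have "inj_on (\<lambda>g. {(i, j). g i j}) (G ` space M)"
    by (rule inj_onI) (auto simp: fun_eq_iff set_eq_iff)
  ultimately show fin: "finite (G ` space M)" by (rule finite_imageD)
  have "finite P" by (rule finite_subset[of _ "{1..N} \<times> {1..N}"]) (auto simp: P_def)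
  have edge: "{\<omega> \<in> space M. G \<omega> (fst e) (snd e) = c} \<in> events" if "e \<in> P" for e c
  proof -
    have "(\<lambda>\<omega>. G \<omega> (fst e) (snd e)) \<in> measurable M (count_space UNIV)"
      using er that by (auto simp: erdos_renyi_def indep_vars_def P_def)
    from measurable_sets[OF this, of "{c}"] show ?thesis
      by (simp add: vimage_def Int_def conj_commute)
  qed
  have single: "{\<omega> \<in> space M. G \<omega> = g} \<in> events" if g: "g \<in> G ` space M" for g
  proof -
    have "G \<omega> = g \<longleftrightarrow> (\<forall>e\<in>P. G \<omega> (fst e) (snd e) = g (fst e) (snd e))" if "\<omega> \<in> space M" for \<omega>
    proof
      assume eq: "\<forall>e\<in>P. G \<omega> (fst e) (snd e) = g (fst e) (snd e)"
      obtain \<omega>' where \<omega>': "\<omega>' \<in> space M" "g = G \<omega>'" using g by auto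
      have "G \<omega> i j = g i j" for i j
      proof (cases "i \<in> {1..N} \<and> j \<in> {1..N} \<and> i \<noteq> j")
        case True
        then consider "(i, j) \<in> P" | "(j, i) \<in> P" by (force simp: P_def)
        then show ?thesis
        proof cases
          case 1
          then show ?thesis using eq by force
        next
          case 2
          then have "G \<omega> j i = g j i" using eq by force
          then show ?thesis using sym[OF \<open>\<omega> \<in> space M\<close>, of i j] sym[OF \<omega>'(1), of i j] \<omega>'(2) by simp
        qed
      next
        case False
        then show ?thesis using simple[OF \<open>\<omega> \<in> space M\<close>, of i j] simple[OF \<omega>'(1), of i j] \<omega>'(2) by blast
      qed
      then show "G \<omega> = g" by (simp add: fun_eq_iff)
    qed simp
    then have "{\<omega> \<in> space M. G \<omega> = g} = {\<omega> \<in> space M. \<forall>e\<in>P. G \<omega> (fst e) (snd e) = g (fst e) (snd e)}"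
      by auto
    also have "\<dots> \<in> events"
      using edge \<open>finite P\<close> by (intro sets.sets_Collect_finite_All)  auto
    finally show ?thesis .
  qed
  have "{\<omega> \<in> space M. Q (G \<omega>)} = (\<Union>g\<in>{g \<in> G ` space M. Q g}. {\<omega> \<in> space M. G \<omega> = g})"
    by auto
  also have "\<dots> \<in> events"
    using fin single by (intro sets.finite_UN) auto
  finally show "{\<omega> \<in> space M. Q (G \<omega>)} \<in> events" .
qed

text \<open>The outcomes in null atoms are covered by finitely many null sets. In the application
  \<open>Rel\<close> says that two graphs have the same diffusion matrix, since one atom of A may
  contain several graphs.\<close>

lemma (in prob_space) prob_null_atom:
  assumes fin: "finite (G ` space M)" and ev: "\<And>Q. {\<omega> \<in> space M. Q (G \<omega>)} \<in> events"
    and refl: "\<And>g. Rel g g"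
  shows "prob {\<omega> \<in> space M. prob {\<omega>' \<in> space M. Rel (G \<omega>') (G \<omega>)} = 0} = 0"
proof -
  define I where "I = {g \<in> G ` space M. prob {\<omega>' \<in> space M. Rel (G \<omega>') g} = 0}"
  have "finite I" using fin by (simp add: I_def)
  have "{\<omega> \<in> space M. prob {\<omega>' \<in> space M. Rel (G \<omega>') (G \<omega>)} = 0}
      \<subseteq> (\<Union>g\<in>I. {\<omega>' \<in> space M. Rel (G \<omega>') g})"
    using refl by (auto simp: I_def)
  then have "prob {\<omega> \<in> space M. prob {\<omega>' \<in> space M. Rel (G \<omega>') (G \<omega>)} = 0}
      \<le> prob (\<Union>g\<in>I. {\<omega>' \<in> space M. Rel (G \<omega>') g})"
    using ev \<open>finite I\<close> by (intro finite_measure_mono sets.finite_UN) auto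
  also have "\<dots> \<le> (\<Sum>g\<in>I. prob {\<omega>' \<in> space M. Rel (G \<omega>') g})"
    using ev \<open>finite I\<close> by (intro finite_measure_subadditive_finite) auto
  also have "\<dots> = 0" by (rule sum.neutral) (simp add: I_def)
  finally show ?thesis using measure_nonneg[of M] by (simp add: measure_le_0_iff)
qed

text \<open>For i = j and a symmetric graph the sum counts the neighbours of i in T, so that degrees
  and common neighbours are handled together.\<close>

definition concentrated_graph :: "nat \<Rightarrow> nat set \<Rightarrow> real \<Rightarrow> real \<Rightarrow> graph \<Rightarrow> bool" where
  "concentrated_graph N S P e g \<longleftrightarrow>
    (\<forall>i\<in>{1..N}. \<forall>j\<in>{1..N}. \<forall>T\<in>{S, {1..N} - S}.
      \<bar>(\<Sum>l\<in>T - {i, j}. of_bool (g i l \<and> g l j)) - real (card (T - {i, j})) * (if i = j then P else P\<^sup>2)\<bar>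
        < e * (real N * P))"

text \<open>A union bound over N^2 pairs and two sets T, each contributing two tails.\<close>

lemma (in prob_space) prob_not_concentrated_graph:
  assumes er: "erdos_renyi M N p G" and p: "0 \<le> p" "p \<le> 1" and S: "S \<subseteq> {1..N}" and e: "0 < e" "e \<le> 2"
  shows "prob {\<omega> \<in> space M. \<not> concentrated_graph N S p e (G \<omega>)}
    \<le> 4 * (real N)\<^sup>2 * exp (- (e\<^sup>2 * (real N * p) / 4))"
proof -
  define I where "I = {1..N} \<times> {1..N} \<times> {S, {1..N} - S}"
  define X where "X = (\<lambda>(i, j, T). {\<omega> \<in> space M. e * (real N * p) \<le>
      \<bar>(\<Sum>l\<in>T - {i, j}. of_bool (G \<omega> i l \<and> G \<omega> l j)) - real (card (T - {i, j})) * (if i = j then p else p\<^sup>2)\<bar>})"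
  have X_ev: "X u \<in> events" for u
    unfolding X_def by (cases u) (simp only: prod.case, rule erdos_renyi_graph_event(2)[OF er])
  have "finite I" by (simp add: I_def)
  have "{\<omega> \<in> space M. \<not> concentrated_graph N S p e (G \<omega>)} \<subseteq> (\<Union>u\<in>I. X u)"
  proof
    fix \<omega> assume "\<omega> \<in> {\<omega> \<in> space M. \<not> concentrated_graph N S p e (G \<omega>)}"
    then obtain i j T where "\<omega> \<in> space M" and ijT: "i \<in> {1..N}" "j \<in> {1..N}" "T \<in> {S, {1..N} - S}"
      and "\<not> \<bar>(\<Sum>l\<in>T - {i, j}. of_bool (G \<omega> i l \<and> G \<omega> l j)) - real (card (T - {i, j})) * (if i = j then p else p\<^sup>2)\<bar>
        < e * (real N * p)"
      unfolding concentrated_graph_def by blast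
    then have "\<omega> \<in> X (i, j, T)" unfolding X_def prod.case not_less by blast
    moreover have "(i, j, T) \<in> I" using ijT unfolding I_def by blast
    ultimately show "\<omega> \<in> (\<Union>u\<in>I. X u)" by blast
  qed
  then have "prob {\<omega> \<in> space M. \<not> concentrated_graph N S p e (G \<omega>)} \<le> prob (\<Union>u\<in>I. X u)"
    using X_ev \<open>finite I\<close> by (intro finite_measure_mono sets.finite_UN) auto
  also have "\<dots> \<le> (\<Sum>u\<in>I. prob (X u))"
    using X_ev \<open>finite I\<close> by (intro finite_measure_subadditive_finite) auto
  also have "\<dots> \<le> (\<Sum>u\<in>I. 2 * exp (- (e\<^sup>2 * (real N * p) / 4)))"
  proof (rule sum_mono)
    fix u assume "u \<in> I"
    then obtain i j T where u: "u = (i, j, T)" "i \<in> {1..N}" "j \<in> {1..N}" "T - {i, j} \<subseteq> {1..N} - {i, j}"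
      using S by (cases u) (auto simp: I_def)
    show "prob (X u) \<le> 2 * exp (- (e\<^sup>2 * (real N * p) / 4))"
      unfolding X_def u(1) prod.case
      by (rule erdos_renyi_common_neighbours_concentration[OF er p u(2-4) e])
  qed
  also have "\<dots> = real (card I) * (2 * exp (- (e\<^sup>2 * (real N * p) / 4)))" by simp
  also have "\<dots> \<le> (2 * (real N)\<^sup>2) * (2 * exp (- (e\<^sup>2 * (real N * p) / 4)))"
  proof (rule mult_right_mono)
    have "card {S, {1..N} - S} \<le> 2" by (simp add: card_insert_if)
    then have "card I \<le> N * (N * 2)" by (simp add: I_def card_cartesian_product)
    then have "real (card I) \<le> real (N * (N * 2))" by (simp only: of_nat_le_iff)
    then show "real (card I) \<le> 2 * (real N)\<^sup>2" by (simp add: power2_eq_square)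
  qed simp
  finally show ?thesis by simp
qed

section \<open>Combination of the probabilistic and the deterministic estimates\<close>

theorem theorem2:
  fixes M :: "nat \<Rightarrow> 'a measure"
    and G :: "nat \<Rightarrow> 'a \<Rightarrow> graph"
    and \<pi> :: "nat \<Rightarrow> graph \<Rightarrow> rmatrix"
    and A :: "nat \<Rightarrow> 'a \<Rightarrow> rmatrix"
    and x :: "nat \<Rightarrow> nat \<Rightarrow> nat \<Rightarrow> 'a \<Rightarrow> real"
    and y :: "nat \<Rightarrow> nat \<Rightarrow> 'a \<Rightarrow> nat \<Rightarrow> real"
    and S :: "nat \<Rightarrow> nat set"
    and pN w :: "nat \<Rightarrow> real"
    and p \<xi> \<rho> \<kappa> \<sigma> :: real
    and R0 R1 :: "nat \<Rightarrow> 'a \<Rightarrow> rmatrix"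
  assumes "\<And>N. prob_space (M N)"
    and "\<And>N. 0 \<le> pN N \<and> pN N \<le> 1"
    and "\<And>N. erdos_renyi (M N) N (pN N) (G N)"
    and "0 < \<kappa>" and "\<kappa> \<le> \<rho>" and "\<rho> < 1"
    and "\<And>N \<omega>. A N \<omega> = \<pi> N (G N \<omega>)"
    and "\<And>N \<omega>. \<omega> \<in> space (M N) \<Longrightarrow> regular_diffusion N \<rho> \<kappa> (G N \<omega>) (A N \<omega>)"
    and "0 < \<sigma>"
    and "\<And>N. iid_inputs (M N) N (x N)"
    and "\<And>N. inputs_indep (M N) N (G N) (y N 0) (x N)"
    and "\<And>N. diffusion_dynamics (M N) N \<sigma> (A N) (x N) (y N)"
    and "\<And>N \<omega>. R0 N \<omega> = corr0 (M N) N (A N) (y N) \<omega>"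
    and "\<And>N \<omega>. R1 N \<omega> = corr1 (M N) N (A N) (y N) \<omega>"
    and "\<And>N. S N \<subseteq> {1..N}"
    and "nondegenerate M A S"
    and "0 < \<xi>" and "\<xi> < 1"
    and "(\<lambda>N. real (card (S N)) / real N) \<longlonglongrightarrow> \<xi>"
    and "\<forall>\<^sub>F N in sequentially. pN N = w N * (ln (real N) / real N)"
    and "filterlim w at_top sequentially"
    and "pN \<longlonglongrightarrow> p"
  shows "universal_local_consistency M A S (\<lambda>N \<omega>. granger_est (S N) (R0 N \<omega>) (R1 N \<omega>))
           (\<lambda>N. real N * pN N)
           (\<kappa>\<^sup>2 * p * ((2 * \<rho> - \<kappa>) * (1 - \<xi>) / (1 - (\<rho>\<^sup>2 - 2 * \<rho> * \<kappa> * \<xi> + \<kappa>\<^sup>2 * \<xi>))))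
           \<kappa> \<and>
         universal_local_consistency M A S (\<lambda>N \<omega>. onelag_est (S N) (R0 N \<omega>) (R1 N \<omega>))
           (\<lambda>N. real N * pN N)
           (\<sigma>\<^sup>2 * \<kappa>\<^sup>2 * p *
             ((\<rho> + \<rho> * (\<rho> - \<kappa>)\<^sup>2 + 2 * (\<rho> - \<kappa>)) / ((1 - \<rho>\<^sup>2) * (1 - (\<rho> - \<kappa>)\<^sup>2)\<^sup>2)))
           (\<sigma>\<^sup>2 * \<kappa> * ((1 + (\<rho> - \<kappa>)\<^sup>2) / (1 - (\<rho> - \<kappa>)\<^sup>2)\<^sup>2)) \<and>
         universal_local_consistency M A S (\<lambda>N \<omega>. residual_est (S N) (R0 N \<omega>) (R1 N \<omega>))
           (\<lambda>N. real N * pN N)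
           (- (\<sigma>\<^sup>2 * \<kappa>\<^sup>2 * p / ((1 + \<rho>) * (1 + \<rho> - \<kappa>)\<^sup>2)))
           (\<sigma>\<^sup>2 * \<kappa> / (1 + \<rho> - \<kappa>)\<^sup>2)"
proof -
  note ps = assms(1) and pN = assms(2) and er = assms(3) and A_eq = assms(7) and reg = assms(8)
    and S_sub = assms(15) and w = assms(20,21)
  have meas: "{\<omega> \<in> space (M N). Q (G N \<omega>)} \<in> sets (M N)" for N Q
    by (rule prob_space.erdos_renyi_graph_event(2)[OF ps er])
  have er_sym: "G N \<omega> j i = G N \<omega> i j" if "\<omega> \<in> space (M N)" for N \<omega> i j
    using er that unfolding erdos_renyi_def by blast
  define q where "q N = real N * pN N" for N
  have q_eq: "\<forall>\<^sub>F N in sequentially. q N = w N * ln (real N)"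
    using w(1) eventually_gt_at_top[of 0] by eventually_elim (simp add: q_def)
  have ln_top: "filterlim (\<lambda>N. ln (real N)) at_top sequentially"
    by (rule filterlim_compose[OF ln_at_top filterlim_real_sequentially])
  have q_top: "filterlim q at_top sequentially"
    using filterlim_at_top_mult_at_top[OF w(2) ln_top] q_eq by (simp cong: filterlim_cong)
  define atom where "atom N \<omega> = {\<omega>' \<in> space (M N). \<forall>i\<in>{1..N}. \<forall>j\<in>{1..N}. A N \<omega>' i j = A N \<omega> i j}" for N \<omega>
  \<comment> \<open>The second condition discards outcomes whose conditional law is undefined; it
    costs no probability.\<close>
  define H where "H e N = {\<omega> \<in> space (M N). concentrated_graph N (S N) (pN N) e (G N \<omega>) \<and>
      measure (M N) (atom N \<omega>) \<noteq> 0}" for e N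
  have H_ev: "H e N \<in> sets (M N)" for e N
    unfolding H_def atom_def A_eq by (rule meas)
  have H_prob: "(\<lambda>N. measure (M N) (H e N)) \<longlonglongrightarrow> 1" if e: "0 < e" "e \<le> 2" for e
  proof (rule tendsto_sandwich)
    show "\<forall>\<^sub>F N in sequentially. measure (M N) (H e N) \<le> 1"
      using prob_space.prob_le_1[OF ps] by simp
    show "(\<lambda>N. 1 - 4 * inverse (real N)) \<longlonglongrightarrow> 1"
      using tendsto_diff[OF tendsto_const[of 1] tendsto_mult_left[OF lim_inverse_n, of "4::real"]] by simp
    \<comment> \<open>With this bound e^2 * q / 4 \<ge> 3 * ln N, so the tail N^(-3) beats the N^2
      of the union bound and 4 / N remains.\<close>
    have "\<forall>\<^sub>F N in sequentially. 12 / e\<^sup>2 \<le> w N"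
      using w(2) by (simp add: filterlim_at_top)
    then show "\<forall>\<^sub>F N in sequentially. 1 - 4 * inverse (real N) \<le> measure (M N) (H e N)"
      using q_eq eventually_ge_at_top[of 1]
    proof eventually_elim
      case (elim N)
      interpret prob_space "M N" by (rule ps)
      define Z where "Z = {\<omega> \<in> space (M N). prob (atom N \<omega>) = 0}"
      have Z: "Z \<in> events" "prob Z = 0"
        unfolding Z_def atom_def A_eq
        by (rule meas, rule prob_null_atom[OF erdos_renyi_graph_event[OF er],
              where Rel = "\<lambda>g g'. \<forall>i\<in>{1..N}. \<forall>j\<in>{1..N}. \<pi> N g i j = \<pi> N g' i j"]) simp
      define Y where "Y = {\<omega> \<in> space (M N). \<not> concentrated_graph N (S N) (pN N) e (G N \<omega>)}"
      have "Y \<in> events" unfolding Y_def by (rule meas)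
      have "1 - prob (H e N) = prob (space (M N) - H e N)"
        using prob_compl[OF H_ev] by simp
      also have "\<dots> \<le> prob (Y \<union> Z)"
        using \<open>Y \<in> events\<close> Z(1) by (intro finite_measure_mono) (auto simp: Y_def Z_def H_def)
      also have "\<dots> \<le> prob Y + prob Z"
        using \<open>Y \<in> events\<close> Z(1) by (rule measure_Un_le)
      also have "\<dots> \<le> 4 * (real N)\<^sup>2 * exp (- (e\<^sup>2 * q N / 4))"
        using prob_not_concentrated_graph[OF er _ _ S_sub e] pN[of N] by (simp add: Z(2) Y_def q_def)
      also have "\<dots> \<le> 4 * (real N)\<^sup>2 * exp (- (3 * ln (real N)))"
      proof -
        have "12 \<le> e\<^sup>2 * w N" using elim(1) e by (simp add: field_simps)
        then have "12 * ln (real N) \<le> e\<^sup>2 * w N * ln (real N)"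
          using elim(3) by (intro mult_right_mono) auto
        then show ?thesis by (simp add: elim(2) mult_left_mono mult.assoc)
      qed
      also have "exp (- (3 * ln (real N))) = inverse (real N ^ 3)"
        using elim(3) exp_of_nat_mult[of 3 "ln (real N)"] by (simp add: exp_minus)
      also have "4 * (real N)\<^sup>2 * inverse (real N ^ 3) = 4 * inverse (real N)"
        using elim(3) by (simp add: field_simps power2_eq_square power3_eq_cube)
      finally show ?case by simp
    qed
  qed simp
  have p: "0 \<le> p" "p \<le> 1"
    using LIMSEQ_le_const[OF assms(22), of 0] LIMSEQ_le_const2[OF assms(22), of 1] pN by auto
  obtain C where C: "0 \<le> C"
    and entries: "\<And>V S A g q \<epsilon> R0 R1 i j. concentrated_diffusion V S A g q \<kappa> \<rho> p \<xi> \<epsilon> \<Longrightarrow>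
      (\<And>i j. i \<in> V \<Longrightarrow> j \<in> V \<Longrightarrow> A j i = A i j) \<Longrightarrow>
      (\<And>i j. i \<in> V \<Longrightarrow> j \<in> V \<Longrightarrow>
        R0 i j = \<sigma>\<^sup>2 * of_bool (i = j) + mat_mult_on V A (mat_mult_on V R0 A) i j) \<Longrightarrow>
      (\<And>i j. i \<in> V \<Longrightarrow> j \<in> V \<Longrightarrow> R0 j i = R0 i j) \<Longrightarrow>
      (\<And>i j. i \<in> V \<Longrightarrow> j \<in> V \<Longrightarrow> R1 i j = mat_mult_on V A R0 i j) \<Longrightarrow>
      i \<in> S \<Longrightarrow> j \<in> S \<Longrightarrow> i \<noteq> j \<Longrightarrow>
      \<bar>q * granger_est S R0 R1 i j - (\<kappa> * of_bool (g i j)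
        + \<kappa>\<^sup>2 * p * ((2 * \<rho> - \<kappa>) * (1 - \<xi>) / (1 - (\<rho>\<^sup>2 - 2 * \<rho> * \<kappa> * \<xi> + \<kappa>\<^sup>2 * \<xi>))))\<bar> \<le> C * \<epsilon> \<and>
      \<bar>q * onelag_est S R0 R1 i j - (\<sigma>\<^sup>2 * \<kappa> * ((1 + (\<rho> - \<kappa>)\<^sup>2) / (1 - (\<rho> - \<kappa>)\<^sup>2)\<^sup>2) * of_bool (g i j)
        + \<sigma>\<^sup>2 * \<kappa>\<^sup>2 * p * ((\<rho> + \<rho> * (\<rho> - \<kappa>)\<^sup>2 + 2 * (\<rho> - \<kappa>)) / ((1 - \<rho>\<^sup>2) * (1 - (\<rho> - \<kappa>)\<^sup>2)\<^sup>2)))\<bar> \<le> C * \<epsilon> \<and>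
      \<bar>q * residual_est S R0 R1 i j - (\<sigma>\<^sup>2 * \<kappa> / (1 + \<rho> - \<kappa>)\<^sup>2 * of_bool (g i j)
        + - (\<sigma>\<^sup>2 * \<kappa>\<^sup>2 * p / ((1 + \<rho>) * (1 + \<rho> - \<kappa>)\<^sup>2)))\<bar> \<le> C * \<epsilon>"
    by (rule estimator_entries[of \<kappa> \<rho> \<xi> "\<sigma>\<^sup>2" p]) (use assms in auto)
  have approx: "\<exists>H. (\<forall>N. H N \<in> sets (M N)) \<and> (\<lambda>N. measure (M N) (H N)) \<longlonglongrightarrow> 1 \<and>
      (\<forall>\<^sub>F N in sequentially. \<forall>\<omega>\<in>H N. \<forall>i\<in>S N. \<forall>j\<in>S N. i \<noteq> j \<longrightarrow>
      \<bar>real N * pN N * granger_est (S N) (R0 N \<omega>) (R1 N \<omega>) i j - (\<kappa> * of_bool (G N \<omega> i j)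
        + \<kappa>\<^sup>2 * p * ((2 * \<rho> - \<kappa>) * (1 - \<xi>) / (1 - (\<rho>\<^sup>2 - 2 * \<rho> * \<kappa> * \<xi> + \<kappa>\<^sup>2 * \<xi>))))\<bar> \<le> \<delta> \<and>
      \<bar>real N * pN N * onelag_est (S N) (R0 N \<omega>) (R1 N \<omega>) i j - (\<sigma>\<^sup>2 * \<kappa> * ((1 + (\<rho> - \<kappa>)\<^sup>2) / (1 - (\<rho> - \<kappa>)\<^sup>2)\<^sup>2) * of_bool (G N \<omega> i j)
        + \<sigma>\<^sup>2 * \<kappa>\<^sup>2 * p * ((\<rho> + \<rho> * (\<rho> - \<kappa>)\<^sup>2 + 2 * (\<rho> - \<kappa>)) / ((1 - \<rho>\<^sup>2) * (1 - (\<rho> - \<kappa>)\<^sup>2)\<^sup>2)))\<bar> \<le> \<delta> \<and>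
      \<bar>real N * pN N * residual_est (S N) (R0 N \<omega>) (R1 N \<omega>) i j - (\<sigma>\<^sup>2 * \<kappa> / (1 + \<rho> - \<kappa>)\<^sup>2 * of_bool (G N \<omega> i j)
        + - (\<sigma>\<^sup>2 * \<kappa>\<^sup>2 * p / ((1 + \<rho>) * (1 + \<rho> - \<kappa>)\<^sup>2)))\<bar> \<le> \<delta>)" (is "\<exists>H. _ \<and> _ \<and> eventually (?near H) _")
    if "0 < \<delta>" for \<delta>
  proof -
    \<comment> \<open>The diffusion matrix is concentrated with \<epsilon> = 50 * e, so the entry
      error is C * 50 * e \<le> \<delta>; C + 1 guards against C = 0.\<close>
    define e where "e = min (1 / 50) (\<delta> / (50 * (C + 1)))"
    have e_le: "e \<le> 1 / 50" "e \<le> \<delta> / (50 * (C + 1))"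
      unfolding e_def by (rule min.cobounded1, rule min.cobounded2)
    have "0 < e" using \<open>0 < \<delta>\<close> C by (auto simp: e_def)
    note e = this e_le(1) order_trans[OF e_le(1), of 2, simplified]
    have "C * (50 * e) \<le> (C + 1) * (50 * (\<delta> / (50 * (C + 1))))"
      using C e(1) e_le(2) by (intro mult_mono mult_left_mono) auto
    also have "\<dots> = \<delta>"
    proof -
      have "K * (50 * (\<delta> / (50 * K))) = \<delta>" if "K \<noteq> 0" for K :: real using that by simp
      then show ?thesis using C by (metis add.commute add_nonneg_eq_0_iff zero_le_one zero_neq_one)
    qed
    finally have C_le: "C * (50 * e) \<le> \<delta>" .
    have p_ev: "\<forall>\<^sub>F N in sequentially. \<bar>pN N - p\<bar> < e"
      using tendstoD[OF assms(22) e(1)] by (simp add: dist_real_def)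
    have \<xi>_ev: "\<forall>\<^sub>F N in sequentially. \<bar>real (card (S N)) / real N - \<xi>\<bar> < e"
      using tendstoD[OF assms(19) e(1)] by (simp add: dist_real_def)
    have q_ev: "\<forall>\<^sub>F N in sequentially. 1 / e \<le> q N"
      using q_top by (simp add: filterlim_at_top)
    have "eventually (?near (H e)) sequentially"
      using p_ev \<xi>_ev q_ev eventually_ge_at_top[of 1]
    proof (eventually_elim, intro ballI impI)
      fix N \<omega> i j
      assume N: "\<bar>pN N - p\<bar> < e" "\<bar>real (card (S N)) / real N - \<xi>\<bar> < e" "1 / e \<le> q N" "1 \<le> N"
        and \<omega>: "\<omega> \<in> H e N" and ij: "i \<in> S N" "j \<in> S N" "i \<noteq> j"
      have sp: "\<omega> \<in> space (M N)" and conc: "concentrated_graph N (S N) (pN N) e (G N \<omega>)"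
        and pos: "measure (M N) (atom N \<omega>) \<noteq> 0"
        using \<omega> by (auto simp: H_def)
      interpret prob_space "M N" by (rule ps)
      have pos': "0 < prob {\<omega>' \<in> space (M N). \<forall>i\<in>{1..N}. \<forall>j\<in>{1..N}. A N \<omega>' i j = A N \<omega> i j}"
        using pos unfolding atom_def by (simp add: zero_less_measure_iff)
      have A_sym: "A N \<omega> j i = A N \<omega> i j" and A_nonneg: "0 \<le> A N \<omega> i j"
        if "i \<in> {1..N}" "j \<in> {1..N}" for i j
        using reg[OF sp] that unfolding regular_diffusion_def by blast+
      have A_row: "(\<Sum>l\<in>{1..N}. \<bar>A N \<omega> i l\<bar>) \<le> \<rho>" if "i \<in> {1..N}" for i
      proof -
        have "(\<Sum>l\<in>{1..N}. A N \<omega> i l) = \<rho>"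
          using reg[OF sp] that unfolding regular_diffusion_def by blast
        then show ?thesis using A_nonneg[OF that] by simp
      qed
      note corr = stationary_correlations[OF assms(10-12) A_eq pos' A_sym A_row assms(6),
          folded assms(13,14)]
      have eq: "1 \<le> e * q N" using N(3) e(1) by (simp add: field_simps)
      have cd: "concentrated_diffusion {1..N} (S N) (A N \<omega>) (G N \<omega>) (q N) \<kappa> \<rho> p \<xi> (50 * e)"
      proof (rule concentrated_diffusionI[OF \<open>1 \<le> N\<close> S_sub er_sym[OF sp] reg[OF sp] assms(4-6) _ _ q_def e(1,2) eq])
        show "\<bar>(\<Sum>l\<in>T - {i, j}. of_bool (G N \<omega> i l \<and> G N \<omega> l j))
            - real (card (T - {i, j})) * (if i = j then pN N else (pN N)\<^sup>2)\<bar> < e * q N"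
          if "i \<in> {1..N}" "j \<in> {1..N}" "T \<in> {S N, {1..N} - S N}" for i j T
          using conc that unfolding concentrated_graph_def q_def by blast
      qed (use N p assms(17,18) pN[of N] in simp_all)
      show "\<bar>real N * pN N * granger_est (S N) (R0 N \<omega>) (R1 N \<omega>) i j - (\<kappa> * of_bool (G N \<omega> i j)
        + \<kappa>\<^sup>2 * p * ((2 * \<rho> - \<kappa>) * (1 - \<xi>) / (1 - (\<rho>\<^sup>2 - 2 * \<rho> * \<kappa> * \<xi> + \<kappa>\<^sup>2 * \<xi>))))\<bar> \<le> \<delta> \<and>
      \<bar>real N * pN N * onelag_est (S N) (R0 N \<omega>) (R1 N \<omega>) i j - (\<sigma>\<^sup>2 * \<kappa> * ((1 + (\<rho> - \<kappa>)\<^sup>2) / (1 - (\<rho> - \<kappa>)\<^sup>2)\<^sup>2) * of_bool (G N \<omega> i j)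
        + \<sigma>\<^sup>2 * \<kappa>\<^sup>2 * p * ((\<rho> + \<rho> * (\<rho> - \<kappa>)\<^sup>2 + 2 * (\<rho> - \<kappa>)) / ((1 - \<rho>\<^sup>2) * (1 - (\<rho> - \<kappa>)\<^sup>2)\<^sup>2)))\<bar> \<le> \<delta> \<and>
      \<bar>real N * pN N * residual_est (S N) (R0 N \<omega>) (R1 N \<omega>) i j - (\<sigma>\<^sup>2 * \<kappa> / (1 + \<rho> - \<kappa>)\<^sup>2 * of_bool (G N \<omega> i j)
        + - (\<sigma>\<^sup>2 * \<kappa>\<^sup>2 * p / ((1 + \<rho>) * (1 + \<rho> - \<kappa>)\<^sup>2)))\<bar> \<le> \<delta>"
        using entries[OF cd A_sym corr ij, unfolded q_def] C_le by (blast intro: order_trans)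
    qed
    then show ?thesis using H_ev H_prob[OF e(1,3)] by blast
  qed
  \<comment> \<open>The conditional law depends on the outcome only through \<pi>(G), so R0 and R1
    factor through the graph, including on null atoms. This supplies the measurability of the
    margins.\<close>
  define r0 where "r0 N g i j = lim (\<lambda>n. \<integral>\<omega>'. y N n \<omega>' i * y N n \<omega>' j
      \<partial>uniform_measure (M N) {\<omega>'\<in>space (M N). \<forall>i\<in>{1..N}. \<forall>j\<in>{1..N}. A N \<omega>' i j = \<pi> N g i j})" for N g i j
  define r1 where "r1 N g i j = lim (\<lambda>n. \<integral>\<omega>'. y N n \<omega>' i * y N (n - 1) \<omega>' j
      \<partial>uniform_measure (M N) {\<omega>'\<in>space (M N). \<forall>i\<in>{1..N}. \<forall>j\<in>{1..N}. A N \<omega>' i j = \<pi> N g i j})" for N g i j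
  have r: "R0 N \<omega> = r0 N (G N \<omega>)" "R1 N \<omega> = r1 N (G N \<omega>)" for N \<omega>
    by (simp_all add: fun_eq_iff assms(13,14) corr0_def corr1_def law_given_def r0_def r1_def A_eq)
  have fin: "finite (S N)" for N using S_sub finite_subset by blast
  have edge: "(0 < A N \<omega> i j \<longleftrightarrow> G N \<omega> i j) \<and> (A N \<omega> i j = 0 \<longleftrightarrow> \<not> G N \<omega> i j)"
    if "\<omega> \<in> space (M N)" "i \<in> S N" "j \<in> S N" "i \<noteq> j" for N \<omega> i j
    using regular_diffusion_pos_iff[OF reg[OF that(1)] assms(4), of i j] that S_sub[of N] by blast
  note consistencyI = universal_local_consistencyI[where G = G and \<pi> = \<pi>, OF ps meas A_eq _ fin assms(16) _ edge]
  have \<Gamma>_pos: "0 < \<sigma>\<^sup>2 * \<kappa> * ((1 + (\<rho> - \<kappa>)\<^sup>2) / (1 - (\<rho> - \<kappa>)\<^sup>2)\<^sup>2)" "0 < \<sigma>\<^sup>2 * \<kappa> / (1 + \<rho> - \<kappa>)\<^sup>2"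
  proof -
    have "(\<rho> - \<kappa>)\<^sup>2 < 1" using assms(4-6) by (intro power_less_one_iff[THEN iffD2]) auto
    moreover have "0 < 1 + (\<rho> - \<kappa>)\<^sup>2" by (simp add: add_pos_nonneg)
    ultimately show "0 < \<sigma>\<^sup>2 * \<kappa> * ((1 + (\<rho> - \<kappa>)\<^sup>2) / (1 - (\<rho> - \<kappa>)\<^sup>2)\<^sup>2)"
      using assms(4,9) by (intro mult_pos_pos divide_pos_pos) auto
    show "0 < \<sigma>\<^sup>2 * \<kappa> / (1 + \<rho> - \<kappa>)\<^sup>2"
      using assms(4-6,9) by (intro mult_pos_pos divide_pos_pos) auto
  qed
  show ?thesis
  proof (intro conjI)
    show "universal_local_consistency M A S (\<lambda>N \<omega>. granger_est (S N) (R0 N \<omega>) (R1 N \<omega>))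
           (\<lambda>N. real N * pN N)
           (\<kappa>\<^sup>2 * p * ((2 * \<rho> - \<kappa>) * (1 - \<xi>) / (1 - (\<rho>\<^sup>2 - 2 * \<rho> * \<kappa> * \<xi> + \<kappa>\<^sup>2 * \<xi>))))
           \<kappa>"
    proof (rule consistencyI[where E = "\<lambda>N g. granger_est (S N) (r0 N g) (r1 N g)"])
      fix \<delta> :: real assume "0 < \<delta>"
      from approx[OF this] show "\<exists>H. (\<forall>N. H N \<in> sets (M N)) \<and> (\<lambda>N. measure (M N) (H N)) \<longlonglongrightarrow> 1 \<and>
        (\<forall>\<^sub>F N in sequentially. \<forall>\<omega>\<in>H N. \<forall>i\<in>S N. \<forall>j\<in>S N. i \<noteq> j \<longrightarrow>
        \<bar>real N * pN N * granger_est (S N) (R0 N \<omega>) (R1 N \<omega>) i j - (\<kappa> * of_bool (G N \<omega> i j)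
        + \<kappa>\<^sup>2 * p * ((2 * \<rho> - \<kappa>) * (1 - \<xi>) / (1 - (\<rho>\<^sup>2 - 2 * \<rho> * \<kappa> * \<xi> + \<kappa>\<^sup>2 * \<xi>))))\<bar> \<le> \<delta>)"
        by (elim exE conjE, intro exI conjI) (assumption, assumption, erule eventually_mono, blast)
    qed (use r assms(4) in auto)
    show "universal_local_consistency M A S (\<lambda>N \<omega>. onelag_est (S N) (R0 N \<omega>) (R1 N \<omega>))
           (\<lambda>N. real N * pN N)
           (\<sigma>\<^sup>2 * \<kappa>\<^sup>2 * p *
             ((\<rho> + \<rho> * (\<rho> - \<kappa>)\<^sup>2 + 2 * (\<rho> - \<kappa>)) / ((1 - \<rho>\<^sup>2) * (1 - (\<rho> - \<kappa>)\<^sup>2)\<^sup>2)))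
           (\<sigma>\<^sup>2 * \<kappa> * ((1 + (\<rho> - \<kappa>)\<^sup>2) / (1 - (\<rho> - \<kappa>)\<^sup>2)\<^sup>2))"
    proof (rule consistencyI[where E = "\<lambda>N g. onelag_est (S N) (r0 N g) (r1 N g)"])
      fix \<delta> :: real assume "0 < \<delta>"
      from approx[OF this] show "\<exists>H. (\<forall>N. H N \<in> sets (M N)) \<and> (\<lambda>N. measure (M N) (H N)) \<longlonglongrightarrow> 1 \<and>
        (\<forall>\<^sub>F N in sequentially. \<forall>\<omega>\<in>H N. \<forall>i\<in>S N. \<forall>j\<in>S N. i \<noteq> j \<longrightarrow>
        \<bar>real N * pN N * onelag_est (S N) (R0 N \<omega>) (R1 N \<omega>) i j - (\<sigma>\<^sup>2 * \<kappa> * ((1 + (\<rho> - \<kappa>)\<^sup>2) / (1 - (\<rho> - \<kappa>)\<^sup>2)\<^sup>2) * of_bool (G N \<omega> i j)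
        + \<sigma>\<^sup>2 * \<kappa>\<^sup>2 * p * ((\<rho> + \<rho> * (\<rho> - \<kappa>)\<^sup>2 + 2 * (\<rho> - \<kappa>)) / ((1 - \<rho>\<^sup>2) * (1 - (\<rho> - \<kappa>)\<^sup>2)\<^sup>2)))\<bar> \<le> \<delta>)"
        by (elim exE conjE, intro exI conjI) (assumption, assumption, erule eventually_mono, blast)
    qed (use r \<Gamma>_pos in auto)
    show "universal_local_consistency M A S (\<lambda>N \<omega>. residual_est (S N) (R0 N \<omega>) (R1 N \<omega>))
           (\<lambda>N. real N * pN N)
           (- (\<sigma>\<^sup>2 * \<kappa>\<^sup>2 * p / ((1 + \<rho>) * (1 + \<rho> - \<kappa>)\<^sup>2)))
           (\<sigma>\<^sup>2 * \<kappa> / (1 + \<rho> - \<kappa>)\<^sup>2)"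
    proof (rule consistencyI[where E = "\<lambda>N g. residual_est (S N) (r0 N g) (r1 N g)"])
      fix \<delta> :: real assume "0 < \<delta>"
      from approx[OF this] show "\<exists>H. (\<forall>N. H N \<in> sets (M N)) \<and> (\<lambda>N. measure (M N) (H N)) \<longlonglongrightarrow> 1 \<and>
        (\<forall>\<^sub>F N in sequentially. \<forall>\<omega>\<in>H N. \<forall>i\<in>S N. \<forall>j\<in>S N. i \<noteq> j \<longrightarrow>
        \<bar>real N * pN N * residual_est (S N) (R0 N \<omega>) (R1 N \<omega>) i j - (\<sigma>\<^sup>2 * \<kappa> / (1 + \<rho> - \<kappa>)\<^sup>2 * of_bool (G N \<omega> i j)
        + - (\<sigma>\<^sup>2 * \<kappa>\<^sup>2 * p / ((1 + \<rho>) * (1 + \<rho> - \<kappa>)\<^sup>2)))\<bar> \<le> \<delta>)"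
        by (elim exE conjE, intro exI conjI) (assumption, assumption, erule eventually_mono, blast)
    qed (use r \<Gamma>_pos in auto)
  qed
qed

end
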